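(* There is an isomorphism of strict $\mathbb{C}$-linear monoidal supercategories $\mathcal{F}\colon \mathcal{TAS}(\mathrm{Cl})\to\mathcal{TAH}(\mathrm{Cl})$ which sends the object $\mathsf{I}$ to $\mathsf{I}$ and each $Q\in\mathcal{E}_{\mathrm{OPol}_1}$ to $\psi(Q)\in\mathcal{E}_{\mathrm{Pol}_1(\mathrm{Cl})}$, and is given on generating morphisms by $$\mathcal{F}(C)=C,\quad \mathcal{F}(X)=\tfrac{1}{\sqrt{-2}}\,C\circ X,\quad \mathcal{F}(T)=-\tfrac{1}{\sqrt{-2}}\,(C\otimes 1_{\mathsf I}-1_{\mathsf I}\otimes C)\circ T,\quad \mathcal{F}(R_Q)=R_{\psi(Q)},\quad \mathcal{F}(L_Q)=L_{\psi(Q)}$$ for all $Q\in\mathcal{E}_{\mathrm{OPol}_1}$. Its inverse $\mathcal{G}\colon\mathcal{TAH}(\mathrm{Cl})\to\mathcal{TAS}(\mathrm{Cl})$ sends $\mathsf{I}$ to $\mathsf{I}$ and each $Q\in\mathcal{E}_{\mathrm{Pol}_1(\mathrm{Cl})}$ to $\psi^{-1}(Q)\in\mathcal{E}_{\mathrm{OPol}_1}$, and is given by $$\mathcal{G}(C)=C,\quad \mathcal{G}(X)=\sqrt{-2}\,C\circ X,\quad \mathcal{G}(T)=\tfrac{1}{\sqrt{-2}}\,(C\otimes 1_{\mathsf I}-1_{\mathsf I}\otimes C)\circ T,\quad \mathcal{G}(R_Q)=R_{\psi^{-1}(Q)},\quad \mathcal{G}(L_Q)=L_{\psi^{-1}(Q)}$$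 for all $Q\in\mathcal{E}_{\mathrm{Pol}_1(\mathrm{Cl})}$.
   Context: Conventions. The ground field is $\mathbb{C}$; superalgebras are associative and $\mathbb{Z}/2$-graded; $\bar a$ denotes parity; $\sqrt{-2}$ is a fixed square root of $-2$. Elements $a,b$ of a superalgebra (super)commute if $ab=(-1)^{\bar a\bar b}ba$; central elements are taken in this sense. For a superalgebra $A$, $\mathcal{E}_A$ is the set of elements of $A$ that are even, central and regular (neither left nor right zero-divisors), and $\widehat{\mathcal{E}}_A=\mathcal{E}_A\cup\{\mathsf I\}$ with $\mathsf I$ a formal symbol. In a strict monoidal supercategory, morphisms satisfy the super interchange law $(f'\otimes g)\circ(f\otimes g')=(-1)^{\bar f\bar g}(f'\circ f)\otimes(g\circ g')$. String diagrams are translated into algebra: $f\circ g$ means $f$ above $g$, and $f\otimes g=(f\otimes 1)\circ(1\otimes g)$. Polynomial superalgebras. $\mathrm{OPol}_n$ is the superalgebra on odd generators $x_1,\dots,x_n$ with $x_ix_j=-x_jx_i$ for $i\ne j$. $\mathrm{OPol}_n(\mathrm{Cl})$ is the superalgebra on odd generators $c_1,\dots,c_n,x_1,\dots,x_n$ with $c_i^2=1$, $c_ic_j=-c_jc_i$ and $x_ix_j=-x_jx_i$ for $i\neq j$, and $c_ix_j=-x_jc_i$ for all $i,j$. $\mathrm{Pol}_n(\mathrm{Cl})$ is the superalgebra on odd generators $c_1,\dots,c_n$ and even generators $x_1,\dots,x_n$ with $c_i^2=1$, $c_ix_i=-x_ic_i$, $c_ic_j=-c_jc_i$ and $c_ix_j=x_jc_i$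 for $i\ne j$, and $x_ix_j=x_jx_i$. For $n=1$ write $x=x_1$, $c=c_1$. One has $\mathcal{E}_{\mathrm{OPol}_1}=\mathbb{C}[x^2]\setminus 0$ and $\mathcal{E}_{\mathrm{Pol}_1(\mathrm{Cl})}=\mathbb{C}[x^2]\setminus 0$. The superalgebra isomorphism $\psi\colon\mathrm{OPol}_1(\mathrm{Cl})\to\mathrm{Pol}_1(\mathrm{Cl})$ is $c\mapsto c$, $x\mapsto\frac{1}{\sqrt{-2}}cx$ (so $x^2\mapsto \frac12x^2$); it restricts to a bijection $\mathcal{E}_{\mathrm{OPol}_1}\to\mathcal{E}_{\mathrm{Pol}_1(\mathrm{Cl})}$. For $Q=Q(x)$, write $Q_1=Q(x_1)$ in the two-variable algebra. Demazure operators. Let $s$ be the automorphism swapping the indices $1,2$. $D\colon\mathrm{OPol}_2\to\mathrm{OPol}_2$ is the parity-reversing linear operator with $D(1)=0$, $D(x_1)=D(x_2)=1$, $D(fg)=D(f)g+(-1)^{\bar f}s(f)D(g)$. $\partial\colon\mathrm{Pol}_2(\mathrm{Cl})\to\mathrm{Pol}_2(\mathrm{Cl})$ is the linear operator vanishing on the subalgebra generated by $c_1,c_2$ with $\partial(x_1)=1+c_1c_2$, $\partial(x_2)=-1+c_1c_2$, $\partial(fg)=\partial(f)g+s(f)\partial(g)$. The supercategory $\mathcal{TAS}(\mathrm{Cl})$: the strict $\mathbb{C}$-linear monoidal supercategory whose objects are generated by $\widehat{\mathcal{E}}_{\mathrm{OPol}_1}$ (so objects are words), with odd generating morphisms $T\colon\mathsf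 I\otimes\mathsf I\to\mathsf I\otimes\mathsf I$ (crossing), $X\colon\mathsf I\to\mathsf I$ (dot), $C\colon\mathsf I\to\mathsf I$ (Clifford token), and even generating morphisms $R_Q\colon Q\otimes\mathsf I\to\mathsf I\otimes Q$, $L_Q\colon\mathsf I\otimes Q\to Q\otimes\mathsf I$ for all $Q\in\mathcal{E}_{\mathrm{OPol}_1}$, subject to (writing $1$ for $1_{\mathsf I}$, and $1_Q$ for the identity of $Q$): (1) $T\circ T=1\otimes1$; $(T\otimes1)(1\otimes T)(T\otimes1)=(1\otimes T)(T\otimes1)(1\otimes T)$; (2) $T(X\otimes1)+(1\otimes X)T=1\otimes1$; (3) $L_Q(X\otimes1_Q)=(1_Q\otimes X)L_Q$; $R_Q(1_Q\otimes X)=(X\otimes1_Q)R_Q$; (4) $R_QL_Q=Q(X)\otimes1_Q$; $L_QR_Q=1_Q\otimes Q(X)$; (5) $(T\otimes1_Q)(1\otimes R_Q)(R_Q\otimes1)=(1\otimes R_Q)(R_Q\otimes1)(1_Q\otimes T)$; $(L_Q\otimes1)(1\otimes L_Q)(T\otimes1_Q)=(1_Q\otimes T)(L_Q\otimes1)(1\otimes L_Q)$; (6) $(R_Q\otimes1)(1_Q\otimes T)(L_Q\otimes1)=(1\otimes L_Q)(T\otimes1_Q)(1\otimes R_Q)+D(Q_1)_{\mathrm{pin}}$, where for $f=\sum\lambda_{r,s}x_1^rx_2^s\in\mathrm{OPol}_2$, $f_{\mathrm{pin}}=\sum\lambda_{r,s}X^r\otimes1_Q\otimes X^s$; (7) $C\circ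 C=1$; $CX=-XC$; (8) $T(C\otimes1)=-(C\otimes1)T$; $T(1\otimes C)=-(1\otimes C)T$; (9) $L_Q(C\otimes1_Q)=(1_Q\otimes C)L_Q$; $R_Q(1_Q\otimes C)=(C\otimes1_Q)R_Q$. The supercategory $\mathcal{TAH}(\mathrm{Cl})$: the strict $\mathbb{C}$-linear monoidal supercategory whose objects are generated by $\widehat{\mathcal{E}}_{\mathrm{Pol}_1(\mathrm{Cl})}$, with generating morphisms $T\colon\mathsf I\otimes\mathsf I\to\mathsf I\otimes\mathsf I$ (even), $X\colon\mathsf I\to\mathsf I$ (even), $C\colon\mathsf I\to\mathsf I$ (odd), $R_Q\colon Q\otimes\mathsf I\to\mathsf I\otimes Q$ (even), $L_Q\colon\mathsf I\otimes Q\to Q\otimes\mathsf I$ (even) for $Q\in\mathcal{E}_{\mathrm{Pol}_1(\mathrm{Cl})}$, subject to: $C\circ C=1$; $CX=-XC$; $T\circ T=1\otimes1$; the braid relation in (1); $T(C\otimes1)=(1\otimes C)T$; $T(X\otimes1)=(1\otimes X)T-1\otimes1-C\otimes C$; the relations (3), (4), (5), (9) (with these generators and $Q\in\mathcal{E}_{\mathrm{Pol}_1(\mathrm{Cl})}$); and $(R_Q\otimes1)(1_Q\otimes T)(L_Q\otimes1)=(1\otimes L_Q)(T\otimes1_Q)(1\otimes R_Q)-\partial(Q_1)_{\mathrm{pin}}$, where $(c_1^ac_2^bx_1^rx_2^s)_{\mathrm{pin}}=(C^aX^r)\otimes1_Q\otimes(C^bX^s)$, extended linearly to $\mathrm{Pol}_2(\mathrm{Cl})$.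 *)

theory Defs
  imports Complex_Main "HOL-Library.Z2"
begin

section \<open>Superalgebras given by generators and relations\<close>

text \<open>Parities are elements of the two-element field \<^typ>\<open>bit\<close>.\<close>

definition sign :: "bit \<Rightarrow> complex" where
  "sign p = (if p = 0 then 1 else -1)"

datatype 'g fa =
    Gen 'g | One | Zero | Plus "'g fa" "'g fa" | Times "'g fa" "'g fa" | Scale complex "'g fa"

text \<open>An instance of the following class is a type of generators together with their parities
  and the defining relations (which should be homogeneous). This makes the presented superalgebra
  a type depending on the type of generators.\<close>

class presentation =
  fixes gen_parity :: "'a \<Rightarrow> bit"
    and gen_rel :: "'a fa \<Rightarrow> 'a fa \<Rightarrow> bool"

inductive fa_eq :: "'g::presentation fa \<Rightarrow> 'g fa \<Rightarrow> bool" where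
  fa_rel: "gen_rel s t \<Longrightarrow> fa_eq s t"
| fa_refl: "fa_eq t t"
| fa_sym: "fa_eq s t \<Longrightarrow> fa_eq t s"
| fa_trans: "fa_eq s t \<Longrightarrow> fa_eq t u \<Longrightarrow> fa_eq s u"
| fa_plus_cong: "fa_eq s s' \<Longrightarrow> fa_eq t t' \<Longrightarrow> fa_eq (Plus s t) (Plus s' t')"
| fa_times_cong: "fa_eq s s' \<Longrightarrow> fa_eq t t' \<Longrightarrow> fa_eq (Times s t) (Times s' t')"
| fa_scale_cong: "fa_eq t t' \<Longrightarrow> fa_eq (Scale z t) (Scale z t')"
| fa_plus_assoc: "fa_eq (Plus (Plus s t) u) (Plus s (Plus t u))"
| fa_plus_comm: "fa_eq (Plus s t) (Plus t s)"
| fa_plus_zero: "fa_eq (Plus Zero t) t"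
| fa_plus_neg: "fa_eq (Plus (Scale (-1) t) t) Zero"
| fa_scale_plus: "fa_eq (Scale z (Plus s t)) (Plus (Scale z s) (Scale z t))"
| fa_plus_scale: "fa_eq (Scale (z + z') t) (Plus (Scale z t) (Scale z' t))"
| fa_scale_scale: "fa_eq (Scale z (Scale z' t)) (Scale (z * z') t)"
| fa_scale_one: "fa_eq (Scale 1 t) t"
| fa_times_assoc: "fa_eq (Times (Times s t) u) (Times s (Times t u))"
| fa_one_times: "fa_eq (Times One t) t"
| fa_times_one: "fa_eq (Times t One) t"
| fa_plus_times: "fa_eq (Times (Plus s t) u) (Plus (Times s u) (Times t u))"
| fa_times_plus: "fa_eq (Times u (Plus s t)) (Plus (Times u s) (Times u t))"
| fa_scale_times: "fa_eq (Times (Scale z s) t) (Scale z (Times s t))"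
| fa_times_scale: "fa_eq (Times s (Scale z t)) (Scale z (Times s t))"

quotient_type (overloaded) 'g salg = "'g::presentation fa" / fa_eq
  by (intro equivpI reflpI sympI transpI) (blast intro: fa_eq.intros)+

instantiation salg :: (presentation) "{ring, monoid_mult}"
begin

lift_definition zero_salg :: "'a salg" is Zero .
lift_definition one_salg :: "'a salg" is One .
lift_definition plus_salg :: "'a salg \<Rightarrow> 'a salg \<Rightarrow> 'a salg" is Plus by (rule fa_plus_cong)
lift_definition times_salg :: "'a salg \<Rightarrow> 'a salg \<Rightarrow> 'a salg" is Times by (rule fa_times_cong)
lift_definition uminus_salg :: "'a salg \<Rightarrow> 'a salg" is "Scale (-1)" by (rule fa_scale_cong)
lift_definition minus_salg :: "'a salg \<Rightarrow> 'a salg \<Rightarrow> 'a salg" is "\<lambda>s t. Plus s (Scale (-1) t)"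
  by (intro fa_plus_cong fa_scale_cong)

instance
  by standard (transfer, blast intro: fa_eq.intros)+

end

lift_definition csc :: "complex \<Rightarrow> 'g::presentation salg \<Rightarrow> 'g salg" is Scale
  by (rule fa_scale_cong)

lift_definition sgen :: "'g::presentation \<Rightarrow> 'g salg" is Gen .

inductive homogeneous :: "bit \<Rightarrow> 'g::presentation salg \<Rightarrow> bool" where
  homogeneous_gen: "homogeneous (gen_parity g) (sgen g)"
| homogeneous_one: "homogeneous 0 1"
| homogeneous_zero: "homogeneous p 0"
| homogeneous_plus: "homogeneous p a \<Longrightarrow> homogeneous p b \<Longrightarrow> homogeneous p (a + b)"
| homogeneous_csc: "homogeneous p a \<Longrightarrow> homogeneous p (csc z a)"
| homogeneous_times: "homogeneous p a \<Longrightarrow> homogeneous q b \<Longrightarrow> homogeneous (p + q) (a * b)"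

inductive_set subalg :: "'g::presentation salg set \<Rightarrow> 'g salg set" for S where
  "a \<in> S \<Longrightarrow> a \<in> subalg S"
| "1 \<in> subalg S"
| "0 \<in> subalg S"
| "a \<in> subalg S \<Longrightarrow> b \<in> subalg S \<Longrightarrow> a + b \<in> subalg S"
| "a \<in> subalg S \<Longrightarrow> csc z a \<in> subalg S"
| "a \<in> subalg S \<Longrightarrow> b \<in> subalg S \<Longrightarrow> a * b \<in> subalg S"

definition supercentral :: "bit \<Rightarrow> 'g::presentation salg \<Rightarrow> bool" where
  "supercentral p a \<longleftrightarrow>
     homogeneous p a \<and> (\<forall>q b. homogeneous q b \<longrightarrow> a * b = csc (sign (p * q)) (b * a))"

definition regular :: "'g::presentation salg \<Rightarrow> bool" where
  "regular a \<longleftrightarrow> (\<forall>b. a * b = 0 \<longrightarrow> b = 0) \<and> (\<forall>b. b * a = 0 \<longrightarrow> b = 0)"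

definition EE :: "'g::presentation salg set" where
  "EE = {a. homogeneous 0 a \<and> supercentral 0 a \<and> regular a}"

primrec fa_eval :: "('g \<Rightarrow> 'h::presentation salg) \<Rightarrow> 'g fa \<Rightarrow> 'h salg" where
  "fa_eval \<phi> (Gen g) = \<phi> g"
| "fa_eval \<phi> One = 1"
| "fa_eval \<phi> Zero = 0"
| "fa_eval \<phi> (Plus s t) = fa_eval \<phi> s + fa_eval \<phi> t"
| "fa_eval \<phi> (Times s t) = fa_eval \<phi> s * fa_eval \<phi> t"
| "fa_eval \<phi> (Scale z t) = csc z (fa_eval \<phi> t)"

text \<open>The algebra homomorphism with prescribed values on the generators. The choice of the
  representative is irrelevant if these values satisfy the defining relations, see \<open>alg_ext\<close>
  below.\<close>

definition alg_ext :: "('g::presentation \<Rightarrow> 'h::presentation salg) \<Rightarrow> 'g salg \<Rightarrow> 'h salg" where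
  "alg_ext \<phi> a = fa_eval \<phi> (rep_salg a)"

lemma csc_simps [simp]:
  "csc z (a + b) = csc z a + csc z b"
  "csc z (csc z' a) = csc (z * z') a"
  "csc 1 a = a"
  "csc z a * b = csc z (a * b)"
  "a * csc z b = csc z (a * b)"
  by (transfer, blast intro: fa_eq.intros)+

lemma csc_plus: "csc (z + z') a = csc z a + csc z' a"
  by transfer (rule fa_plus_scale)

lemma csc_minus_one: "csc (-1) a = - a"
  by transfer (rule fa_refl)

lemma csc_0_left [simp]: "csc 0 a = 0"
  using csc_plus[of 0 0 a] by simp

lemma csc_0_right [simp]: "csc z 0 = 0"
  by (metis csc_0_left csc_simps(2) mult_zero_right)

lemma csc_uminus_left [simp]: "csc (- z) a = - csc z a"
  using csc_simps(2)[of "-1" z a] unfolding csc_minus_one by simp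

lemma csc_uminus_right [simp]: "csc z (- a) = - csc z a"
  using csc_simps(2)[of z "-1" a] unfolding csc_minus_one by simp

lemma salg_induct [case_names gen one zero plus times scale]:
  assumes "\<And>g. P (sgen g)" "P 1" "P 0" "\<And>a b. P a \<Longrightarrow> P b \<Longrightarrow> P (a + b)"
    "\<And>a b. P a \<Longrightarrow> P b \<Longrightarrow> P (a * b)" "\<And>z a. P a \<Longrightarrow> P (csc z a)"
  shows "P a"
proof -
  have "P (abs_salg t)" for t
    by (induction t) (metis assms sgen.abs_eq one_salg_def zero_salg_def plus_salg.abs_eq
        times_salg.abs_eq csc.abs_eq)+
  then show ?thesis by (metis Quotient3_abs_rep Quotient3_salg)
qed

lemma fa_rep_abs: "fa_eq (rep_salg (abs_salg t)) t"
  by (rule Quotient3_rep_abs[OF Quotient3_salg]) (rule fa_refl)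

lemma alg_ext:
  assumes "\<And>s t. gen_rel s t \<Longrightarrow> fa_eval \<phi> s = fa_eval \<phi> t"
  shows "alg_ext \<phi> (abs_salg t) = fa_eval \<phi> t"
    and "alg_ext \<phi> (sgen g) = \<phi> g"
    and "alg_ext \<phi> 0 = 0"
    and "alg_ext \<phi> 1 = 1"
    and "alg_ext \<phi> (a + b) = alg_ext \<phi> a + alg_ext \<phi> b"
    and "alg_ext \<phi> (a * b) = alg_ext \<phi> a * alg_ext \<phi> b"
    and "alg_ext \<phi> (csc z a) = csc z (alg_ext \<phi> a)"
proof -
  have wd: "fa_eval \<phi> s = fa_eval \<phi> t" if "fa_eq s t" for s t
    using that by induction (simp_all add: assms algebra_simps csc_plus csc_minus_one)
  then show abs: "alg_ext \<phi> (abs_salg t) = fa_eval \<phi> t" for t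
    unfolding alg_ext_def by (simp add: fa_rep_abs)
  show "alg_ext \<phi> (sgen g) = \<phi> g" "alg_ext \<phi> 0 = 0" "alg_ext \<phi> 1 = 1"
    by (simp_all add: sgen.abs_eq zero_salg_def one_salg_def abs)
  have rep: "a = abs_salg (rep_salg a)" for a :: "'a salg"
    by (metis Quotient3_abs_rep Quotient3_salg)
  show "alg_ext \<phi> (a + b) = alg_ext \<phi> a + alg_ext \<phi> b"
    by (subst (1 2) rep) (simp add: plus_salg.abs_eq abs, simp add: alg_ext_def)
  show "alg_ext \<phi> (a * b) = alg_ext \<phi> a * alg_ext \<phi> b"
    by (subst (1 2) rep) (simp add: times_salg.abs_eq abs, simp add: alg_ext_def)
  show "alg_ext \<phi> (csc z a) = csc z (alg_ext \<phi> a)"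
    by (subst rep) (simp add: csc.abs_eq abs, simp add: alg_ext_def)
qed


section \<open>Polynomial superalgebras\<close>

text \<open>The indices range over a type \<open>'i\<close>; for \<open>n = 1, 2\<close> these are \<^typ>\<open>unit\<close> and \<open>two\<close>.\<close>

datatype two = First | Second

primrec flip :: "two \<Rightarrow> two" where
  "flip First = Second"
| "flip Second = First"

datatype 'i opol_gen = Ox 'i
datatype 'i opolcl_gen = OCc 'i | OCx 'i
datatype 'i polcl_gen = PCc 'i | PCx 'i

instantiation opol_gen :: (type) presentation
begin

definition "gen_parity (g :: 'a opol_gen) = 1"

inductive gen_rel_opol_gen :: "'a opol_gen fa \<Rightarrow> 'a opol_gen fa \<Rightarrow> bool" where
  "i \<noteq> j \<Longrightarrow> gen_rel_opol_gen (Times (Gen (Ox i)) (Gen (Ox j)))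
     (Scale (-1) (Times (Gen (Ox j)) (Gen (Ox i))))"

instance ..

end

instantiation opolcl_gen :: (type) presentation
begin

definition "gen_parity (g :: 'a opolcl_gen) = 1"

inductive gen_rel_opolcl_gen :: "'a opolcl_gen fa \<Rightarrow> 'a opolcl_gen fa \<Rightarrow> bool" where
  "gen_rel_opolcl_gen (Times (Gen (OCc i)) (Gen (OCc i))) One"
| "i \<noteq> j \<Longrightarrow> gen_rel_opolcl_gen (Times (Gen (OCc i)) (Gen (OCc j)))
     (Scale (-1) (Times (Gen (OCc j)) (Gen (OCc i))))"
| "i \<noteq> j \<Longrightarrow> gen_rel_opolcl_gen (Times (Gen (OCx i)) (Gen (OCx j)))
     (Scale (-1) (Times (Gen (OCx j)) (Gen (OCx i))))"
| "gen_rel_opolcl_gen (Times (Gen (OCc i)) (Gen (OCx j)))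
     (Scale (-1) (Times (Gen (OCx j)) (Gen (OCc i))))"

instance ..

end

instantiation polcl_gen :: (type) presentation
begin

definition "gen_parity (g :: 'a polcl_gen) = (case g of PCc i \<Rightarrow> 1 | PCx i \<Rightarrow> 0)"

inductive gen_rel_polcl_gen :: "'a polcl_gen fa \<Rightarrow> 'a polcl_gen fa \<Rightarrow> bool" where
  "gen_rel_polcl_gen (Times (Gen (PCc i)) (Gen (PCc i))) One"
| "gen_rel_polcl_gen (Times (Gen (PCc i)) (Gen (PCx i)))
     (Scale (-1) (Times (Gen (PCx i)) (Gen (PCc i))))"
| "i \<noteq> j \<Longrightarrow> gen_rel_polcl_gen (Times (Gen (PCc i)) (Gen (PCc j)))
     (Scale (-1) (Times (Gen (PCc j)) (Gen (PCc i))))"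
| "i \<noteq> j \<Longrightarrow> gen_rel_polcl_gen (Times (Gen (PCc i)) (Gen (PCx j)))
     (Times (Gen (PCx j)) (Gen (PCc i)))"
| "gen_rel_polcl_gen (Times (Gen (PCx i)) (Gen (PCx j))) (Times (Gen (PCx j)) (Gen (PCx i)))"

instance ..

end

type_synonym 'i opol = "'i opol_gen salg"
type_synonym 'i opolcl = "'i opolcl_gen salg"
type_synonym 'i polcl = "'i polcl_gen salg"

abbreviation ox :: "'i \<Rightarrow> 'i opol" where "ox i \<equiv> sgen (Ox i)"
abbreviation occ :: "'i \<Rightarrow> 'i opolcl" where "occ i \<equiv> sgen (OCc i)"
abbreviation ocx :: "'i \<Rightarrow> 'i opolcl" where "ocx i \<equiv> sgen (OCx i)"
abbreviation pcc :: "'i \<Rightarrow> 'i polcl" where "pcc i \<equiv> sgen (PCc i)"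
abbreviation pcx :: "'i \<Rightarrow> 'i polcl" where "pcx i \<equiv> sgen (PCx i)"

definition opol_to_opolcl :: "'i opol \<Rightarrow> 'i opolcl" where
  "opol_to_opolcl = alg_ext (\<lambda>g. case g of Ox i \<Rightarrow> ocx i)"

text \<open>The parameter \<open>w\<close> is the chosen square root of \<open>-2\<close>.\<close>

definition psi :: "complex \<Rightarrow> unit opolcl \<Rightarrow> unit polcl" where
  "psi w = alg_ext (\<lambda>g. case g of OCc i \<Rightarrow> pcc i | OCx i \<Rightarrow> csc (1 / w) (pcc i * pcx i))"

definition psi_E :: "complex \<Rightarrow> unit opol \<Rightarrow> unit polcl" where
  "psi_E w Q = psi w (opol_to_opolcl Q)"

definition psi_E_inv :: "complex \<Rightarrow> unit polcl \<Rightarrow> unit opol" where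
  "psi_E_inv w = inv_into EE (psi_E w)"

definition opol_at1 :: "unit opol \<Rightarrow> two opol" where
  "opol_at1 = alg_ext (\<lambda>g. case g of Ox i \<Rightarrow> ox First)"

definition polcl_at1 :: "unit polcl \<Rightarrow> two polcl" where
  "polcl_at1 = alg_ext (\<lambda>g. case g of PCc i \<Rightarrow> pcc First | PCx i \<Rightarrow> pcx First)"

definition opol_swap :: "two opol \<Rightarrow> two opol" where
  "opol_swap = alg_ext (\<lambda>g. case g of Ox i \<Rightarrow> ox (flip i))"

definition polcl_swap :: "two polcl \<Rightarrow> two polcl" where
  "polcl_swap = alg_ext (\<lambda>g. case g of PCc i \<Rightarrow> pcc (flip i) | PCx i \<Rightarrow> pcx (flip i))"

definition clinear :: "('g::presentation salg \<Rightarrow> 'g salg) \<Rightarrow> bool" where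
  "clinear D \<longleftrightarrow> (\<forall>f g. D (f + g) = D f + D g) \<and> (\<forall>z f. D (csc z f) = csc z (D f))"

definition is_odd_demazure :: "(two opol \<Rightarrow> two opol) \<Rightarrow> bool" where
  "is_odd_demazure D \<longleftrightarrow>
     clinear D \<and> (\<forall>p f. homogeneous p f \<longrightarrow> homogeneous (p + 1) (D f)) \<and>
     D 1 = 0 \<and> D (ox First) = 1 \<and> D (ox Second) = 1 \<and>
     (\<forall>p f g. homogeneous p f \<longrightarrow>
        D (f * g) = D f * g + csc (sign p) (opol_swap f * D g))"

definition odd_demazure :: "two opol \<Rightarrow> two opol" where
  "odd_demazure = (THE D. is_odd_demazure D)"

definition is_clifford_demazure :: "(two polcl \<Rightarrow> two polcl) \<Rightarrow> bool" where
  "is_clifford_demazure D \<longleftrightarrow>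
     clinear D \<and> (\<forall>f \<in> subalg {pcc First, pcc Second}. D f = 0) \<and>
     D (pcx First) = 1 + pcc First * pcc Second \<and>
     D (pcx Second) = -1 + pcc First * pcc Second \<and>
     (\<forall>f g. D (f * g) = D f * g + polcl_swap f * D g)"

definition clifford_demazure :: "two polcl \<Rightarrow> two polcl" where
  "clifford_demazure = (THE D. is_clifford_demazure D)"


subsection \<open>The homomorphisms and Demazure operators above are well defined\<close>

lemma ox_anticommute: "i \<noteq> j \<Longrightarrow> ox i * ox j = - (ox j * ox i)"
  by (transfer, rule fa_rel) (rule gen_rel_opol_gen.intros)

lemma opolcl_rels:
  "occ i * occ i = 1"
  "i \<noteq> j \<Longrightarrow> occ i * occ j = - (occ j * occ i)"
  "i \<noteq> j \<Longrightarrow> ocx i * ocx j = - (ocx j * ocx i)"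
  "occ i * ocx k = - (ocx k * occ i)"
  by (transfer, rule fa_rel, blast intro: gen_rel_opolcl_gen.intros)+

lemma polcl_rels:
  "pcc i * pcc i = 1"
  "pcc i * pcx i = - (pcx i * pcc i)"
  "i \<noteq> j \<Longrightarrow> pcc i * pcc j = - (pcc j * pcc i)"
  "i \<noteq> j \<Longrightarrow> pcc i * pcx j = pcx j * pcc i"
  "pcx i * pcx k = pcx k * pcx i"
  by (transfer, rule fa_rel, blast intro: gen_rel_polcl_gen.intros)+

lemma two_neq: "i \<noteq> j \<Longrightarrow> flip i = j" "flip i \<noteq> i" "flip (flip i) = i"
  by (cases i; cases j; simp)+

lemma opol_swap_rel: "gen_rel s t \<Longrightarrow> fa_eval (\<lambda>g. case g of Ox i \<Rightarrow> ox (flip i)) s =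
   fa_eval (\<lambda>g. case g of Ox i \<Rightarrow> ox (flip i)) t"
  by (erule gen_rel_opol_gen.cases) (auto simp: csc_minus_one intro!: ox_anticommute, metis two_neq)

lemma opol_at1_rel: "gen_rel s t \<Longrightarrow> fa_eval (\<lambda>g. case g of Ox (i::unit) \<Rightarrow> ox First) s =
   fa_eval (\<lambda>g. case g of Ox i \<Rightarrow> ox First) t"
  by (erule gen_rel_opol_gen.cases) (auto)

lemma opol_to_opolcl_rel: "gen_rel s t \<Longrightarrow> fa_eval (\<lambda>g. case g of Ox i \<Rightarrow> ocx i) s =
   fa_eval (\<lambda>g. case g of Ox i \<Rightarrow> ocx i) t"
  by (erule gen_rel_opol_gen.cases) (auto simp: csc_minus_one intro!: opolcl_rels)

lemma polcl_swap_rel: "gen_rel s t \<Longrightarrow> fa_eval (\<lambda>g. case g of PCc i \<Rightarrow> pcc (flip i) | PCx i \<Rightarrow> pcx (flip i)) s =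
   fa_eval (\<lambda>g. case g of PCc i \<Rightarrow> pcc (flip i) | PCx i \<Rightarrow> pcx (flip i)) t"
  by (erule gen_rel_polcl_gen.cases) (auto simp: csc_minus_one intro!: polcl_rels, (metis two_neq)+)

lemma polcl_at1_rel: "gen_rel s t \<Longrightarrow> fa_eval (\<lambda>g. case g of PCc (i::unit) \<Rightarrow> pcc First | PCx i \<Rightarrow> pcx First) s =
   fa_eval (\<lambda>g. case g of PCc i \<Rightarrow> pcc First | PCx i \<Rightarrow> pcx First) t"
  by (erule gen_rel_polcl_gen.cases) (auto simp: csc_minus_one intro!: polcl_rels)

lemma psi_rel: "gen_rel s t \<Longrightarrow> fa_eval (\<lambda>g. case g of OCc (i::unit) \<Rightarrow> pcc i | OCx i \<Rightarrow> csc (1 / w) (pcc i * pcx i)) s =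
   fa_eval (\<lambda>g. case g of OCc i \<Rightarrow> pcc i | OCx i \<Rightarrow> csc (1 / w) (pcc i * pcx i)) t"
proof (erule gen_rel_opolcl_gen.cases, goal_cases)
  case (4 i j)
  have "pcc () * (pcc () * pcx ()) = - (pcc () * pcx () * pcc ())"
    using polcl_rels(1)[of "()"] polcl_rels(2)[of "()"] by (metis mult.assoc minus_minus mult_minus_right mult_minus_left mult_1_left mult_1_right)
  then show ?case using 4 by (auto simp: csc_minus_one)
qed (auto simp: polcl_rels(1))

lemma homog_decomp: "\<exists>b c. homogeneous 0 b \<and> homogeneous 1 c \<and> a = b + c"
proof (induction a rule: salg_induct)
  case (gen g)
  show ?case
  proof (cases "gen_parity g = 0")
    case True then show ?thesis using homogeneous_gen[of g] homogeneous_zero by (metis add.right_neutral)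
  next
    case False then have "gen_parity g = 1" by simp
    then show ?thesis using homogeneous_gen[of g] homogeneous_zero by (metis add.left_neutral)
  qed
next
  case one then show ?case using homogeneous_one homogeneous_zero by (metis add.right_neutral)
next
  case zero then show ?case using homogeneous_zero by (metis add.right_neutral)
next
  case (plus a b)
  then obtain a0 a1 b0 b1 where "homogeneous 0 a0" "homogeneous 1 a1" "a = a0 + a1"
    "homogeneous 0 b0" "homogeneous 1 b1" "b = b0 + b1" by blast
  then show ?case by (intro exI[of _ "a0 + b0"] exI[of _ "a1 + b1"]) (auto intro: homogeneous_plus simp: algebra_simps)
next
  case (times a b)
  then obtain a0 a1 b0 b1 where *: "homogeneous 0 a0" "homogeneous 1 a1" "a = a0 + a1"
    "homogeneous 0 b0" "homogeneous 1 b1" "b = b0 + b1" by blast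
  then show ?case
    using homogeneous_times[OF *(1,4)] homogeneous_times[OF *(2,4)] homogeneous_times[OF *(1,5)] homogeneous_times[OF *(2,5)]
    by (intro exI[of _ "a0 * b0 + a1 * b1"] exI[of _ "a0 * b1 + a1 * b0"]) (auto intro: homogeneous_plus simp: algebra_simps)
next
  case (scale z a)
  then show ?case using homogeneous_csc by (metis csc_simps(1))
qed

lemma csc_sign: "csc (sign p) a = (if p = 0 then a else - a)"
  by (simp add: sign_def csc_minus_one)

lemmas opol_swap_simps = alg_ext[OF opol_swap_rel, folded opol_swap_def]
lemmas polcl_swap_simps = alg_ext[OF polcl_swap_rel, folded polcl_swap_def]

primrec oD :: "two opol_gen fa \<Rightarrow> two opol" where
  "oD (Gen g) = 1"
| "oD One = 0"
| "oD Zero = 0"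
| "oD (Plus s t) = oD s + oD t"
| "oD (Times s t) = oD s * abs_salg t + fa_eval (\<lambda>g. case g of Ox i \<Rightarrow> - ox (flip i)) s * oD t"
| "oD (Scale z t) = csc z (oD t)"

lemma sg_rel: "gen_rel s t \<Longrightarrow> fa_eval (\<lambda>g. case g of Ox i \<Rightarrow> - ox (flip i)) s =
   fa_eval (\<lambda>g. case g of Ox i \<Rightarrow> - ox (flip i)) t"
  by (erule gen_rel_opol_gen.cases) (auto simp: csc_minus_one intro!: ox_anticommute, metis two_neq)

lemmas abs_simps = plus_salg.abs_eq[symmetric] times_salg.abs_eq[symmetric] csc.abs_eq[symmetric]
  one_salg_def[symmetric] zero_salg_def[symmetric] sgen.abs_eq[symmetric]

lemma abs_eqI: "fa_eq s t \<Longrightarrow> abs_salg s = abs_salg t"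
  by (simp add: salg.abs_eq_iff)

lemma eval_eqI: "fa_eq s t \<Longrightarrow> fa_eval (\<lambda>g. case g of Ox i \<Rightarrow> - ox (flip i)) s =
   fa_eval (\<lambda>g. case g of Ox i \<Rightarrow> - ox (flip i)) t"
  using alg_ext(1)[OF sg_rel] abs_eqI by metis

lemma oD_wd: "fa_eq s t \<Longrightarrow> oD s = oD t"
proof (induction rule: fa_eq.induct)
  case (fa_rel s t)
  then show ?case
   by (cases rule: gen_rel_opol_gen.cases)
     (auto simp: abs_simps csc_minus_one algebra_simps dest!: two_neq(1), metis add.commute two_neq(1))
qed (simp_all add: abs_eqI eval_eqI abs_simps algebra_simps csc_plus csc_minus_one)

lemma is_odd_demazure_ex: "\<exists>D. is_odd_demazure D"
proof
  let ?D = "\<lambda>a. oD (rep_salg a)"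
  have 1: "?D (abs_salg t) = oD t" for t using oD_wd[OF fa_rep_abs] .
  let ?g = "alg_ext (\<lambda>g. case g of Ox i \<Rightarrow> - ox (flip i))"
  note g = alg_ext[OF sg_rel]
  have rep: "a = abs_salg (rep_salg a)" for a :: "two opol"
    by (metis Quotient3_abs_rep Quotient3_salg)
  have gs: "?g f = csc (sign p) (opol_swap f)" if "homogeneous p f" for p f
    using that
  proof induction
    case (homogeneous_gen g') then show ?case by (cases g') (auto simp: g opol_swap_simps sign_def gen_parity_opol_gen_def csc_minus_one)
  qed (auto simp: g opol_swap_simps csc_sign, auto simp: sign_def)
  have D: "?D (a + b) = ?D a + ?D b" "?D (csc z a) = csc z (?D a)" "?D 1 = 0" "?D 0 = 0" "?D (sgen i) = 1"
    "?D (a * b) = ?D a * b + ?g a * ?D b" for a b z i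
  proof -
    obtain s t where st: "a = abs_salg s" "b = abs_salg t" using rep by blast
    show "?D (a + b) = ?D a + ?D b" "?D (csc z a) = csc z (?D a)" "?D (a * b) = ?D a * b + ?g a * ?D b"
       by (simp_all only: st plus_salg.abs_eq csc.abs_eq times_salg.abs_eq 1 g(1) oD.simps)
  qed (simp_all only: 1 one_salg_def zero_salg_def sgen.abs_eq oD.simps)
  have "homogeneous (p + 1) (?D f)" if "homogeneous p f" for p f
    using that
  proof induction
    case (homogeneous_gen g') then show ?case by (auto simp: D gen_parity_opol_gen_def intro: homogeneous_one)
  next
    case (homogeneous_times p a q b)
    have "homogeneous p (opol_swap a)" using homogeneous_times(1)
    proof induction
      case (homogeneous_gen g') then show ?case
       using homogeneous.homogeneous_gen[of "case g' of Ox i \<Rightarrow> Ox (flip i)"] by (cases g') (auto simp: opol_swap_simps gen_parity_opol_gen_def)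
    qed (simp_all only: opol_swap_simps homogeneous.intros)
    then have "homogeneous (p + (q + 1)) (opol_swap a * ?D b)" by (intro homogeneous.intros homogeneous_times)
    moreover have "homogeneous ((p + 1) + q) (?D a * b)" by (intro homogeneous.intros homogeneous_times)
    ultimately show ?case using homogeneous_times by (auto simp: D gs algebra_simps intro!: homogeneous.intros)
  qed (auto simp: D intro: homogeneous.intros)
  then show "is_odd_demazure ?D" by (auto simp: is_odd_demazure_def clinear_def D gs)
qed

lemma is_odd_demazure_unique: assumes "is_odd_demazure D" "is_odd_demazure D'" shows "D = D'"
proof
  fix a :: "two opol"
  have *: "D f = D' f" if "homogeneous p f" for p f using that
  proof induction
    case (homogeneous_gen g)
    obtain i where "g = Ox i" by (cases g)
    then show ?case using assms by (cases i) (auto simp: is_odd_demazure_def)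
  next
    case (homogeneous_zero p) show ?case using assms unfolding is_odd_demazure_def clinear_def by (metis csc_0_left)
  next
    case (homogeneous_times p a q b) then show ?case using assms unfolding is_odd_demazure_def by metis
  qed (use assms in \<open>auto simp: is_odd_demazure_def clinear_def\<close>)
  obtain b c where "homogeneous 0 b" "homogeneous 1 c" "a = b + c" using homog_decomp by blast
  then show "D a = D' a" using * assms by (auto simp: is_odd_demazure_def clinear_def)
qed

primrec pD :: "two polcl_gen fa \<Rightarrow> two polcl" where
  "pD (Gen g) = (case g of PCc i \<Rightarrow> 0 | PCx i \<Rightarrow> (if i = First then 1 else -1) + pcc First * pcc Second)"
| "pD One = 0"
| "pD Zero = 0"
| "pD (Plus s t) = pD s + pD t"
| "pD (Times s t) = pD s * abs_salg t + polcl_swap (abs_salg s) * pD t"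
| "pD (Scale z t) = csc z (pD t)"

lemma pcx_move: "pcx i * (pcc i * a) = - (pcc i * (pcx i * a))" "i \<noteq> j \<Longrightarrow> pcx j * (pcc i * a) = pcc i * (pcx j * a)"
  "pcx i * pcc i = - (pcc i * pcx i)"  "i \<noteq> j \<Longrightarrow> pcx j * pcc i = pcc i * pcx j"
  "pcc Second * pcc First = - (pcc First * pcc Second)"
  "pcc Second * (pcc First * a) = - (pcc First * (pcc Second * a))"
  "pcc i * pcc i = 1" "pcc i * (pcc i * a) = a"
  "pcx Second * pcx First = pcx First * pcx Second"
proof -
  show 1: "pcx i * pcc i = - (pcc i * pcx i)" for i :: two by (simp add: polcl_rels(2))
  show 2: "i \<noteq> j \<Longrightarrow> pcx j * pcc i = pcc i * pcx j" for i j :: two by (simp add: polcl_rels(4))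
  show 3: "pcc Second * pcc First = - (pcc First * pcc Second)" by (simp add: polcl_rels(3)[of Second First])
  show 4: "pcc i * pcc i = 1" for i :: two by (rule polcl_rels)
  show "pcx Second * pcx First = pcx First * pcx Second" by (rule polcl_rels)
  show "pcx i * (pcc i * a) = - (pcc i * (pcx i * a))" "i \<noteq> j \<Longrightarrow> pcx j * (pcc i * a) = pcc i * (pcx j * a)"
   "pcc Second * (pcc First * a) = - (pcc First * (pcc Second * a))" "pcc i * (pcc i * a) = a"
    using 1[of i] 2[of i j] 3 4[of i] by (simp_all flip: mult.assoc)
qed

lemma pD_wd: "fa_eq s t \<Longrightarrow> pD s = pD t"
proof (induction rule: fa_eq.induct)
  case (fa_rel s t)
  then show ?case
  proof (cases rule: gen_rel_polcl_gen.cases)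
    case (1 i)
    then show ?thesis by simp
  next
    case (2 i)
    then show ?thesis by (cases i) (auto simp: abs_simps polcl_swap_simps csc_minus_one pcx_move algebra_simps mult.assoc)
  next
    case (3 i j)
    then show ?thesis by simp
  next
    case (4 i j)
    then show ?thesis by (cases i; cases j) (auto simp: abs_simps polcl_swap_simps csc_minus_one pcx_move algebra_simps mult.assoc)
  next
    case (5 i j)
    then show ?thesis by (cases i; cases j) (auto simp: abs_simps polcl_swap_simps csc_minus_one pcx_move algebra_simps mult.assoc)
  qed
qed (simp_all add: abs_eqI abs_simps algebra_simps csc_plus csc_minus_one polcl_swap_simps)

lemma is_clifford_demazure_ex: "\<exists>D. is_clifford_demazure D"
proof
  let ?D = "\<lambda>a. pD (rep_salg a)"
  have 1: "?D (abs_salg t) = pD t" for t using pD_wd[OF fa_rep_abs] .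
  have rep: "a = abs_salg (rep_salg a)" for a :: "two polcl"
    by (metis Quotient3_abs_rep Quotient3_salg)
  have D: "?D (a + b) = ?D a + ?D b" "?D (csc z a) = csc z (?D a)" "?D 1 = 0" "?D 0 = 0" "?D (sgen i) = pD (Gen i)"
    "?D (a * b) = ?D a * b + polcl_swap a * ?D b" for a b z i
  proof -
    obtain s t where st: "a = abs_salg s" "b = abs_salg t" using rep by blast
    show "?D (a + b) = ?D a + ?D b" "?D (csc z a) = csc z (?D a)" "?D (a * b) = ?D a * b + polcl_swap a * ?D b"
       by (simp_all only: st plus_salg.abs_eq csc.abs_eq times_salg.abs_eq 1 pD.simps)
  qed (simp_all only: 1 one_salg_def zero_salg_def sgen.abs_eq pD.simps)
  have "?D f = 0" if "f \<in> subalg {pcc First, pcc Second}" for f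
    using that by induction (auto simp: D)
  then show "is_clifford_demazure ?D" by (auto simp: is_clifford_demazure_def clinear_def D)
qed

lemma is_clifford_demazure_unique: assumes "is_clifford_demazure D" "is_clifford_demazure D'" shows "D = D'"
proof
  fix a :: "two polcl"
  show "D a = D' a"
  proof (induction a rule: salg_induct)
    case (gen g)
    have "D (pcc i) = 0" "D' (pcc i) = 0" for i
      using assms by (cases i; auto simp: is_clifford_demazure_def intro: subalg.intros)+
    then show ?case using assms by (cases g; cases "case g of PCx i \<Rightarrow> i | PCc i \<Rightarrow> i") (auto simp: is_clifford_demazure_def)
  next
    case one show ?case using assms subalg.intros(2) unfolding is_clifford_demazure_def by metis
  next
    case zero show ?case using assms subalg.intros(3) unfolding is_clifford_demazure_def by metis
  qed (use assms in \<open>auto simp: is_clifford_demazure_def clinear_def\<close>)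
qed

lemma odd_demazure: "is_odd_demazure odd_demazure"
  unfolding odd_demazure_def
  by (rule theI'[of is_odd_demazure]) (metis is_odd_demazure_ex is_odd_demazure_unique)

lemma clifford_demazure: "is_clifford_demazure clifford_demazure"
  unfolding clifford_demazure_def
  by (rule theI'[of is_clifford_demazure]) (metis is_clifford_demazure_ex is_clifford_demazure_unique)


section \<open>Strict monoidal supercategories\<close>

text \<open>\<open>Hom a b\<close> is a complex vector space, with even and odd subspaces \<open>Part 0 a b\<close> and
  \<open>Part 1 a b\<close>. Composition is written in the usual order: \<open>Comp f g\<close> is \<open>f\<close> after \<open>g\<close>.\<close>

record ('o, 'm) smcat =
  Obj :: "'o set"
  Unit :: 'o
  OTens :: "'o \<Rightarrow> 'o \<Rightarrow> 'o"
  Hom :: "'o \<Rightarrow> 'o \<Rightarrow> 'm set"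
  Part :: "bit \<Rightarrow> 'o \<Rightarrow> 'o \<Rightarrow> 'm set"
  ZeroM :: "'o \<Rightarrow> 'o \<Rightarrow> 'm"
  Add :: "'m \<Rightarrow> 'm \<Rightarrow> 'm"
  Scal :: "complex \<Rightarrow> 'm \<Rightarrow> 'm"
  Ident :: "'o \<Rightarrow> 'm"
  Comp :: "'m \<Rightarrow> 'm \<Rightarrow> 'm"
  Tens :: "'m \<Rightarrow> 'm \<Rightarrow> 'm"

locale strict_monoidal_supercategory =
  fixes M :: "('o, 'm) smcat"
  assumes unit_obj: "Unit M \<in> Obj M"
    and tens_obj: "\<lbrakk>a \<in> Obj M; b \<in> Obj M\<rbrakk> \<Longrightarrow> OTens M a b \<in> Obj M"
    and tens_obj_assoc: "\<lbrakk>a \<in> Obj M; b \<in> Obj M; c \<in> Obj M\<rbrakk> \<Longrightarrow>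
        OTens M (OTens M a b) c = OTens M a (OTens M b c)"
    and unit_tens_obj: "a \<in> Obj M \<Longrightarrow> OTens M (Unit M) a = a"
    and tens_unit_obj: "a \<in> Obj M \<Longrightarrow> OTens M a (Unit M) = a"
    and hom_obj: "f \<in> Hom M a b \<Longrightarrow> a \<in> Obj M \<and> b \<in> Obj M"
    and hom_disjoint: "\<lbrakk>f \<in> Hom M a b; f \<in> Hom M a' b'\<rbrakk> \<Longrightarrow> a = a' \<and> b = b'"
    \<comment> \<open>hom-spaces are vector spaces\<close>
    and zero_hom: "\<lbrakk>a \<in> Obj M; b \<in> Obj M\<rbrakk> \<Longrightarrow> ZeroM M a b \<in> Hom M a b"
    and add_hom: "\<lbrakk>f \<in> Hom M a b; g \<in> Hom M a b\<rbrakk> \<Longrightarrow> Add M f g \<in> Hom M a b"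
    and scal_hom: "f \<in> Hom M a b \<Longrightarrow> Scal M z f \<in> Hom M a b"
    and add_assoc: "\<lbrakk>f \<in> Hom M a b; g \<in> Hom M a b; h \<in> Hom M a b\<rbrakk> \<Longrightarrow>
        Add M (Add M f g) h = Add M f (Add M g h)"
    and add_comm: "\<lbrakk>f \<in> Hom M a b; g \<in> Hom M a b\<rbrakk> \<Longrightarrow> Add M f g = Add M g f"
    and add_zero: "f \<in> Hom M a b \<Longrightarrow> Add M f (ZeroM M a b) = f"
    and add_neg: "f \<in> Hom M a b \<Longrightarrow> Add M f (Scal M (-1) f) = ZeroM M a b"
    and scal_add: "\<lbrakk>f \<in> Hom M a b; g \<in> Hom M a b\<rbrakk> \<Longrightarrow>
        Scal M z (Add M f g) = Add M (Scal M z f) (Scal M z g)"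
    and add_scal: "f \<in> Hom M a b \<Longrightarrow> Scal M (z + z') f = Add M (Scal M z f) (Scal M z' f)"
    and scal_scal: "f \<in> Hom M a b \<Longrightarrow> Scal M z (Scal M z' f) = Scal M (z * z') f"
    and scal_one: "f \<in> Hom M a b \<Longrightarrow> Scal M 1 f = f"
    \<comment> \<open>they are the direct sums of their even and odd parts\<close>
    and part_hom: "f \<in> Part M p a b \<Longrightarrow> f \<in> Hom M a b"
    and zero_part: "\<lbrakk>a \<in> Obj M; b \<in> Obj M\<rbrakk> \<Longrightarrow> ZeroM M a b \<in> Part M p a b"
    and add_part: "\<lbrakk>f \<in> Part M p a b; g \<in> Part M p a b\<rbrakk> \<Longrightarrow> Add M f g \<in> Part M p a b"
    and scal_part: "f \<in> Part M p a b \<Longrightarrow> Scal M z f \<in> Part M p a b"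
    and part_sum: "f \<in> Hom M a b \<Longrightarrow> \<exists>g\<in>Part M 0 a b. \<exists>h\<in>Part M 1 a b. f = Add M g h"
    and part_direct: "\<lbrakk>f \<in> Part M 0 a b; f \<in> Part M 1 a b\<rbrakk> \<Longrightarrow> f = ZeroM M a b"
    \<comment> \<open>category structure, with even bilinear composition\<close>
    and id_part: "a \<in> Obj M \<Longrightarrow> Ident M a \<in> Part M 0 a a"
    and comp_hom: "\<lbrakk>f \<in> Hom M b c; g \<in> Hom M a b\<rbrakk> \<Longrightarrow> Comp M f g \<in> Hom M a c"
    and comp_part: "\<lbrakk>f \<in> Part M p b c; g \<in> Part M q a b\<rbrakk> \<Longrightarrow> Comp M f g \<in> Part M (p + q) a c"
    and comp_assoc: "\<lbrakk>f \<in> Hom M c d; g \<in> Hom M b c; h \<in> Hom M a b\<rbrakk> \<Longrightarrow>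
        Comp M (Comp M f g) h = Comp M f (Comp M g h)"
    and id_comp: "f \<in> Hom M a b \<Longrightarrow> Comp M (Ident M b) f = f"
    and comp_id: "f \<in> Hom M a b \<Longrightarrow> Comp M f (Ident M a) = f"
    and comp_add_left: "\<lbrakk>f \<in> Hom M b c; g \<in> Hom M b c; h \<in> Hom M a b\<rbrakk> \<Longrightarrow>
        Comp M (Add M f g) h = Add M (Comp M f h) (Comp M g h)"
    and comp_add_right: "\<lbrakk>f \<in> Hom M b c; g \<in> Hom M a b; h \<in> Hom M a b\<rbrakk> \<Longrightarrow>
        Comp M f (Add M g h) = Add M (Comp M f g) (Comp M f h)"
    and comp_scal_left: "\<lbrakk>f \<in> Hom M b c; g \<in> Hom M a b\<rbrakk> \<Longrightarrow>
        Comp M (Scal M z f) g = Scal M z (Comp M f g)"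
    and comp_scal_right: "\<lbrakk>f \<in> Hom M b c; g \<in> Hom M a b\<rbrakk> \<Longrightarrow>
        Comp M f (Scal M z g) = Scal M z (Comp M f g)"
    \<comment> \<open>strict monoidal structure, with even bilinear tensor product\<close>
    and tens_hom: "\<lbrakk>f \<in> Hom M a b; g \<in> Hom M c d\<rbrakk> \<Longrightarrow>
        Tens M f g \<in> Hom M (OTens M a c) (OTens M b d)"
    and tens_part: "\<lbrakk>f \<in> Part M p a b; g \<in> Part M q c d\<rbrakk> \<Longrightarrow>
        Tens M f g \<in> Part M (p + q) (OTens M a c) (OTens M b d)"
    and tens_assoc: "\<lbrakk>f \<in> Hom M a b; g \<in> Hom M a' b'; h \<in> Hom M a'' b''\<rbrakk> \<Longrightarrow>
        Tens M (Tens M f g) h = Tens M f (Tens M g h)"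
    and unit_tens: "f \<in> Hom M a b \<Longrightarrow> Tens M (Ident M (Unit M)) f = f"
    and tens_unit: "f \<in> Hom M a b \<Longrightarrow> Tens M f (Ident M (Unit M)) = f"
    and tens_id: "\<lbrakk>a \<in> Obj M; b \<in> Obj M\<rbrakk> \<Longrightarrow> Tens M (Ident M a) (Ident M b) = Ident M (OTens M a b)"
    and tens_add_left: "\<lbrakk>f \<in> Hom M a b; g \<in> Hom M a b; h \<in> Hom M c d\<rbrakk> \<Longrightarrow>
        Tens M (Add M f g) h = Add M (Tens M f h) (Tens M g h)"
    and tens_add_right: "\<lbrakk>f \<in> Hom M a b; g \<in> Hom M c d; h \<in> Hom M c d\<rbrakk> \<Longrightarrow>
        Tens M f (Add M g h) = Add M (Tens M f g) (Tens M f h)"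
    and tens_scal_left: "\<lbrakk>f \<in> Hom M a b; g \<in> Hom M c d\<rbrakk> \<Longrightarrow>
        Tens M (Scal M z f) g = Scal M z (Tens M f g)"
    and tens_scal_right: "\<lbrakk>f \<in> Hom M a b; g \<in> Hom M c d\<rbrakk> \<Longrightarrow>
        Tens M f (Scal M z g) = Scal M z (Tens M f g)"
    and interchange: "\<lbrakk>f' \<in> Hom M b c; f \<in> Part M p a b; g \<in> Part M q b' c'; g' \<in> Hom M a' b'\<rbrakk> \<Longrightarrow>
        Comp M (Tens M f' g) (Tens M f g') =
        Scal M (sign (p * q)) (Tens M (Comp M f' f) (Comp M g g'))"

locale strict_monoidal_superfunctor =
  A: strict_monoidal_supercategory A + B: strict_monoidal_supercategory B
  for A :: "('o, 'm) smcat" and B :: "('o2, 'm2) smcat" +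
  fixes Fo :: "'o \<Rightarrow> 'o2" and Fm :: "'m \<Rightarrow> 'm2"
  assumes F_obj: "a \<in> Obj A \<Longrightarrow> Fo a \<in> Obj B"
    and F_unit: "Fo (Unit A) = Unit B"
    and F_otens: "\<lbrakk>a \<in> Obj A; b \<in> Obj A\<rbrakk> \<Longrightarrow> Fo (OTens A a b) = OTens B (Fo a) (Fo b)"
    and F_hom: "f \<in> Hom A a b \<Longrightarrow> Fm f \<in> Hom B (Fo a) (Fo b)"
    and F_part: "f \<in> Part A p a b \<Longrightarrow> Fm f \<in> Part B p (Fo a) (Fo b)"
    and F_add: "\<lbrakk>f \<in> Hom A a b; g \<in> Hom A a b\<rbrakk> \<Longrightarrow> Fm (Add A f g) = Add B (Fm f) (Fm g)"
    and F_scal: "f \<in> Hom A a b \<Longrightarrow> Fm (Scal A z f) = Scal B z (Fm f)"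
    and F_id: "a \<in> Obj A \<Longrightarrow> Fm (Ident A a) = Ident B (Fo a)"
    and F_comp: "\<lbrakk>f \<in> Hom A b c; g \<in> Hom A a b\<rbrakk> \<Longrightarrow> Fm (Comp A f g) = Comp B (Fm f) (Fm g)"
    and F_tens: "\<lbrakk>f \<in> Hom A a b; g \<in> Hom A c d\<rbrakk> \<Longrightarrow> Fm (Tens A f g) = Tens B (Fm f) (Fm g)"

definition inverse_superfunctors ::
  "('o, 'm) smcat \<Rightarrow> ('o2, 'm2) smcat \<Rightarrow> ('o \<Rightarrow> 'o2) \<Rightarrow> ('m \<Rightarrow> 'm2) \<Rightarrow>
   ('o2 \<Rightarrow> 'o) \<Rightarrow> ('m2 \<Rightarrow> 'm) \<Rightarrow> bool" where
  "inverse_superfunctors A B Fo Fm Go Gm \<longleftrightarrow>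
     strict_monoidal_superfunctor A B Fo Fm \<and> strict_monoidal_superfunctor B A Go Gm \<and>
     (\<forall>a\<in>Obj A. Go (Fo a) = a) \<and> (\<forall>a\<in>Obj B. Fo (Go a) = a) \<and>
     (\<forall>a b. \<forall>f\<in>Hom A a b. Gm (Fm f) = f) \<and> (\<forall>a b. \<forall>f\<in>Hom B a b. Fm (Gm f) = f)"


section \<open>Strict monoidal supercategories given by generators and relations\<close>

datatype ('l, 'g) mterm =
    MGen 'g
  | MId "'l list"
  | MZero "'l list" "'l list"
  | MAdd "('l, 'g) mterm" "('l, 'g) mterm" (infixl "\<oplus>" 65)
  | MScal complex "('l, 'g) mterm"
  | MComp "('l, 'g) mterm" "('l, 'g) mterm" (infixr "\<cdot>" 70)
  | MTens "('l, 'g) mterm" "('l, 'g) mterm" (infixr "\<otimes>" 75)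

abbreviation MMinus (infixl "\<ominus>" 65) where
  "s \<ominus> t \<equiv> s \<oplus> MScal (-1) t"

record ('l, 'g) mpres =
  letters :: "'l set"
  gens :: "'g set"
  src :: "'g \<Rightarrow> 'l list"
  tgt :: "'g \<Rightarrow> 'l list"
  par :: "'g \<Rightarrow> bit"
  rel :: "('l, 'g) mterm \<Rightarrow> ('l, 'g) mterm \<Rightarrow> bool"

inductive mhom :: "('l, 'g) mpres \<Rightarrow> 'l list \<Rightarrow> 'l list \<Rightarrow> ('l, 'g) mterm \<Rightarrow> bool" for P where
  "g \<in> gens P \<Longrightarrow> mhom P (src P g) (tgt P g) (MGen g)"
| "a \<in> lists (letters P) \<Longrightarrow> mhom P a a (MId a)"
| "a \<in> lists (letters P) \<Longrightarrow> b \<in> lists (letters P) \<Longrightarrow> mhom P a b (MZero a b)"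
| "mhom P a b s \<Longrightarrow> mhom P a b t \<Longrightarrow> mhom P a b (s \<oplus> t)"
| "mhom P a b t \<Longrightarrow> mhom P a b (MScal z t)"
| "mhom P b c s \<Longrightarrow> mhom P a b t \<Longrightarrow> mhom P a c (s \<cdot> t)"
| "mhom P a b s \<Longrightarrow> mhom P c d t \<Longrightarrow> mhom P (a @ c) (b @ d) (s \<otimes> t)"

inductive mhomog ::
  "('l, 'g) mpres \<Rightarrow> bit \<Rightarrow> 'l list \<Rightarrow> 'l list \<Rightarrow> ('l, 'g) mterm \<Rightarrow> bool" for P where
  "g \<in> gens P \<Longrightarrow> mhomog P (par P g) (src P g) (tgt P g) (MGen g)"
| "a \<in> lists (letters P) \<Longrightarrow> mhomog P 0 a a (MId a)"
| "a \<in> lists (letters P) \<Longrightarrow> b \<in> lists (letters P) \<Longrightarrow> mhomog P p a b (MZero a b)"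
| "mhomog P p a b s \<Longrightarrow> mhomog P p a b t \<Longrightarrow> mhomog P p a b (s \<oplus> t)"
| "mhomog P p a b t \<Longrightarrow> mhomog P p a b (MScal z t)"
| "mhomog P p b c s \<Longrightarrow> mhomog P q a b t \<Longrightarrow> mhomog P (p + q) a c (s \<cdot> t)"
| "mhomog P p a b s \<Longrightarrow> mhomog P q c d t \<Longrightarrow> mhomog P (p + q) (a @ c) (b @ d) (s \<otimes> t)"

inductive meq :: "('l, 'g) mpres \<Rightarrow> ('l, 'g) mterm \<Rightarrow> ('l, 'g) mterm \<Rightarrow> bool" for P where
  meq_rel: "rel P s t \<Longrightarrow> meq P s t"
| meq_refl: "mhom P a b t \<Longrightarrow> meq P t t"
| meq_sym: "meq P s t \<Longrightarrow> meq P t s"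
| meq_trans: "meq P s t \<Longrightarrow> meq P t u \<Longrightarrow> meq P s u"
| add_cong: "mhom P a b s \<Longrightarrow> mhom P a b t \<Longrightarrow> meq P s s' \<Longrightarrow> meq P t t' \<Longrightarrow>
    meq P (s \<oplus> t) (s' \<oplus> t')"
| scal_cong: "mhom P a b t \<Longrightarrow> meq P t t' \<Longrightarrow> meq P (MScal z t) (MScal z t')"
| comp_cong: "mhom P b c s \<Longrightarrow> mhom P a b t \<Longrightarrow> meq P s s' \<Longrightarrow> meq P t t' \<Longrightarrow>
    meq P (s \<cdot> t) (s' \<cdot> t')"
| tens_cong: "mhom P a b s \<Longrightarrow> mhom P c d t \<Longrightarrow> meq P s s' \<Longrightarrow> meq P t t' \<Longrightarrow>
    meq P (s \<otimes> t) (s' \<otimes> t')"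
| meq_add_assoc: "mhom P a b s \<Longrightarrow> mhom P a b t \<Longrightarrow> mhom P a b u \<Longrightarrow>
    meq P ((s \<oplus> t) \<oplus> u) (s \<oplus> (t \<oplus> u))"
| meq_add_comm: "mhom P a b s \<Longrightarrow> mhom P a b t \<Longrightarrow> meq P (s \<oplus> t) (t \<oplus> s)"
| meq_add_zero: "mhom P a b t \<Longrightarrow> meq P (t \<oplus> MZero a b) t"
| meq_add_neg: "mhom P a b t \<Longrightarrow> meq P (t \<oplus> MScal (-1) t) (MZero a b)"
| meq_scal_add: "mhom P a b s \<Longrightarrow> mhom P a b t \<Longrightarrow>
    meq P (MScal z (s \<oplus> t)) (MScal z s \<oplus> MScal z t)"
| meq_add_scal: "mhom P a b t \<Longrightarrow> meq P (MScal (z + z') t) (MScal z t \<oplus> MScal z' t)"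
| meq_scal_scal: "mhom P a b t \<Longrightarrow> meq P (MScal z (MScal z' t)) (MScal (z * z') t)"
| meq_scal_one: "mhom P a b t \<Longrightarrow> meq P (MScal 1 t) t"
| meq_comp_assoc: "mhom P c d s \<Longrightarrow> mhom P b c t \<Longrightarrow> mhom P a b u \<Longrightarrow>
    meq P ((s \<cdot> t) \<cdot> u) (s \<cdot> (t \<cdot> u))"
| meq_id_comp: "mhom P a b t \<Longrightarrow> meq P (MId b \<cdot> t) t"
| meq_comp_id: "mhom P a b t \<Longrightarrow> meq P (t \<cdot> MId a) t"
| meq_comp_add_left: "mhom P b c s \<Longrightarrow> mhom P b c t \<Longrightarrow> mhom P a b u \<Longrightarrow>
    meq P ((s \<oplus> t) \<cdot> u) (s \<cdot> u \<oplus> t \<cdot> u)"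
| meq_comp_add_right: "mhom P b c u \<Longrightarrow> mhom P a b s \<Longrightarrow> mhom P a b t \<Longrightarrow>
    meq P (u \<cdot> (s \<oplus> t)) (u \<cdot> s \<oplus> u \<cdot> t)"
| meq_comp_scal_left: "mhom P b c s \<Longrightarrow> mhom P a b t \<Longrightarrow> meq P (MScal z s \<cdot> t) (MScal z (s \<cdot> t))"
| meq_comp_scal_right: "mhom P b c s \<Longrightarrow> mhom P a b t \<Longrightarrow> meq P (s \<cdot> MScal z t) (MScal z (s \<cdot> t))"
| meq_tens_assoc: "mhom P a b s \<Longrightarrow> mhom P a' b' t \<Longrightarrow> mhom P a'' b'' u \<Longrightarrow>
    meq P ((s \<otimes> t) \<otimes> u) (s \<otimes> (t \<otimes> u))"
| meq_unit_tens: "mhom P a b t \<Longrightarrow> meq P (MId [] \<otimes> t) t"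
| meq_tens_unit: "mhom P a b t \<Longrightarrow> meq P (t \<otimes> MId []) t"
| meq_tens_id: "a \<in> lists (letters P) \<Longrightarrow> b \<in> lists (letters P) \<Longrightarrow>
    meq P (MId a \<otimes> MId b) (MId (a @ b))"
| meq_tens_add_left: "mhom P a b s \<Longrightarrow> mhom P a b t \<Longrightarrow> mhom P c d u \<Longrightarrow>
    meq P ((s \<oplus> t) \<otimes> u) (s \<otimes> u \<oplus> t \<otimes> u)"
| meq_tens_add_right: "mhom P a b u \<Longrightarrow> mhom P c d s \<Longrightarrow> mhom P c d t \<Longrightarrow>
    meq P (u \<otimes> (s \<oplus> t)) (u \<otimes> s \<oplus> u \<otimes> t)"
| meq_tens_scal_left: "mhom P a b s \<Longrightarrow> mhom P c d t \<Longrightarrow>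
    meq P (MScal z s \<otimes> t) (MScal z (s \<otimes> t))"
| meq_tens_scal_right: "mhom P a b s \<Longrightarrow> mhom P c d t \<Longrightarrow>
    meq P (s \<otimes> MScal z t) (MScal z (s \<otimes> t))"
| meq_interchange: "mhom P b c s' \<Longrightarrow> mhomog P p a b s \<Longrightarrow> mhomog P q b' c' t \<Longrightarrow>
    mhom P a' b' t' \<Longrightarrow>
    meq P ((s' \<otimes> t) \<cdot> (s \<otimes> t')) (MScal (sign (p * q)) ((s' \<cdot> s) \<otimes> (t \<cdot> t')))"

definition mcls :: "('l, 'g) mpres \<Rightarrow> ('l, 'g) mterm \<Rightarrow> ('l, 'g) mterm set" where
  "mcls P t = {s. meq P t s}"

definition presented :: "('l, 'g) mpres \<Rightarrow> ('l list, ('l, 'g) mterm set) smcat" where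
  "presented P = \<lparr>
     Obj = lists (letters P),
     Unit = [],
     OTens = (@),
     Hom = (\<lambda>a b. {mcls P t | t. mhom P a b t}),
     Part = (\<lambda>p a b. {mcls P t | t. mhomog P p a b t}),
     ZeroM = (\<lambda>a b. mcls P (MZero a b)),
     Add = (\<lambda>f g. \<Union>s\<in>f. \<Union>t\<in>g. mcls P (s \<oplus> t)),
     Scal = (\<lambda>z f. \<Union>s\<in>f. mcls P (MScal z s)),
     Ident = (\<lambda>a. mcls P (MId a)),
     Comp = (\<lambda>f g. \<Union>s\<in>f. \<Union>t\<in>g. mcls P (s \<cdot> t)),
     Tens = (\<lambda>f g. \<Union>s\<in>f. \<Union>t\<in>g. mcls P (s \<otimes> t))\<rparr>"

primrec msum :: "'l list \<Rightarrow> 'l list \<Rightarrow> ('l, 'g) mterm list \<Rightarrow> ('l, 'g) mterm" where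
  "msum a b [] = MZero a b"
| "msum a b (t # ts) = t \<oplus> msum a b ts"

primrec mpow :: "'l list \<Rightarrow> ('l, 'g) mterm \<Rightarrow> nat \<Rightarrow> ('l, 'g) mterm" where
  "mpow a t 0 = MId a"
| "mpow a t (Suc k) = t \<cdot> mpow a t k"


section \<open>The two affine supercategories\<close>

datatype 'q letter = Strand | Pin 'q

datatype 'q dgen = Cross | Dot | Token | RightPin 'q | LeftPin 'q

primrec dsrc :: "'q dgen \<Rightarrow> 'q letter list" where
  "dsrc Cross = [Strand, Strand]"
| "dsrc Dot = [Strand]"
| "dsrc Token = [Strand]"
| "dsrc (RightPin Q) = [Pin Q, Strand]"
| "dsrc (LeftPin Q) = [Strand, Pin Q]"

primrec dtgt :: "'q dgen \<Rightarrow> 'q letter list" where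
  "dtgt Cross = [Strand, Strand]"
| "dtgt Dot = [Strand]"
| "dtgt Token = [Strand]"
| "dtgt (RightPin Q) = [Strand, Pin Q]"
| "dtgt (LeftPin Q) = [Pin Q, Strand]"

type_synonym 'q dterm = "('q letter, 'q dgen) mterm"

abbreviation gT :: "'q dterm" where "gT \<equiv> MGen Cross"
abbreviation gX :: "'q dterm" where "gX \<equiv> MGen Dot"
abbreviation gC :: "'q dterm" where "gC \<equiv> MGen Token"
abbreviation gR :: "'q \<Rightarrow> 'q dterm" where "gR Q \<equiv> MGen (RightPin Q)"
abbreviation gL :: "'q \<Rightarrow> 'q dterm" where "gL Q \<equiv> MGen (LeftPin Q)"
abbreviation idI :: "'q dterm" where "idI \<equiv> MId [Strand]"
abbreviation idQ :: "'q \<Rightarrow> 'q dterm" where "idQ Q \<equiv> MId [Pin Q]"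
abbreviation powX :: "nat \<Rightarrow> 'q dterm" where "powX \<equiv> mpow [Strand] gX"
abbreviation powC :: "nat \<Rightarrow> 'q dterm" where "powC \<equiv> mpow [Strand] gC"

definition poly_dot :: "nat \<Rightarrow> (nat \<Rightarrow> complex) \<Rightarrow> 'q dterm" where
  "poly_dot n \<mu> = msum [Strand] [Strand] [MScal (\<mu> k) (powX k). k \<leftarrow> [0..<Suc n]]"

text \<open>The relations common to both supercategories; \<open>x\<close> is the polynomial generator of the
  one-variable algebra. Every element of \<^const>\<open>EE\<close> is a polynomial in \<open>x\<close> (indeed in \<open>x\<^sup>2\<close>), and
  \<open>Q(X)\<close> is obtained from such an expansion of \<open>Q\<close>. The pinnings of elements of the two-variable
  algebras are obtained in the same way.\<close>

inductive common_rel :: "'g::presentation salg \<Rightarrow> 'g salg dterm \<Rightarrow> 'g salg dterm \<Rightarrow> bool" for x where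
  "common_rel x (gT \<cdot> gT) (idI \<otimes> idI)"
| "common_rel x ((gT \<otimes> idI) \<cdot> (idI \<otimes> gT) \<cdot> (gT \<otimes> idI)) ((idI \<otimes> gT) \<cdot> (gT \<otimes> idI) \<cdot> (idI \<otimes> gT))"
| "Q \<in> EE \<Longrightarrow> common_rel x (gL Q \<cdot> (gX \<otimes> idQ Q)) ((idQ Q \<otimes> gX) \<cdot> gL Q)"
| "Q \<in> EE \<Longrightarrow> common_rel x (gR Q \<cdot> (idQ Q \<otimes> gX)) ((gX \<otimes> idQ Q) \<cdot> gR Q)"
| "Q \<in> EE \<Longrightarrow> Q = (\<Sum>k\<le>n. csc (\<mu> k) (x ^ k)) \<Longrightarrow>
     common_rel x (gR Q \<cdot> gL Q) (poly_dot n \<mu> \<otimes> idQ Q)"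
| "Q \<in> EE \<Longrightarrow> Q = (\<Sum>k\<le>n. csc (\<mu> k) (x ^ k)) \<Longrightarrow>
     common_rel x (gL Q \<cdot> gR Q) (idQ Q \<otimes> poly_dot n \<mu>)"
| "Q \<in> EE \<Longrightarrow> common_rel x ((gT \<otimes> idQ Q) \<cdot> (idI \<otimes> gR Q) \<cdot> (gR Q \<otimes> idI))
     ((idI \<otimes> gR Q) \<cdot> (gR Q \<otimes> idI) \<cdot> (idQ Q \<otimes> gT))"
| "Q \<in> EE \<Longrightarrow> common_rel x ((gL Q \<otimes> idI) \<cdot> (idI \<otimes> gL Q) \<cdot> (gT \<otimes> idQ Q))
     ((idQ Q \<otimes> gT) \<cdot> (gL Q \<otimes> idI) \<cdot> (idI \<otimes> gL Q))"
| "common_rel x (gC \<cdot> gC) idI"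
| "common_rel x (gC \<cdot> gX) (MScal (-1) (gX \<cdot> gC))"
| "Q \<in> EE \<Longrightarrow> common_rel x (gL Q \<cdot> (gC \<otimes> idQ Q)) ((idQ Q \<otimes> gC) \<cdot> gL Q)"
| "Q \<in> EE \<Longrightarrow> common_rel x (gR Q \<cdot> (idQ Q \<otimes> gC)) ((gC \<otimes> idQ Q) \<cdot> gR Q)"

text \<open>Pinning of \<open>\<Sum>r s\<le>n. \<mu> r s x\<^sub>1\<^sup>r x\<^sub>2\<^sup>s\<close> and of
  \<open>\<Sum>a b\<le>1. \<Sum>r s\<le>n. \<mu> a b r s c\<^sub>1\<^sup>a c\<^sub>2\<^sup>b x\<^sub>1\<^sup>r x\<^sub>2\<^sup>s\<close>, respectively.\<close>

definition opin :: "'q \<Rightarrow> nat \<Rightarrow> (nat \<Rightarrow> nat \<Rightarrow> complex) \<Rightarrow> 'q dterm" where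
  "opin Q n \<mu> = msum [Strand, Pin Q, Strand] [Strand, Pin Q, Strand]
     [MScal (\<mu> r s) (powX r \<otimes> idQ Q \<otimes> powX s). r \<leftarrow> [0..<Suc n], s \<leftarrow> [0..<Suc n]]"

definition pin :: "'q \<Rightarrow> nat \<Rightarrow> (nat \<Rightarrow> nat \<Rightarrow> nat \<Rightarrow> nat \<Rightarrow> complex) \<Rightarrow> 'q dterm" where
  "pin Q n \<mu> = msum [Strand, Pin Q, Strand] [Strand, Pin Q, Strand]
     [MScal (\<mu> a b r s) ((powC a \<cdot> powX r) \<otimes> idQ Q \<otimes> (powC b \<cdot> powX s)).
        a \<leftarrow> [0, 1], b \<leftarrow> [0, 1], r \<leftarrow> [0..<Suc n], s \<leftarrow> [0..<Suc n]]"

inductive TAS_rel :: "unit opol dterm \<Rightarrow> unit opol dterm \<Rightarrow> bool" where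
  "common_rel (ox ()) s t \<Longrightarrow> TAS_rel s t"
| "TAS_rel (gT \<cdot> (gX \<otimes> idI) \<oplus> (idI \<otimes> gX) \<cdot> gT) (idI \<otimes> idI)"
| "TAS_rel (gT \<cdot> (gC \<otimes> idI)) (MScal (-1) ((gC \<otimes> idI) \<cdot> gT))"
| "TAS_rel (gT \<cdot> (idI \<otimes> gC)) (MScal (-1) ((idI \<otimes> gC) \<cdot> gT))"
| "Q \<in> EE \<Longrightarrow>
   odd_demazure (opol_at1 Q) = (\<Sum>r\<le>n. \<Sum>s\<le>n. csc (\<mu> r s) (ox First ^ r * ox Second ^ s)) \<Longrightarrow>
   TAS_rel ((gR Q \<otimes> idI) \<cdot> (idQ Q \<otimes> gT) \<cdot> (gL Q \<otimes> idI))
     ((idI \<otimes> gL Q) \<cdot> (gT \<otimes> idQ Q) \<cdot> (idI \<otimes> gR Q) \<oplus> opin Q n \<mu>)"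

inductive TAH_rel :: "unit polcl dterm \<Rightarrow> unit polcl dterm \<Rightarrow> bool" where
  "common_rel (pcx ()) s t \<Longrightarrow> TAH_rel s t"
| "TAH_rel (gT \<cdot> (gC \<otimes> idI)) ((idI \<otimes> gC) \<cdot> gT)"
| "TAH_rel (gT \<cdot> (gX \<otimes> idI)) ((idI \<otimes> gX) \<cdot> gT \<ominus> idI \<otimes> idI \<ominus> gC \<otimes> gC)"
| "Q \<in> EE \<Longrightarrow>
   clifford_demazure (polcl_at1 Q) = (\<Sum>a\<le>1. \<Sum>b\<le>1. \<Sum>r\<le>n. \<Sum>s\<le>n.
     csc (\<mu> a b r s) (pcc First ^ a * pcc Second ^ b * pcx First ^ r * pcx Second ^ s)) \<Longrightarrow>
   TAH_rel ((gR Q \<otimes> idI) \<cdot> (idQ Q \<otimes> gT) \<cdot> (gL Q \<otimes> idI))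
     ((idI \<otimes> gL Q) \<cdot> (gT \<otimes> idQ Q) \<cdot> (idI \<otimes> gR Q) \<ominus> pin Q n \<mu>)"

definition TAS_pres :: "(unit opol letter, unit opol dgen) mpres" where
  "TAS_pres = \<lparr>
     letters = insert Strand (Pin ` EE),
     gens = {Cross, Dot, Token} \<union> RightPin ` EE \<union> LeftPin ` EE,
     src = dsrc, tgt = dtgt,
     par = (\<lambda>g. if g \<in> {Cross, Dot, Token} then 1 else 0),
     rel = TAS_rel\<rparr>"

definition TAH_pres :: "(unit polcl letter, unit polcl dgen) mpres" where
  "TAH_pres = \<lparr>
     letters = insert Strand (Pin ` EE),
     gens = {Cross, Dot, Token} \<union> RightPin ` EE \<union> LeftPin ` EE,
     src = dsrc, tgt = dtgt,
     par = (\<lambda>g. if g = Token then 1 else 0),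
     rel = TAH_rel\<rparr>"

abbreviation "TAS \<equiv> presented TAS_pres"
abbreviation "TAH \<equiv> presented TAH_pres"

text \<open>The morphisms of the two supercategories denoted by terms in the generators.\<close>

abbreviation morS ("\<lbrakk>_\<rbrakk>\<^sub>S") where "\<lbrakk>t\<rbrakk>\<^sub>S \<equiv> mcls TAS_pres t"
abbreviation morH ("\<lbrakk>_\<rbrakk>\<^sub>H") where "\<lbrakk>t\<rbrakk>\<^sub>H \<equiv> mcls TAH_pres t"

end

theory Submission
  imports Defs "HOL-Computational_Algebra.Polynomial"
begin

text \<open>
  Why the two supercategories are isomorphic. Let \<open>c\<^sub>1\<close> and \<open>c\<^sub>2\<close> be the tokens on two strands and
  \<open>d = c\<^sub>1 - c\<^sub>2\<close>, so \<open>d\<^sup>2 = 2\<close>. An even crossing permutes the tokens, an odd crossing anticommutes with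
  them; in both cases it anticommutes with \<open>d\<close>, and multiplication by a multiple of \<open>d\<close> exchanges the
  two kinds of crossing. In the same way multiplication by the token exchanges even and odd dots.
  Hence every supercategory that contains one kind of data contains the other kind, given by the
  formulas of the theorem: this is \<open>even_to_odd\<close> and \<open>odd_to_even\<close>. The factors are chosen so that
  the two constructions undo each other, by \<open>d\<^sup>2 = 2\<close>, \<open>C\<^sup>2 = 1\<close> and \<open>w\<^sup>2 = -2\<close>.

  The universal property of a presented supercategory, \<open>induced_superfunctor\<close>, turns the new data into
  superfunctors in both directions, and they are inverse because they are so on generators
  (\<open>generators_fixed\<close>).

  The relation that moves a crossing through a pin has a correction term, a pinned Demazure
  derivative. All tokens and dots on two strands, possibly with a pin between them, are values of a
  homomorphism \<open>ev\<close> from the algebra \<open>Pol\<^sub>2(Cl)\<close> to endomorphisms; the odd polynomials are included by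
  \<open>x\<^sub>i \<mapsto> c\<^sub>i x\<^sub>i / w\<close>. Under this inclusion the odd Demazure operator becomes \<open>d / w\<close> times the even one
  (\<open>demazure_compare\<close>), which is exactly the factor that the twisted crossing produces. Calculations
  with tokens and dots are made in \<open>Pol\<^sub>2(Cl)\<close> and transported by \<open>ev\<close>.

  Two facts come before this. Terms modulo the relations form a supercategory: that no nonzero
  morphism is both even and odd follows from the involution that negates the odd generators. And
  \<open>psi_E\<close> is a bijection between the two sets of pins, because both consist of the nonzero polynomials
  in \<open>x\<^sup>2\<close>.
\<close>

section \<open>Presented supercategories\<close>

text \<open>Typing and parity are computed by recursion on terms, so that rewriting decides the side
  conditions on concrete diagrams.\<close>

primrec mdom :: "('l, 'g) mpres \<Rightarrow> ('l, 'g) mterm \<Rightarrow> 'l list" where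
  "mdom P (MGen g) = src P g"
| "mdom P (MId a) = a"
| "mdom P (MZero a b) = a"
| "mdom P (s \<oplus> t) = mdom P s"
| "mdom P (MScal z t) = mdom P t"
| "mdom P (s \<cdot> t) = mdom P t"
| "mdom P (s \<otimes> t) = mdom P s @ mdom P t"

primrec mcod :: "('l, 'g) mpres \<Rightarrow> ('l, 'g) mterm \<Rightarrow> 'l list" where
  "mcod P (MGen g) = tgt P g"
| "mcod P (MId a) = a"
| "mcod P (MZero a b) = b"
| "mcod P (s \<oplus> t) = mcod P s"
| "mcod P (MScal z t) = mcod P t"
| "mcod P (s \<cdot> t) = mcod P s"
| "mcod P (s \<otimes> t) = mcod P s @ mcod P t"

primrec mwf :: "('l, 'g) mpres \<Rightarrow> ('l, 'g) mterm \<Rightarrow> bool" where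
  "mwf P (MGen g) \<longleftrightarrow> g \<in> gens P"
| "mwf P (MId a) \<longleftrightarrow> a \<in> lists (letters P)"
| "mwf P (MZero a b) \<longleftrightarrow> a \<in> lists (letters P) \<and> b \<in> lists (letters P)"
| "mwf P (s \<oplus> t) \<longleftrightarrow> mwf P s \<and> mwf P t \<and> mdom P s = mdom P t \<and> mcod P s = mcod P t"
| "mwf P (MScal z t) \<longleftrightarrow> mwf P t"
| "mwf P (s \<cdot> t) \<longleftrightarrow> mwf P s \<and> mwf P t \<and> mdom P s = mcod P t"
| "mwf P (s \<otimes> t) \<longleftrightarrow> mwf P s \<and> mwf P t"

primrec mpar :: "('l, 'g) mpres \<Rightarrow> ('l, 'g) mterm \<Rightarrow> bit" where
  "mpar P (MGen g) = par P g"
| "mpar P (MId a) = 0"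
| "mpar P (MZero a b) = 0"
| "mpar P (s \<oplus> t) = mpar P s"
| "mpar P (MScal z t) = mpar P t"
| "mpar P (s \<cdot> t) = mpar P s + mpar P t"
| "mpar P (s \<otimes> t) = mpar P s + mpar P t"

text \<open>Homogeneity with parity given by \<open>mpar\<close>. A zero term, which has both parities, is taken to be
  even here.\<close>

primrec mgraded :: "('l, 'g) mpres \<Rightarrow> ('l, 'g) mterm \<Rightarrow> bool" where
  "mgraded P (MGen g) = True"
| "mgraded P (MId a) = True"
| "mgraded P (MZero a b) = True"
| "mgraded P (s \<oplus> t) \<longleftrightarrow> mgraded P s \<and> mgraded P t \<and> mpar P s = mpar P t"
| "mgraded P (MScal z t) = mgraded P t"
| "mgraded P (s \<cdot> t) \<longleftrightarrow> mgraded P s \<and> mgraded P t"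
| "mgraded P (s \<otimes> t) \<longleftrightarrow> mgraded P s \<and> mgraded P t"

text \<open>The parity involution: every odd generator is multiplied by \<open>-1\<close>.\<close>

primrec msgn :: "('l, 'g) mpres \<Rightarrow> ('l, 'g) mterm \<Rightarrow> ('l, 'g) mterm" where
  "msgn P (MGen g) = MScal (sign (par P g)) (MGen g)"
| "msgn P (MId a) = MId a"
| "msgn P (MZero a b) = MZero a b"
| "msgn P (s \<oplus> t) = msgn P s \<oplus> msgn P t"
| "msgn P (MScal z t) = MScal z (msgn P t)"
| "msgn P (s \<cdot> t) = msgn P s \<cdot> msgn P t"
| "msgn P (s \<otimes> t) = msgn P s \<otimes> msgn P t"

lemma mhom_iff: "mhom P a b t \<longleftrightarrow> mwf P t \<and> mdom P t = a \<and> mcod P t = b"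
proof
  show "mwf P t \<and> mdom P t = a \<and> mcod P t = b" if "mhom P a b t"
    using that by induction auto
next
  have "mwf P t \<Longrightarrow> mhom P (mdom P t) (mcod P t) t"
    by (induction t) (auto intro: mhom.intros)
  then show "mwf P t \<and> mdom P t = a \<and> mcod P t = b \<Longrightarrow> mhom P a b t" by blast
qed

lemma mhomog_mhom: "mhomog P p a b t \<Longrightarrow> mhom P a b t"
  by (induction rule: mhomog.induct) (auto intro: mhom.intros)

lemma mhomogI:
  "mwf P t \<Longrightarrow> mgraded P t \<Longrightarrow> p = mpar P t \<Longrightarrow> a = mdom P t \<Longrightarrow> b = mcod P t \<Longrightarrow> mhomog P p a b t"
proof (induction t arbitrary: p a b)
  case (MComp s t)
  then show ?case by (simp only: mwf.simps mgraded.simps mpar.simps mdom.simps mcod.simps) (metis mhomog.intros(6))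
next
  case (MTens s t)
  then show ?case by (simp only: mwf.simps mgraded.simps mpar.simps mdom.simps mcod.simps) (metis mhomog.intros(7))
qed (simp_all add: mhomog.intros)

declare meq_trans [trans]

lemma sign_mult: "sign p * sign q = sign (p + q)"
  by (cases p; cases q) (auto simp: sign_def)

locale typed_presentation =
  fixes P :: "('l, 'g) mpres"
  assumes gens_typed: "g \<in> gens P \<Longrightarrow> src P g \<in> lists (letters P) \<and> tgt P g \<in> lists (letters P)"
    and rel_typed: "rel P s t \<Longrightarrow> mwf P s \<and> mwf P t \<and> mdom P s = mdom P t \<and> mcod P s = mcod P t"
begin

lemma mwf_words: "mwf P t \<Longrightarrow> mdom P t \<in> lists (letters P) \<and> mcod P t \<in> lists (letters P)"
  by (induction t) (use gens_typed in auto)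

lemma meq_typed:
  "meq P s t \<Longrightarrow> mwf P s \<and> mwf P t \<and> mdom P s = mdom P t \<and> mcod P s = mcod P t"
  by (induction rule: meq.induct) (use rel_typed mwf_words in \<open>auto simp: mhom_iff dest!: mhomog_mhom\<close>)

lemma in_mcls: "s \<in> mcls P t \<longleftrightarrow> meq P t s"
  by (simp add: mcls_def)

lemma mcls_self: "t \<in> mcls P t \<longleftrightarrow> mwf P t"
  using meq_refl[of P _ _ t] meq_typed[of t t] by (auto simp: mcls_def mhom_iff)

lemma mcls_illtyped: "\<not> mwf P t \<Longrightarrow> mcls P t = {}"
  using meq_typed by (auto simp: mcls_def)

lemma mcls_eqI: "meq P s t \<Longrightarrow> mcls P s = mcls P t"
  unfolding mcls_def by (rule Collect_cong) (blast intro: meq_trans meq_sym)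

lemma mcls_eq_iff: "mwf P s \<Longrightarrow> mcls P s = mcls P t \<longleftrightarrow> meq P s t"
  using mcls_eqI[of s t] mcls_self[of s] by (metis in_mcls meq_sym)

text \<open>The class of an ill-typed term is empty. Hence the operations on classes agree with those on
  terms for all terms, typed or not, and can be used as rewrite rules.\<close>

lemma union_mcls:
  assumes wf: "mwf P (k s t) \<Longrightarrow> mwf P s \<and> mwf P t"
    and cong: "\<And>s' t'. mwf P (k s t) \<Longrightarrow> meq P s s' \<Longrightarrow> meq P t t' \<Longrightarrow> meq P (k s t) (k s' t')"
    and wf': "\<And>s' t'. meq P s s' \<Longrightarrow> meq P t t' \<Longrightarrow> mwf P (k s' t') \<Longrightarrow> mwf P (k s t)"
  shows "(\<Union>s'\<in>mcls P s. \<Union>t'\<in>mcls P t. mcls P (k s' t')) = mcls P (k s t)"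
proof (cases "mwf P (k s t)")
  case True
  have "(\<Union>s'\<in>mcls P s. \<Union>t'\<in>mcls P t. mcls P (k s' t')) =
      (\<Union>s'\<in>mcls P s. \<Union>t'\<in>mcls P t. mcls P (k s t))"
    using cong[OF True] by (intro SUP_cong refl mcls_eqI[symmetric]) (simp add: in_mcls)
  moreover have "mcls P s \<noteq> {}" "mcls P t \<noteq> {}"
    using wf[OF True] mcls_self by blast+
  ultimately show ?thesis by simp
next
  case False
  then have "\<not> mwf P (k s' t')" if "s' \<in> mcls P s" "t' \<in> mcls P t" for s' t'
    using wf' that by (auto simp: in_mcls)
  then show ?thesis using False by (simp add: mcls_illtyped)
qed

lemma presented_ops [simp]:
  "Comp (presented P) (mcls P s) (mcls P t) = mcls P (s \<cdot> t)"
  "Tens (presented P) (mcls P s) (mcls P t) = mcls P (s \<otimes> t)"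
  "Add (presented P) (mcls P s) (mcls P t) = mcls P (s \<oplus> t)"
  "Scal (presented P) z (mcls P t) = mcls P (MScal z t)"
proof -
  show "Comp (presented P) (mcls P s) (mcls P t) = mcls P (s \<cdot> t)"
    unfolding presented_def smcat.simps
  proof (rule union_mcls[of MComp s t])
    fix s' t'
    show "mwf P (s \<cdot> t) \<Longrightarrow> meq P s s' \<Longrightarrow> meq P t t' \<Longrightarrow> meq P (s \<cdot> t) (s' \<cdot> t')"
      using comp_cong[of P "mdom P s" "mcod P s" s "mdom P t" t s' t'] by (simp add: mhom_iff)
    show "meq P s s' \<Longrightarrow> meq P t t' \<Longrightarrow> mwf P (s' \<cdot> t') \<Longrightarrow> mwf P (s \<cdot> t)"
      using meq_typed[of s s'] meq_typed[of t t'] by simp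
  qed simp
  show "Tens (presented P) (mcls P s) (mcls P t) = mcls P (s \<otimes> t)"
    unfolding presented_def smcat.simps
  proof (rule union_mcls[of MTens s t])
    fix s' t'
    show "mwf P (s \<otimes> t) \<Longrightarrow> meq P s s' \<Longrightarrow> meq P t t' \<Longrightarrow> meq P (s \<otimes> t) (s' \<otimes> t')"
      using tens_cong[of P "mdom P s" "mcod P s" s "mdom P t" "mcod P t" t s' t'] by (simp add: mhom_iff)
    show "meq P s s' \<Longrightarrow> meq P t t' \<Longrightarrow> mwf P (s' \<otimes> t') \<Longrightarrow> mwf P (s \<otimes> t)"
      using meq_typed[of s s'] meq_typed[of t t'] by simp
  qed simp
  show "Add (presented P) (mcls P s) (mcls P t) = mcls P (s \<oplus> t)"
    unfolding presented_def smcat.simps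
  proof (rule union_mcls[of MAdd s t])
    fix s' t'
    show "mwf P (s \<oplus> t) \<Longrightarrow> meq P s s' \<Longrightarrow> meq P t t' \<Longrightarrow> meq P (s \<oplus> t) (s' \<oplus> t')"
      using add_cong[of P "mdom P s" "mcod P s" s t s' t'] by (simp add: mhom_iff)
    show "meq P s s' \<Longrightarrow> meq P t t' \<Longrightarrow> mwf P (s' \<oplus> t') \<Longrightarrow> mwf P (s \<oplus> t)"
      using meq_typed[of s s'] meq_typed[of t t'] by simp
  qed simp
  have "mcls P (MScal z t') = mcls P (MScal z t)" if "meq P t t'" for t'
    using meq_typed[OF that] scal_cong[of P "mdom P t" "mcod P t" t t' z] that
    by (simp add: mhom_iff mcls_eqI)
  then have "(\<Union>t'\<in>mcls P t. mcls P (MScal z t')) = (\<Union>t'\<in>mcls P t. mcls P (MScal z t))"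
    by (intro SUP_cong refl) (simp add: in_mcls)
  then show "Scal (presented P) z (mcls P t) = mcls P (MScal z t)"
    using mcls_self[of t] mcls_illtyped[of t] mcls_illtyped[of "MScal z t"]
    by (cases "mwf P t") (auto simp: presented_def)
qed

lemma presented_objs [simp]:
  "Obj (presented P) = lists (letters P)" "Unit (presented P) = []" "OTens (presented P) = (@)"
  "ZeroM (presented P) a b = mcls P (MZero a b)" "Ident (presented P) a = mcls P (MId a)"
  by (simp_all add: presented_def)

lemma presented_HomE:
  assumes "f \<in> Hom (presented P) a b"
  obtains t where "f = mcls P t" "mhom P a b t"
  using assms by (auto simp: presented_def)

lemma presented_PartE:
  assumes "f \<in> Part (presented P) p a b"
  obtains t where "f = mcls P t" "mhomog P p a b t"
  using assms by (auto simp: presented_def)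

lemma presented_HomI: "mhom P a b t \<Longrightarrow> mcls P t \<in> Hom (presented P) a b"
  by (auto simp: presented_def)

lemma presented_PartI: "mhomog P p a b t \<Longrightarrow> mcls P t \<in> Part (presented P) p a b"
  by (auto simp: presented_def)

lemma msgn_mhomog: "mhomog P p a b t \<Longrightarrow> mhomog P p a b (msgn P t)"
  by (induction rule: mhomog.induct) (simp_all only: msgn.simps mhomog.intros)

lemma msgn_mhom: "mhom P a b t \<Longrightarrow> mhom P a b (msgn P t)"
  by (induction rule: mhom.induct) (auto intro: mhom.intros)

lemma scal_comp:
  assumes "mhom P b c s" "mhom P a b t"
  shows "meq P (MScal z s \<cdot> MScal z' t) (MScal (z * z') (s \<cdot> t))"
proof -
  note st = mhom.intros(6)[OF assms] and t' = mhom.intros(5)[OF assms(2), of z']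
  have "meq P (MScal z s \<cdot> MScal z' t) (MScal z (s \<cdot> MScal z' t))"
    using assms(1) t' by (rule meq_comp_scal_left)
  also have "meq P \<dots> (MScal z (MScal z' (s \<cdot> t)))"
    using mhom.intros(6)[OF assms(1) t'] meq_comp_scal_right[OF assms] by (rule scal_cong)
  also have "meq P \<dots> (MScal (z * z') (s \<cdot> t))"
    using st by (rule meq_scal_scal)
  finally show ?thesis .
qed

lemma scal_tens:
  assumes "mhom P a b s" "mhom P c d t"
  shows "meq P (MScal z s \<otimes> MScal z' t) (MScal (z * z') (s \<otimes> t))"
proof -
  note st = mhom.intros(7)[OF assms] and t' = mhom.intros(5)[OF assms(2), of z']
  have "meq P (MScal z s \<otimes> MScal z' t) (MScal z (s \<otimes> MScal z' t))"
    using assms(1) t' by (rule meq_tens_scal_left)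
  also have "meq P \<dots> (MScal z (MScal z' (s \<otimes> t)))"
    using mhom.intros(7)[OF assms(1) t'] meq_tens_scal_right[OF assms] by (rule scal_cong)
  also have "meq P \<dots> (MScal (z * z') (s \<otimes> t))"
    using st by (rule meq_scal_scal)
  finally show ?thesis .
qed

lemma scal_MZero:
  assumes "a \<in> lists (letters P)" "b \<in> lists (letters P)"
  shows "meq P (MScal z (MZero a b)) (MZero a b)"
proof -
  note z = mhom.intros(3)[OF assms]
  note sz = mhom.intros(5)[OF z]
  have "meq P (MScal z (MZero a b)) (MScal z (MZero a b \<oplus> MScal (-1) (MZero a b)))"
    using z meq_sym[OF meq_add_neg[OF z]] by (rule scal_cong)
  also have "meq P \<dots> (MScal z (MZero a b) \<oplus> MScal z (MScal (-1) (MZero a b)))"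
    using z sz by (rule meq_scal_add)
  also have "meq P \<dots> (MScal z (MZero a b) \<oplus> MScal (-1) (MScal z (MZero a b)))"
    using sz mhom.intros(5)[OF sz] meq_refl[OF sz]
      meq_trans[OF meq_scal_scal[OF z, of z "-1"] meq_sym[OF meq_scal_scal[OF z, of "-1" z, simplified mult.commute]]]
    by (rule add_cong)
  also have "meq P \<dots> (MZero a b)"
    using sz by (rule meq_add_neg)
  finally show ?thesis .
qed

lemma msgn_homogeneous: "mhomog P p a b t \<Longrightarrow> meq P (msgn P t) (MScal (sign p) t)"
proof (induction rule: mhomog.induct)
  case (1 g)
  then show ?case by (simp only: msgn.simps) (blast intro: meq_refl mhom.intros)
next
  case (2 a)
  then show ?case by (simp add: sign_def) (blast intro: meq_sym meq_scal_one mhom.intros)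
next
  case (3 a b p)
  then show ?case by (simp add: scal_MZero meq_sym)
next
  case (4 p a b s t)
  note h = 4(1,2)[THEN mhomog_mhom]
  show ?case
    using meq_trans[OF add_cong[OF h[THEN msgn_mhom] 4(3,4)] meq_sym[OF meq_scal_add[OF h]]] by simp
next
  case (5 p a b t z)
  then have t: "mhom P a b t" by (blast intro: mhomog_mhom)
  have "meq P (MScal z (msgn P t)) (MScal z (MScal (sign p) t))"
    using 5(2) msgn_mhom[OF t] by (rule scal_cong[rotated])
  also have "meq P \<dots> (MScal (z * sign p) t)" using t by (rule meq_scal_scal)
  also have "meq P \<dots> (MScal (sign p) (MScal z t))"
    using meq_sym[OF meq_scal_scal[OF t, of "sign p" z]] by (simp add: mult.commute)
  finally show ?case by simp
next
  case (6 p b c s q a t)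
  note h = 6(1,2)[THEN mhomog_mhom]
  have "meq P (msgn P s \<cdot> msgn P t) (MScal (sign p) s \<cdot> MScal (sign q) t)"
    using 6(3,4) h by (blast intro: comp_cong msgn_mhom)
  also have "meq P \<dots> (MScal (sign (p + q)) (s \<cdot> t))"
    using scal_comp[OF h, of "sign p" "sign q"] by (simp add: sign_mult)
  finally show ?case by simp
next
  case (7 p a b s q c d t)
  note h = 7(1,2)[THEN mhomog_mhom]
  have "meq P (msgn P s \<otimes> msgn P t) (MScal (sign p) s \<otimes> MScal (sign q) t)"
    using 7(3,4) h by (blast intro: tens_cong msgn_mhom)
  also have "meq P \<dots> (MScal (sign (p + q)) (s \<otimes> t))"
    using scal_tens[OF h, of "sign p" "sign q"] by (simp add: sign_mult)
  finally show ?case by simp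
qed

end

text \<open>Relations need to be homogeneous only modulo all relations. A polynomial in an odd dot, for
  example, has terms of both parities; it is even because certain coefficients vanish, which
  the syntax of the term does not show.\<close>

locale graded_presentation = typed_presentation +
  assumes rel_sgn: "rel P s t \<Longrightarrow> meq P (msgn P s) (msgn P t)"
begin

lemma msgn_meq: "meq P s t \<Longrightarrow> meq P (msgn P s) (msgn P t)"
proof (induction rule: meq.induct)
  case meq_rel
  then show ?case by (rule rel_sgn)
next
  case meq_refl
  then show ?case
    by (blast intro: meq.meq_refl msgn_mhom)
next
  case meq_sym
  then show ?case
    by (blast intro: meq.meq_sym msgn_mhom)
next
  case meq_trans
  then show ?case
    by (blast intro: meq.meq_trans msgn_mhom)
next
  case add_cong
  then show ?case
    by (simp only: msgn.simps) (blast intro: meq.add_cong msgn_mhom msgn_mhomog)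
next
  case scal_cong
  then show ?case
    by (simp only: msgn.simps) (blast intro: meq.scal_cong msgn_mhom msgn_mhomog)
next
  case comp_cong
  then show ?case
    by (simp only: msgn.simps) (blast intro: meq.comp_cong msgn_mhom msgn_mhomog)
next
  case tens_cong
  then show ?case
    by (simp only: msgn.simps) (blast intro: meq.tens_cong msgn_mhom msgn_mhomog)
next
  case meq_add_assoc
  then show ?case
    by (simp only: msgn.simps) (blast intro: meq.meq_add_assoc msgn_mhom msgn_mhomog)
next
  case meq_add_comm
  then show ?case
    by (simp only: msgn.simps) (blast intro: meq.meq_add_comm msgn_mhom msgn_mhomog)
next
  case meq_add_zero
  then show ?case
    by (simp only: msgn.simps) (blast intro: meq.meq_add_zero msgn_mhom msgn_mhomog)
next
  case meq_add_neg
  then show ?case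
    by (simp only: msgn.simps) (blast intro: meq.meq_add_neg msgn_mhom msgn_mhomog)
next
  case meq_scal_add
  then show ?case
    by (simp only: msgn.simps) (blast intro: meq.meq_scal_add msgn_mhom msgn_mhomog)
next
  case meq_add_scal
  then show ?case
    by (simp only: msgn.simps) (blast intro: meq.meq_add_scal msgn_mhom msgn_mhomog)
next
  case meq_scal_scal
  then show ?case
    by (simp only: msgn.simps) (blast intro: meq.meq_scal_scal msgn_mhom msgn_mhomog)
next
  case meq_scal_one
  then show ?case
    by (simp only: msgn.simps) (blast intro: meq.meq_scal_one msgn_mhom msgn_mhomog)
next
  case meq_comp_assoc
  then show ?case
    by (simp only: msgn.simps) (blast intro: meq.meq_comp_assoc msgn_mhom msgn_mhomog)
next
  case meq_id_comp
  then show ?case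
    by (simp only: msgn.simps) (blast intro: meq.meq_id_comp msgn_mhom msgn_mhomog)
next
  case meq_comp_id
  then show ?case
    by (simp only: msgn.simps) (blast intro: meq.meq_comp_id msgn_mhom msgn_mhomog)
next
  case meq_comp_add_left
  then show ?case
    by (simp only: msgn.simps) (blast intro: meq.meq_comp_add_left msgn_mhom msgn_mhomog)
next
  case meq_comp_add_right
  then show ?case
    by (simp only: msgn.simps) (blast intro: meq.meq_comp_add_right msgn_mhom msgn_mhomog)
next
  case meq_comp_scal_left
  then show ?case
    by (simp only: msgn.simps) (blast intro: meq.meq_comp_scal_left msgn_mhom msgn_mhomog)
next
  case meq_comp_scal_right
  then show ?case
    by (simp only: msgn.simps) (blast intro: meq.meq_comp_scal_right msgn_mhom msgn_mhomog)
next
  case meq_tens_assoc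
  then show ?case
    by (simp only: msgn.simps) (blast intro: meq.meq_tens_assoc msgn_mhom msgn_mhomog)
next
  case meq_unit_tens
  then show ?case
    by (simp only: msgn.simps) (blast intro: meq.meq_unit_tens msgn_mhom msgn_mhomog)
next
  case meq_tens_unit
  then show ?case
    by (simp only: msgn.simps) (blast intro: meq.meq_tens_unit msgn_mhom msgn_mhomog)
next
  case meq_tens_id
  then show ?case
    by (simp only: msgn.simps) (blast intro: meq.meq_tens_id msgn_mhom msgn_mhomog)
next
  case meq_tens_add_left
  then show ?case
    by (simp only: msgn.simps) (blast intro: meq.meq_tens_add_left msgn_mhom msgn_mhomog)
next
  case meq_tens_add_right
  then show ?case
    by (simp only: msgn.simps) (blast intro: meq.meq_tens_add_right msgn_mhom msgn_mhomog)
next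
  case meq_tens_scal_left
  then show ?case
    by (simp only: msgn.simps) (blast intro: meq.meq_tens_scal_left msgn_mhom msgn_mhomog)
next
  case meq_tens_scal_right
  then show ?case
    by (simp only: msgn.simps) (blast intro: meq.meq_tens_scal_right msgn_mhom msgn_mhomog)
next
  case meq_interchange
  then show ?case
    by (simp only: msgn.simps) (blast intro: meq.meq_interchange msgn_mhom msgn_mhomog)
qed

lemma meq_medial:
  assumes "mhom P a b r" "mhom P a b s" "mhom P a b t" "mhom P a b u"
  shows "meq P ((r \<oplus> s) \<oplus> (t \<oplus> u)) ((r \<oplus> u) \<oplus> (s \<oplus> t))"
proof -
  note h = mhom.intros(4)[of P a b]
  note tu = h[OF assms(3,4)] and st = h[OF assms(2,3)]
  have "meq P ((r \<oplus> s) \<oplus> (t \<oplus> u)) (r \<oplus> (s \<oplus> (t \<oplus> u)))"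
    using assms(1,2) tu by (rule meq_add_assoc)
  also have "meq P \<dots> (r \<oplus> (u \<oplus> (s \<oplus> t)))"
    using assms(1) h[OF assms(2) tu] meq_refl[OF assms(1)]
      meq_trans[OF meq_sym[OF meq_add_assoc[OF assms(2-4)]] meq_add_comm[OF st assms(4)]]
    by (rule add_cong)
  also have "meq P \<dots> ((r \<oplus> u) \<oplus> (s \<oplus> t))"
    using meq_add_assoc[OF assms(1,4) st] by (rule meq_sym)
  finally show ?thesis .
qed

text \<open>Composition and tensor product, both bilinear, are treated together: \<open>k\<close> stands for either.\<close>

lemma meq_expand:
  assumes congr: "\<And>s s' t t'. mhom P a b s \<Longrightarrow> mhom P c d t \<Longrightarrow> meq P s s' \<Longrightarrow> meq P t t' \<Longrightarrow>
      meq P (k s t) (k s' t')"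
    and left: "\<And>s s' t. mhom P a b s \<Longrightarrow> mhom P a b s' \<Longrightarrow> mhom P c d t \<Longrightarrow>
      meq P (k (s \<oplus> s') t) (k s t \<oplus> k s' t)"
    and right: "\<And>s t t'. mhom P a b s \<Longrightarrow> mhom P c d t \<Longrightarrow> mhom P c d t' \<Longrightarrow>
      meq P (k s (t \<oplus> t')) (k s t \<oplus> k s t')"
    and typed: "\<And>s t. mhom P a b s \<Longrightarrow> mhom P c d t \<Longrightarrow> mhom P a' b' (k s t)"
    and s: "mhom P a b s0" "mhom P a b s1" "meq P s (s0 \<oplus> s1)" "mhom P a b s"
    and t: "mhom P c d t0" "mhom P c d t1" "meq P t (t0 \<oplus> t1)" "mhom P c d t"
  shows "meq P (k s t) ((k s0 t0 \<oplus> k s1 t1) \<oplus> (k s0 t1 \<oplus> k s1 t0))"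
proof -
  note tt = mhom.intros(4)[OF t(1,2)]
  have "meq P (k s t) (k (s0 \<oplus> s1) (t0 \<oplus> t1))"
    using s(4) t(4) s(3) t(3) by (rule congr)
  also have "meq P \<dots> (k s0 (t0 \<oplus> t1) \<oplus> k s1 (t0 \<oplus> t1))"
    using s(1,2) tt by (rule left)
  also have "meq P \<dots> ((k s0 t0 \<oplus> k s0 t1) \<oplus> (k s1 t0 \<oplus> k s1 t1))"
    using typed[OF s(1) tt] typed[OF s(2) tt] right[OF s(1) t(1,2)] right[OF s(2) t(1,2)]
    by (rule add_cong)
  also have "meq P \<dots> ((k s0 t0 \<oplus> k s1 t1) \<oplus> (k s0 t1 \<oplus> k s1 t0))"
    by (rule meq_medial[of a' b']) (intro typed s t)+
  finally show ?thesis .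
qed

lemma mhom_parts:
  "mhom P a b t \<Longrightarrow> \<exists>s u. mhomog P 0 a b s \<and> mhomog P 1 a b u \<and> meq P t (s \<oplus> u)"
proof (induction rule: mhom.induct)
  have zero: "mhom P a b t \<Longrightarrow> mhomog P p a b (MZero a b)" for p a b t
    using mwf_words[of t] by (auto simp: mhom_iff intro: mhomog.intros(3))
  have even: "\<exists>s u. mhomog P 0 a b s \<and> mhomog P 1 a b u \<and> meq P t (s \<oplus> u)"
    if "mhomog P 0 a b t" for a b t
    using that mhomog_mhom[OF that] zero[OF mhomog_mhom[OF that], of 1]
    by (metis meq_sym meq_add_zero)
  have odd: "\<exists>s u. mhomog P 0 a b s \<and> mhomog P 1 a b u \<and> meq P t (s \<oplus> u)"
    if "mhomog P 1 a b t" for a b t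
  proof -
    note h = mhomog_mhom[OF that] and z = zero[OF mhomog_mhom[OF that]]
    have "meq P t (MZero a b \<oplus> t)"
      using meq_sym[OF meq_trans[OF meq_add_comm[OF mhomog_mhom[OF z] h] meq_add_zero[OF h]]] .
    then show ?thesis using that z by blast
  qed
  {
    case (1 g)
    then show ?case
      using mhomog.intros(1)[OF 1] even odd by (cases "par P g = 0") (simp, simp)
  next
    case 2
    then show ?case by (blast intro: even mhomog.intros(2))
  next
    case 3
    then show ?case by (blast intro: even mhomog.intros(3))
  next
    case (4 a b s t)
    then obtain s0 s1 t0 t1 where
      s: "mhomog P 0 a b s0" "mhomog P 1 a b s1" "meq P s (s0 \<oplus> s1)" and
      t: "mhomog P 0 a b t0" "mhomog P 1 a b t1" "meq P t (t0 \<oplus> t1)" by blast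
    note h = s(1,2)[THEN mhomog_mhom] t(1,2)[THEN mhomog_mhom]
    have "meq P (s \<oplus> t) ((s0 \<oplus> s1) \<oplus> (t1 \<oplus> t0))"
      using 4(1,2) s(3) meq_trans[OF t(3) meq_add_comm[OF h(3,4)]] by (rule add_cong)
    also have "meq P \<dots> ((s0 \<oplus> t0) \<oplus> (s1 \<oplus> t1))"
      using h(1,2,4,3) by (rule meq_medial)
    finally show ?case
      using mhomog.intros(4)[OF s(1) t(1)] mhomog.intros(4)[OF s(2) t(2)] by blast
  next
    case (5 a b t z)
    then obtain t0 t1 where
      t: "mhomog P 0 a b t0" "mhomog P 1 a b t1" "meq P t (t0 \<oplus> t1)" by blast
    have "meq P (MScal z t) (MScal z t0 \<oplus> MScal z t1)"
      using meq_trans[OF scal_cong[OF 5(1) t(3)] meq_scal_add] t(1,2)[THEN mhomog_mhom] .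
    then show ?case using t mhomog.intros(5) by blast
  next
    case (6 b c s a t)
    then obtain s0 s1 t0 t1 where
      s: "mhomog P 0 b c s0" "mhomog P 1 b c s1" "meq P s (s0 \<oplus> s1)" and
      t: "mhomog P 0 a b t0" "mhomog P 1 a b t1" "meq P t (t0 \<oplus> t1)" by blast
    have "meq P (s \<cdot> t) ((s0 \<cdot> t0 \<oplus> s1 \<cdot> t1) \<oplus> (s0 \<cdot> t1 \<oplus> s1 \<cdot> t0))"
    proof (rule meq_expand[where k = MComp])
      show "mhom P b c s0" "mhom P b c s1" "mhom P a b t0" "mhom P a b t1"
        by (rule s(1,2)[THEN mhomog_mhom] t(1,2)[THEN mhomog_mhom])+
      show "meq P (s \<cdot> t) (s' \<cdot> t')"
        if "mhom P b c s" "mhom P a b t" "meq P s s'" "meq P t t'" for s s' t t'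
        using that by (rule comp_cong)
      show "meq P ((s \<oplus> s') \<cdot> t) (s \<cdot> t \<oplus> s' \<cdot> t)"
        if "mhom P b c s" "mhom P b c s'" "mhom P a b t" for s s' t
        using that by (rule meq_comp_add_left)
      show "meq P (s \<cdot> (t \<oplus> t')) (s \<cdot> t \<oplus> s \<cdot> t')"
        if "mhom P b c s" "mhom P a b t" "mhom P a b t'" for s t t'
        using that by (rule meq_comp_add_right)
      show "mhom P (a) (c) (s \<cdot> t)" if "mhom P b c s" "mhom P a b t" for s t
        using that by (rule mhom.intros)
    qed (use s t 6 in auto)
    moreover have "mhomog P 0 a c (s0 \<cdot> t0 \<oplus> s1 \<cdot> t1)" "mhomog P 1 a c (s0 \<cdot> t1 \<oplus> s1 \<cdot> t0)"
      using mhomog.intros(6)[OF s(1) t(1)] mhomog.intros(6)[OF s(2) t(2)]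
        mhomog.intros(6)[OF s(1) t(2)] mhomog.intros(6)[OF s(2) t(1)]
      by (auto intro!: mhomog.intros(4))
    ultimately show ?case by blast
  next
    case (7 a b s c d t)
    then obtain s0 s1 t0 t1 where
      s: "mhomog P 0 a b s0" "mhomog P 1 a b s1" "meq P s (s0 \<oplus> s1)" and
      t: "mhomog P 0 c d t0" "mhomog P 1 c d t1" "meq P t (t0 \<oplus> t1)" by blast
    have "meq P (s \<otimes> t) ((s0 \<otimes> t0 \<oplus> s1 \<otimes> t1) \<oplus> (s0 \<otimes> t1 \<oplus> s1 \<otimes> t0))"
    proof (rule meq_expand[where k = MTens])
      show "mhom P a b s0" "mhom P a b s1" "mhom P c d t0" "mhom P c d t1"
        by (rule s(1,2)[THEN mhomog_mhom] t(1,2)[THEN mhomog_mhom])+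
      show "meq P (s \<otimes> t) (s' \<otimes> t')"
        if "mhom P a b s" "mhom P c d t" "meq P s s'" "meq P t t'" for s s' t t'
        using that by (rule tens_cong)
      show "meq P ((s \<oplus> s') \<otimes> t) (s \<otimes> t \<oplus> s' \<otimes> t)"
        if "mhom P a b s" "mhom P a b s'" "mhom P c d t" for s s' t
        using that by (rule meq_tens_add_left)
      show "meq P (s \<otimes> (t \<oplus> t')) (s \<otimes> t \<oplus> s \<otimes> t')"
        if "mhom P a b s" "mhom P c d t" "mhom P c d t'" for s t t'
        using that by (rule meq_tens_add_right)
      show "mhom P (a @ c) (b @ d) (s \<otimes> t)" if "mhom P a b s" "mhom P c d t" for s t
        using that by (rule mhom.intros)
    qed (use s t 7 in auto)
    moreover have "mhomog P 0 (a @ c) (b @ d) (s0 \<otimes> t0 \<oplus> s1 \<otimes> t1)"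
      "mhomog P 1 (a @ c) (b @ d) (s0 \<otimes> t1 \<oplus> s1 \<otimes> t0)"
      using mhomog.intros(7)[OF s(1) t(1)] mhomog.intros(7)[OF s(2) t(2)]
        mhomog.intros(7)[OF s(1) t(2)] mhomog.intros(7)[OF s(2) t(1)]
      by (auto intro!: mhomog.intros(4))
    ultimately show ?case by blast
  }
qed

text \<open>The involution fixes \<open>s\<close> and negates \<open>t\<close>, so \<open>s = t\<close> gives \<open>s = -s\<close>.\<close>

lemma even_odd_zero:
  assumes s: "mhomog P 0 a b s" and t: "mhomog P 1 a b t" and st: "meq P s t"
  shows "meq P s (MZero a b)"
proof -
  note hs = mhomog_mhom[OF s] and ht = mhomog_mhom[OF t]
  have w: "a \<in> lists (letters P)" "b \<in> lists (letters P)"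
    using hs mwf_words[of s] by (auto simp: mhom_iff)
  have "meq P s (MScal (sign 0) s)"
    using meq_sym[OF meq_scal_one[OF hs]] by (simp add: sign_def)
  also have "meq P \<dots> (msgn P s)" using msgn_homogeneous[OF s] by (rule meq_sym)
  also have "meq P \<dots> (msgn P t)" using st by (rule msgn_meq)
  also have "meq P \<dots> (MScal (sign 1) t)" using t by (rule msgn_homogeneous)
  also have "meq P \<dots> (MScal (sign 1) s)" using ht meq_sym[OF st] by (rule scal_cong)
  finally have neg: "meq P s (MScal (-1) s)" by (simp add: sign_def)
  have "meq P s (MScal (1/2 + 1/2) s)"
    using meq_sym[OF meq_scal_one[OF hs]] by simp
  also have "meq P \<dots> (MScal (1/2) s \<oplus> MScal (1/2) s)" using hs by (rule meq_add_scal)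
  also have "meq P \<dots> (MScal (1/2) (s \<oplus> s))" using meq_scal_add[OF hs hs] by (rule meq_sym)
  also have "meq P \<dots> (MScal (1/2) (MZero a b))"
    using mhom.intros(4)[OF hs hs] meq_trans[OF add_cong[OF hs hs meq_refl[OF hs] neg] meq_add_neg[OF hs]]
    by (rule scal_cong)
  also have "meq P \<dots> (MZero a b)" using w by (rule scal_MZero)
  finally show ?thesis .
qed

text \<open>Each axiom is a clause of the congruence, except for the two that say that the hom-spaces are
  direct sums of their even and odd parts.\<close>

theorem presented_supercategory: "strict_monoidal_supercategory (presented P)"
proof -
  note E = presented_HomE presented_PartE
  have tens_hom: "mcls P (s \<otimes> t) \<in> Hom (presented P) (a @ c) (b @ d)"
    if "mhom P a b s" "mhom P c d t" for a b c d s t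
    using that by (intro presented_HomI mhom.intros)
  show ?thesis
    apply standard
    subgoal by simp
    subgoal by simp
    subgoal by simp
    subgoal by simp
    subgoal by simp
    subgoal for f a b by (elim E) (use mwf_words in \<open>auto simp: mhom_iff\<close>)
    subgoal for f a b a' b' by (elim E) (metis mcls_eq_iff meq_typed mhom_iff)
    subgoal by simp (intro presented_HomI mhom.intros)
    subgoal by (elim E) (simp, intro presented_HomI mhom.intros)
    subgoal by (elim E) (simp, intro presented_HomI mhom.intros)
    subgoal by (elim E) (simp, intro mcls_eqI meq_add_assoc)
    subgoal by (elim E) (simp, intro mcls_eqI meq_add_comm)
    subgoal by (elim E) (simp, intro mcls_eqI meq_add_zero)
    subgoal by (elim E) (simp, intro mcls_eqI meq_add_neg)
    subgoal by (elim E) (simp, intro mcls_eqI meq_scal_add)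
    subgoal by (elim E) (simp, intro mcls_eqI meq_add_scal)
    subgoal by (elim E) (simp, intro mcls_eqI meq_scal_scal)
    subgoal by (elim E) (simp, intro mcls_eqI meq_scal_one)
    subgoal by (elim E) (simp add: presented_HomI mhomog_mhom)
    subgoal by simp (intro presented_PartI mhomog.intros)
    subgoal by (elim E) (simp, intro presented_PartI mhomog.intros)
    subgoal by (elim E) (simp, intro presented_PartI mhomog.intros)
    subgoal for f a b
    proof (elim E)
      fix t assume t: "f = mcls P t" "mhom P a b t"
      then obtain s u where "mhomog P 0 a b s" "mhomog P 1 a b u" "mcls P t = mcls P (s \<oplus> u)"
        using mhom_parts mcls_eqI by metis
      then show ?thesis using t(1) presented_PartI presented_ops(3) by metis
    qed
    subgoal for f a b
    proof (elim E)
      fix s t assume f: "f = mcls P s" "f = mcls P t" and s: "mhomog P 0 a b s" and t: "mhomog P 1 a b t"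
      have "mwf P s" using mhomog_mhom[OF s] by (simp add: mhom_iff)
      then have "meq P s t" using f mcls_eq_iff by blast
      then show ?thesis unfolding f(1) presented_objs by (intro mcls_eqI even_odd_zero[OF s t])
    qed
    subgoal by simp (intro presented_PartI mhomog.intros)
    subgoal by (elim E) (simp, rule presented_HomI, rule mhom.intros)
    subgoal by (elim E) (simp only: presented_ops, rule presented_PartI, rule mhomog.intros)
    subgoal by (elim E) (simp, rule mcls_eqI, rule meq_comp_assoc)
    subgoal by (elim E) (simp, rule mcls_eqI, rule meq_id_comp)
    subgoal by (elim E) (simp, rule mcls_eqI, rule meq_comp_id)
    subgoal by (elim E) (simp, rule mcls_eqI, rule meq_comp_add_left)
    subgoal by (elim E) (simp, rule mcls_eqI, rule meq_comp_add_right)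
    subgoal by (elim E) (simp, rule mcls_eqI, rule meq_comp_scal_left)
    subgoal by (elim E) (simp, rule mcls_eqI, rule meq_comp_scal_right)
    subgoal by (elim E) (simp add: tens_hom)
    subgoal by (elim E) (simp only: presented_ops presented_objs, rule presented_PartI, rule mhomog.intros)
    subgoal by (elim E) (simp, rule mcls_eqI, rule meq_tens_assoc)
    subgoal by (elim E) (simp, rule mcls_eqI, rule meq_unit_tens)
    subgoal by (elim E) (simp, rule mcls_eqI, rule meq_tens_unit)
    subgoal by simp (rule mcls_eqI, rule meq_tens_id)
    subgoal by (elim E) (simp, rule mcls_eqI, rule meq_tens_add_left)
    subgoal by (elim E) (simp, rule mcls_eqI, rule meq_tens_add_right)
    subgoal by (elim E) (simp, rule mcls_eqI, rule meq_tens_scal_left)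
    subgoal by (elim E) (simp, rule mcls_eqI, rule meq_tens_scal_right)
    subgoal by (elim E) (simp only: presented_ops, rule mcls_eqI, rule meq_interchange)
    done
qed

end

section \<open>The universal property\<close>

context strict_monoidal_supercategory
begin

lemma scal_0: "f \<in> Hom M a b \<Longrightarrow> Scal M 0 f = ZeroM M a b"
  using add_scal[of f a b 1 "-1"] by (simp add: scal_one add_neg)

end

lemma (in strict_monoidal_superfunctor) F_zero:
  assumes "a \<in> Obj A" "b \<in> Obj A"
  shows "Fm (ZeroM A a b) = ZeroM B (Fo a) (Fo b)"
  using A.zero_hom[OF assms] A.scal_0 B.scal_0 F_scal F_hom by metis

text \<open>With words as objects, associativity and the unit laws for objects are computed by rewriting.\<close>

locale word_supercategory = strict_monoidal_supercategory M
  for M :: "('k list, 'm) smcat" +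
  assumes tens_words: "OTens M = (@)" and unit_word: "Unit M = []"

lemma (in graded_presentation) presented_words: "word_supercategory (presented P)"
  by (intro word_supercategory.intro presented_supercategory) (simp add: word_supercategory_axioms_def)

primrec mval :: "('k list, 'm) smcat \<Rightarrow> ('l \<Rightarrow> 'k list) \<Rightarrow> ('g \<Rightarrow> 'm) \<Rightarrow> ('l, 'g) mterm \<Rightarrow> 'm" where
  "mval M h \<gamma> (MGen g) = \<gamma> g"
| "mval M h \<gamma> (MId a) = Ident M (concat (map h a))"
| "mval M h \<gamma> (MZero a b) = ZeroM M (concat (map h a)) (concat (map h b))"
| "mval M h \<gamma> (s \<oplus> t) = Add M (mval M h \<gamma> s) (mval M h \<gamma> t)"
| "mval M h \<gamma> (MScal z t) = Scal M z (mval M h \<gamma> t)"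
| "mval M h \<gamma> (s \<cdot> t) = Comp M (mval M h \<gamma> s) (mval M h \<gamma> t)"
| "mval M h \<gamma> (s \<otimes> t) = Tens M (mval M h \<gamma> s) (mval M h \<gamma> t)"

locale representation = graded_presentation P + word_supercategory M
  for P :: "('l, 'g) mpres" and M :: "('k list, 'm) smcat" +
  fixes h :: "'l \<Rightarrow> 'k list" and \<gamma> :: "'g \<Rightarrow> 'm"
  assumes h_obj: "l \<in> letters P \<Longrightarrow> h l \<in> Obj M"
    and gen_part: "g \<in> gens P \<Longrightarrow>
      \<gamma> g \<in> Part M (par P g) (concat (map h (src P g))) (concat (map h (tgt P g)))"
    and rel_val: "rel P s t \<Longrightarrow> mval M h \<gamma> s = mval M h \<gamma> t"
begin

abbreviation "hw \<equiv> \<lambda>a. concat (map h a)"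
abbreviation "val \<equiv> mval M h \<gamma>"

lemma hw_obj: "a \<in> lists (letters P) \<Longrightarrow> hw a \<in> Obj M"
  using unit_obj tens_obj by (induction a) (auto simp: unit_word tens_words h_obj)

lemma val_hom: "mhom P a b t \<Longrightarrow> val t \<in> Hom M (hw a) (hw b)"
proof (induction rule: mhom.induct)
  case (7 a b s c d t)
  then show ?case using tens_hom[OF 7(3,4)] by (simp add: tens_words)
qed (auto intro: part_hom gen_part id_part zero_hom hw_obj add_hom scal_hom comp_hom)

lemma val_part: "mhomog P p a b t \<Longrightarrow> val t \<in> Part M p (hw a) (hw b)"
proof (induction rule: mhomog.induct)
  case (6 p b c s q a t)
  then show ?case using comp_part[OF 6(3,4)] by (simp only: mval.simps)
next
  case (7 p a b s q c d t)
  then show ?case using tens_part[OF 7(3,4)] by (simp only: mval.simps tens_words map_append concat_append)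
qed (auto intro: gen_part id_part zero_part hw_obj add_part scal_part)

lemma val_eq: "meq P s t \<Longrightarrow> val s = val t"
proof (induction rule: meq.induct)
  case meq_rel
  then show ?case by (rule rel_val)
next
  case meq_interchange
  then show ?case by (simp add: interchange[OF val_hom val_part val_part val_hom])
next
  case meq_comp_assoc
  then show ?case by (simp add: comp_assoc[OF val_hom val_hom val_hom])
next
  case meq_tens_assoc
  then show ?case by (simp add: tens_assoc[OF val_hom val_hom val_hom])
next
  case meq_add_assoc
  then show ?case by (simp add: add_assoc[OF val_hom val_hom val_hom])
next
  case meq_add_comm
  then show ?case by (simp add: add_comm[OF val_hom val_hom])
next
  case meq_add_zero
  then show ?case by (simp add: add_zero[OF val_hom])
next
  case meq_add_neg
  then show ?case by (simp add: add_neg[OF val_hom])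
next
  case meq_scal_add
  then show ?case by (simp add: scal_add[OF val_hom val_hom])
next
  case meq_add_scal
  then show ?case by (simp add: add_scal[OF val_hom])
next
  case meq_scal_scal
  then show ?case by (simp add: scal_scal[OF val_hom])
next
  case meq_scal_one
  then show ?case by (simp add: scal_one[OF val_hom])
next
  case meq_id_comp
  then show ?case by (simp add: id_comp[OF val_hom])
next
  case meq_comp_id
  then show ?case by (simp add: comp_id[OF val_hom])
next
  case meq_comp_add_left
  then show ?case by (simp add: comp_add_left[OF val_hom val_hom val_hom])
next
  case meq_comp_add_right
  then show ?case by (simp add: comp_add_right[OF val_hom val_hom val_hom])
next
  case meq_comp_scal_left
  then show ?case by (simp add: comp_scal_left[OF val_hom val_hom])
next
  case meq_comp_scal_right
  then show ?case by (simp add: comp_scal_right[OF val_hom val_hom])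
next
  case meq_unit_tens
  then show ?case by (simp add: unit_tens[OF val_hom, unfolded unit_word])
next
  case meq_tens_unit
  then show ?case by (simp add: tens_unit[OF val_hom, unfolded unit_word])
next
  case meq_tens_id
  then show ?case by (simp add: tens_id hw_obj tens_words)
next
  case meq_tens_add_left
  then show ?case by (simp add: tens_add_left[OF val_hom val_hom val_hom])
next
  case meq_tens_add_right
  then show ?case by (simp add: tens_add_right[OF val_hom val_hom val_hom])
next
  case meq_tens_scal_left
  then show ?case by (simp add: tens_scal_left[OF val_hom val_hom])
next
  case meq_tens_scal_right
  then show ?case by (simp add: tens_scal_right[OF val_hom val_hom])
qed simp_all

definition induced :: "('l, 'g) mterm set \<Rightarrow> 'm" where
  "induced f = val (SOME t. t \<in> f)"

lemma induced_mcls: "mwf P t \<Longrightarrow> induced (mcls P t) = val t"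
proof -
  assume "mwf P t"
  then have "(SOME s. s \<in> mcls P t) \<in> mcls P t"
    using someI[of "\<lambda>s. s \<in> mcls P t" t] mcls_self[of t] by blast
  then show ?thesis unfolding induced_def in_mcls by (rule val_eq[symmetric])
qed

text \<open>The chosen representative of a class does not matter, because equal terms have equal values.\<close>

theorem induced_superfunctor: "strict_monoidal_superfunctor (presented P) M hw induced"
proof -
  interpret A: strict_monoidal_supercategory "presented P" by (rule presented_supercategory)
  have I: "induced (mcls P t) = val t" if "mhom P a b t" for a b t
    using that by (simp add: mhom_iff induced_mcls)
  show ?thesis
  proof (unfold_locales, goal_cases)
    case (1 a)
    then show ?case by (simp add: hw_obj)
  next
    case 2
    then show ?case by (simp add: unit_word)
  next
    case (3 a b)
    then show ?case by (simp add: tens_words)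
  next
    case (4 f a b)
    then show ?case by (elim presented_HomE) (simp add: I val_hom)
  next
    case (5 f p a b)
    then show ?case by (elim presented_PartE) (simp add: I[of a b] val_part mhomog_mhom[of P p])
  next
    case (6 f a b g)
    then show ?case by (elim presented_HomE) (simp add: I[of a b] mhom.intros)
  next
    case (7 f a b z)
    then show ?case by (elim presented_HomE) (simp add: I[of a b] mhom.intros)
  next
    case (8 a)
    then show ?case by (simp add: I[of a a] mhom.intros)
  next
    case (9 f b c g a)
    then show ?case by (elim presented_HomE) (simp add: I[of a b] I[of b c] I[of a c] mhom.intros(6)[of P b c _ a])
  next
    case (10 f a b g c d)
    then show ?case
      by (elim presented_HomE) (simp add: I[of a b] I[of c d] I[of "a @ c" "b @ d"] mhom.intros(7))
  qed
qed

end

text \<open>This is how two superfunctors are shown to be inverse: both sides of \<open>Gm (Fm f) = f\<close> are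
  compatible with every operation that builds a morphism from generators.\<close>

lemma (in graded_presentation) generators_fixed:
  assumes F: "strict_monoidal_superfunctor (presented P) B Fo Fm"
    and G: "strict_monoidal_superfunctor B (presented P) Go Gm"
    and obj: "\<And>a. a \<in> lists (letters P) \<Longrightarrow> Go (Fo a) = a"
    and gen: "\<And>g. g \<in> gens P \<Longrightarrow> Gm (Fm (mcls P (MGen g))) = mcls P (MGen g)"
    and f: "f \<in> Hom (presented P) a b"
  shows "Gm (Fm f) = f"
proof -
  interpret F: strict_monoidal_superfunctor "presented P" B Fo Fm by fact
  interpret G: strict_monoidal_superfunctor B "presented P" Go Gm by fact
  have "mhom P a b t \<Longrightarrow> Gm (Fm (mcls P t)) = mcls P t" for a b t
  proof (induction rule: mhom.induct)
    case (1 g)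
    then show ?case by (rule gen)
  next
    case (2 a)
    then show ?case using F.F_id[of a] G.F_id[of "Fo a"] F.F_obj[of a] by (simp add: obj)
  next
    case (3 a b)
    then show ?case
      using F.F_zero[of a b] G.F_zero[of "Fo a" "Fo b"] F.F_obj[of a] F.F_obj[of b] by (simp add: obj)
  next
    case (4 a b s t)
    note h = 4(1,2)[THEN presented_HomI]
    show ?case using F.F_add[OF h] G.F_add[OF h[THEN F.F_hom]] 4(3,4) by simp
  next
    case (5 a b t z)
    note h = 5(1)[THEN presented_HomI]
    show ?case using F.F_scal[OF h] G.F_scal[OF h[THEN F.F_hom]] 5(2) by simp
  next
    case (6 b c s a t)
    note h = 6(1,2)[THEN presented_HomI]
    show ?case using F.F_comp[OF h] G.F_comp[OF h[THEN F.F_hom]] 6(3,4) by simp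
  next
    case (7 a b s c d t)
    note h = 7(1,2)[THEN presented_HomI]
    show ?case using F.F_tens[OF h] G.F_tens[OF h[THEN F.F_hom]] 7(3,4) by simp
  qed
  then show ?thesis using f by (auto elim: presented_HomE)
qed

section \<open>Algebra homomorphisms and polynomials\<close>

definition alg_hom :: "('g::presentation salg \<Rightarrow> 'h::presentation salg) \<Rightarrow> bool" where
  "alg_hom F \<longleftrightarrow> F 1 = 1 \<and> (\<forall>a b. F (a + b) = F a + F b) \<and> (\<forall>a b. F (a * b) = F a * F b) \<and>
     (\<forall>z a. F (csc z a) = csc z (F a))"

lemma alg_homD:
  assumes "alg_hom F"
  shows "F 1 = 1" "F (a + b) = F a + F b" "F (a * b) = F a * F b" "F (csc z a) = csc z (F a)"
    "F 0 = 0" "F (a ^ n) = F a ^ n"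
proof -
  show *: "F 1 = 1" "F (a + b) = F a + F b" "F (a * b) = F a * F b" "F (csc z a) = csc z (F a)" for a b z
    using assms unfolding alg_hom_def by blast+
  show "F 0 = 0" using *(4)[of 0 0] by simp
  show "F (a ^ n) = F a ^ n" by (induction n) (simp_all add: *)
qed

lemma alg_hom_alg_ext:
  assumes "\<And>s t. gen_rel s t \<Longrightarrow> fa_eval \<phi> s = fa_eval \<phi> t"
  shows "alg_hom (alg_ext \<phi>)"
  unfolding alg_hom_def using alg_ext[of \<phi>, OF assms] by simp

lemma alg_hom_comp: "alg_hom F \<Longrightarrow> alg_hom G \<Longrightarrow> alg_hom (\<lambda>a. F (G a))"
  by (simp add: alg_hom_def)

lemma alg_hom_eqI:
  assumes "alg_hom F" "alg_hom G" "\<And>g. F (sgen g) = G (sgen g)"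
  shows "F a = G a"
  by (induction a rule: salg_induct) (simp_all add: assms alg_homD[OF assms(1)] alg_homD[OF assms(2)])

text \<open>The value of a polynomial at an element, by Horner's scheme.\<close>

definition pev :: "'g::presentation salg \<Rightarrow> complex poly \<Rightarrow> 'g salg" where
  "pev y q = fold_coeffs (\<lambda>z b. csc z 1 + y * b) q 0"

lemma pev_0 [simp]: "pev y 0 = 0"
  by (simp add: pev_def)

lemma pev_pCons [simp]: "pev y (pCons z q) = csc z 1 + y * pev y q"
  by (cases "q = 0"; cases "z = 0") (simp_all add: pev_def)

lemma pev_1 [simp]: "pev y 1 = 1"
  by (simp add: one_pCons)

lemma pev_add: "pev y (p + q) = pev y p + pev y q"
  by (induction p q rule: poly_induct2) (simp_all add: csc_plus algebra_simps)

lemma pev_smult: "pev y (smult z q) = csc z (pev y q)"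
  by (induction q) simp_all

lemma pev_mult: "pev y (p * q) = pev y p * pev y q"
  by (induction p) (simp_all add: pev_add pev_smult algebra_simps)

lemma pev_pcompose: "pev y (pcompose q r) = pev (pev y r) q"
  by (induction q) (simp_all add: pcompose_pCons pev_add pev_mult)

lemma pev_monom: "pev y (monom z k) = csc z (y ^ k)"
  by (induction k) (simp_all add: monom_Suc monom_0)

lemma pev_expand: "pev y q = (\<Sum>k\<le>degree q. csc (coeff q k) (y ^ k))"
proof -
  have sum: "pev y (\<Sum>k\<le>n. f k) = (\<Sum>k\<le>n. pev y (f k))" for n :: nat and f
    by (induction n) (simp_all add: pev_add)
  have "pev y q = pev y (\<Sum>k\<le>degree q. monom (coeff q k) k)"
    by (simp only: poly_as_sum_of_monoms)
  then show ?thesis by (simp only: sum pev_monom)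
qed

lemma pev_homogeneous:
  assumes "homogeneous 0 y"
  shows "homogeneous 0 (pev y q)"
proof (induction q)
  case (pCons z q)
  have "homogeneous (0 + 0) (y * pev y q)" using assms pCons(2) by (rule homogeneous_times)
  then show ?case by (simp add: homogeneous_plus homogeneous_csc homogeneous_one)
qed (simp add: homogeneous_zero)

lemma pev_hom: "alg_hom F \<Longrightarrow> F (pev y q) = pev (F y) q"
  by (induction q) (simp_all add: alg_homD)

lemma pev_commute: "a * y = y * a \<Longrightarrow> a * pev y q = pev y q * a"
  proof (induction q)
  case (pCons z q)
  then have "a * (y * pev y q) = y * pev y q * a"
    by (metis mult.assoc)
  then show ?case by (simp add: distrib_left distrib_right)
qed simp

lemma pev_anticommute: "a * y = - (y * a) \<Longrightarrow> a * pev y q = pev (- y) q * a"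
proof (induction q)
  case (pCons z q)
  have "a * (y * pev y q) = - (y * (a * pev y q))"
    using pCons(3) by (metis mult.assoc mult_minus_left)
  then show ?case using pCons by (simp add: algebra_simps)
qed simp

lemma poly_even_odd: "\<exists>r s. (q :: complex poly) = pcompose r [:0, 0, 1:] + pCons 0 (pcompose s [:0, 0, 1:])"
proof (induction q)
  case 0
  show ?case by (intro exI[of _ 0]) simp
next
  case (pCons z q)
  then obtain r s where "q = pcompose r [:0, 0, 1:] + pCons 0 (pcompose s [:0, 0, 1:])" by blast
  then show ?case
    by (intro exI[of _ "pCons z s"] exI[of _ r]) (simp add: pcompose_pCons)
qed

lemma pev_square: "pev y (pcompose r [:0, 0, 1:]) = pev (y * y) r"
  by (simp add: pev_pcompose)

section \<open>The one-variable algebras\<close>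

text \<open>The regular representation of the one-variable algebra: the pair \<open>(f, h)\<close> stands for
  \<open>f(x) + c h(x)\<close>.\<close>

primrec polcl_act :: "unit polcl_gen fa \<Rightarrow> complex poly \<times> complex poly \<Rightarrow> complex poly \<times> complex poly" where
  "polcl_act (Gen g) v = (case g of PCc i \<Rightarrow> (snd v, fst v) | PCx i \<Rightarrow> (pCons 0 (fst v), - pCons 0 (snd v)))"
| "polcl_act One v = v"
| "polcl_act Zero v = (0, 0)"
| "polcl_act (Plus s t) v = (fst (polcl_act s v) + fst (polcl_act t v), snd (polcl_act s v) + snd (polcl_act t v))"
| "polcl_act (Times s t) v = polcl_act s (polcl_act t v)"
| "polcl_act (Scale z t) v = (smult z (fst (polcl_act t v)), smult z (snd (polcl_act t v)))"

lemma polcl_act_linear: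
  "polcl_act t (f + f', h + h') =
    (fst (polcl_act t (f, h)) + fst (polcl_act t (f', h')), snd (polcl_act t (f, h)) + snd (polcl_act t (f', h')))"
  "polcl_act t (smult z f, smult z h) = (smult z (fst (polcl_act t (f, h))), smult z (snd (polcl_act t (f, h))))"
proof (induction t arbitrary: f f' h h')
  case (Gen g)
  { case 1 show ?case by (simp split: polcl_gen.split) }
  { case 2 show ?case by (simp split: polcl_gen.split) }
next
  case (Plus s t)
  { case 1 show ?case by (simp add: Plus) }
  { case 2 show ?case by (simp add: Plus smult_add_right) }
next
  case (Times s t)
  { case 1 show ?case by (simp add: Times) }
  { case 2 show ?case by (simp add: Times) }
next
  case (Scale z t)
  { case 1 show ?case by (simp add: Scale smult_add_right) }
  { case 2 show ?case by (simp add: Scale mult.commute) }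
qed simp_all

lemma polcl_act_wd: "fa_eq s t \<Longrightarrow> polcl_act s v = polcl_act t v"
proof (induction arbitrary: v rule: fa_eq.induct)
  case (fa_rel s t)
  then show ?case by (cases rule: gen_rel_polcl_gen.cases) auto
qed (simp_all add: polcl_act_linear smult_add_right smult_add_left algebra_simps)

definition polcl_mod :: "unit polcl \<Rightarrow> complex poly \<times> complex poly \<Rightarrow> complex poly \<times> complex poly" where
  "polcl_mod a = polcl_act (rep_salg a)"

lemma polcl_mod_simps:
  "polcl_mod (a + b) v = (fst (polcl_mod a v) + fst (polcl_mod b v), snd (polcl_mod a v) + snd (polcl_mod b v))"
  "polcl_mod (a * b) v = polcl_mod a (polcl_mod b v)"
  "polcl_mod (csc z a) v = (smult z (fst (polcl_mod a v)), smult z (snd (polcl_mod a v)))"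
  "polcl_mod 1 v = v" "polcl_mod 0 v = (0, 0)"
  "polcl_mod (pcc i) v = (snd v, fst v)" "polcl_mod (pcx i) v = (pCons 0 (fst v), - pCons 0 (snd v))"
proof -
  have 1: "polcl_mod (abs_salg t) = polcl_act t" for t
    unfolding polcl_mod_def using polcl_act_wd[OF fa_rep_abs] by blast
  obtain s t where st: "a = abs_salg s" "b = abs_salg t"
    by (metis Quotient3_abs_rep Quotient3_salg)
  show "polcl_mod (a + b) v = (fst (polcl_mod a v) + fst (polcl_mod b v), snd (polcl_mod a v) + snd (polcl_mod b v))"
    "polcl_mod (a * b) v = polcl_mod a (polcl_mod b v)"
    "polcl_mod (csc z a) v = (smult z (fst (polcl_mod a v)), smult z (snd (polcl_mod a v)))"
    by (simp_all only: st plus_salg.abs_eq csc.abs_eq times_salg.abs_eq 1 polcl_act.simps)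
  show "polcl_mod 1 v = v" "polcl_mod 0 v = (0, 0)"
    "polcl_mod (pcc i) v = (snd v, fst v)" "polcl_mod (pcx i) v = (pCons 0 (fst v), - pCons 0 (snd v))"
    by (simp_all add: 1 one_salg_def zero_salg_def sgen.abs_eq)
qed

abbreviation "pc \<equiv> pcc ()"
abbreviation "px \<equiv> pcx ()"

lemma polcl_mod_pev: "polcl_mod (pev px q) (f, 0) = (q * f, 0)"
  by (induction q) (simp_all add: polcl_mod_simps)

text \<open>Let both sides act on \<open>1\<close> in the regular representation.\<close>

lemma polcl1_independent:
  assumes "pev px f + pc * pev px g = pev px f' + pc * pev px g'"
  shows "f = f'" "g = g'"
  using arg_cong[OF assms, of "\<lambda>a. polcl_mod a (1, 0)"] by (simp_all add: polcl_mod_simps polcl_mod_pev)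

lemma pc_square: "pc * pc = 1" "pc * (pc * a) = a"
  using polcl_rels(1)[of "()"] by (simp_all flip: mult.assoc)

lemma pc_px: "pc * px = - (px * pc)" "pc * (px * a) = - (px * (pc * a))"
proof -
  show *: "pc * px = - (px * pc)" by (rule polcl_rels)
  show "pc * (px * a) = - (px * (pc * a))" by (simp add: * flip: mult.assoc)
qed

lemma pev_times_pc: "pev px q * pc = pc * pev (- px) q"
  using pev_anticommute[of pc "- px" q] polcl_rels(2)[of "()"] by simp

lemma pev_uminus: "pev (- y) q = pev y (pcompose q [:0, -1:])"
  by (simp add: pev_pcompose csc_minus_one)

lemma polcl1_homogeneous:
  "homogeneous p (a :: unit polcl) \<Longrightarrow> \<exists>q. a = (if p = 0 then pev px q else pc * pev px q)"
proof (induction rule: homogeneous.induct)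
  case (homogeneous_gen g)
  show ?case
  proof (cases g)
    case (PCc i)
    then show ?thesis by (intro exI[of _ 1]) (simp add: gen_parity_polcl_gen_def)
  next
    case (PCx i)
    then show ?thesis by (intro exI[of _ "[:0, 1:]"]) (simp add: gen_parity_polcl_gen_def)
  qed
next
  case homogeneous_one
  show ?case by (intro exI[of _ 1]) simp
next
  case (homogeneous_zero p)
  show ?case by (intro exI[of _ 0]) simp
next
  case (homogeneous_plus p a b)
  then obtain q r where "a = (if p = 0 then pev px q else pc * pev px q)"
    "b = (if p = 0 then pev px r else pc * pev px r)" by blast
  then show ?case by (intro exI[of _ "q + r"]) (simp add: pev_add distrib_left)
next
  case (homogeneous_csc p a z)
  then obtain q where "a = (if p = 0 then pev px q else pc * pev px q)" by blast
  then show ?case by (intro exI[of _ "smult z q"]) (simp add: pev_smult)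
next
  case (homogeneous_times p a p' b)
  then obtain q r where *: "a = (if p = 0 then pev px q else pc * pev px q)"
    "b = (if p' = 0 then pev px r else pc * pev px r)" by blast
  have m: "pev px q * (pc * b) = pc * (pev px (pcompose q [:0, -1:]) * b)" for b
    by (simp add: pev_times_pc pev_uminus flip: mult.assoc)
  show ?case
    by (intro exI[of _ "(if p' = 0 then q else pcompose q [:0, -1:]) * r"])
      (cases "p = 0"; cases "p' = 0"; simp add: * pev_mult m mult.assoc pc_square)
qed

lemma polcl1_normal_form: "\<exists>f g. (a :: unit polcl) = pev px f + pc * pev px g"
  using homog_decomp[of a] polcl1_homogeneous by (metis zero_neq_one)

lemma pc_px_square: "pc * (px * px) = px * px * pc"
  by (simp add: pc_px mult.assoc)

text \<open>An even element is a polynomial in \<open>x\<close>. If it commutes with \<open>c\<close>, it equals its conjugate by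
  \<open>c\<close>, which changes the sign of \<open>x\<close>, so that only even powers occur. Conversely, polynomials in
  \<open>x\<^sup>2\<close> are central, and the normal form \<open>f(x) + c h(x)\<close> reduces their regularity to the absence of
  zero divisors among complex polynomials.\<close>

lemma EE_polcl: "EE = {pev (px * px) q | q. q \<noteq> 0}"
proof (intro equalityI subsetI)
  fix Q assume "Q \<in> (EE :: unit polcl set)"
  then have hom: "homogeneous 0 Q" and cent: "\<And>p b. homogeneous p b \<Longrightarrow> Q * b = b * Q" and reg: "regular Q"
    by (auto simp: EE_def supercentral_def sign_def)
  obtain q where q: "Q = pev px q" using polcl1_homogeneous[OF hom] by auto
  obtain r s where rs: "q = pcompose r [:0, 0, 1:] + pCons 0 (pcompose s [:0, 0, 1:])"
    using poly_even_odd by blast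
  have Q: "Q = pev (px * px) r + px * pev (px * px) s"
    by (simp add: q rs pev_add pev_square)
  have c: "pc * pev (px * px) f = pev (px * px) f * pc" for f
    by (rule pev_commute) (rule pc_px_square)
  have "Q = pc * (Q * pc)"
    using cent[OF homogeneous_gen[of "PCc ()"]] pc_square by simp
  also have "\<dots> = pev (px * px) r - px * pev (px * px) s"
  proof -
    have "pev (px * px) f * pc = pc * pev (px * px) f" for f by (rule c[symmetric])
    then show ?thesis by (simp add: Q distrib_left distrib_right mult.assoc pc_px pc_square)
  qed
  finally have Q': "Q = pev (px * px) r - px * pev (px * px) s" .
  have "csc 2 (px * pev (px * px) s) = Q - (pev (px * px) r - px * pev (px * px) s)"
    using csc_plus[of 1 1 "px * pev (px * px) s"] by (simp add: Q)
  also have "\<dots> = 0" using Q' by simp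
  finally have "csc (1/2) (csc 2 (px * pev (px * px) s)) = 0" by simp
  then have "Q = pev (px * px) r" by (simp add: Q)
  moreover have "r \<noteq> 0"
  proof
    assume "r = 0"
    then have "(1 :: unit polcl) = 0" using reg \<open>Q = pev (px * px) r\<close> by (simp add: regular_def)
    then have "polcl_mod 1 (1, 0) = polcl_mod 0 (1, 0)" by (simp only:)
    then show False by (simp add: polcl_mod_simps)
  qed
  ultimately show "Q \<in> {pev (px * px) q | q. q \<noteq> 0}" by blast
next
  fix Q assume "Q \<in> {pev (px * px) q | q. q \<noteq> 0}"
  then obtain q where q: "Q = pev (px * px) q" "q \<noteq> 0" by blast
  have hx: "homogeneous 0 px" using homogeneous_gen[of "PCx ()"] by (simp add: gen_parity_polcl_gen_def)
  then have "homogeneous 0 (px * px)" using homogeneous_times[OF hx hx] by simp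
  then have hom: "homogeneous 0 Q" unfolding q(1) by (rule pev_homogeneous)
  have comm: "b * Q = Q * b" for b
  proof (induction b rule: salg_induct)
    case (gen g)
    have "sgen g * (px * px) = px * px * sgen g"
      using pc_px_square by (cases g) (simp_all add: mult.assoc)
    then show ?case unfolding q(1) by (rule pev_commute)
  next
    case (times a b)
    then show ?case by (metis mult.assoc)
  qed (simp_all add: distrib_left distrib_right)
  have "b = 0" if "Q * b = 0" for b
  proof -
    obtain f g where b: "b = pev px f + pc * pev px g" using polcl1_normal_form by blast
    let ?r = "pcompose q [:0, 0, 1:]"
    have "?r \<noteq> 0" using q(2) pcompose_eq_0[of q "[:0, 0, 1:]"] by auto
    have Q: "Q = pev px ?r" by (simp add: q(1) pev_square)
    have "Q * b = pev px (?r * f) + pc * pev px (?r * g)"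
    proof -
      have "Q * (pc * pev px g) = pc * (Q * pev px g)" by (metis comm mult.assoc)
      then show ?thesis by (simp add: b distrib_left pev_mult flip: Q)
    qed
    with that have "pev px (?r * f) + pc * pev px (?r * g) = pev px 0 + pc * pev px 0" by simp
    from polcl1_independent[OF this] have "f = 0" "g = 0" using \<open>?r \<noteq> 0\<close> by auto
    then show "b = 0" by (simp add: b)
  qed
  then show "Q \<in> EE"
    using hom comm by (auto simp: EE_def supercentral_def sign_def regular_def)
qed

abbreviation "xo \<equiv> ox ()"

lemma opol1_pev: "\<exists>q. a = pev xo q"
proof (induction a rule: salg_induct)
  case (gen g)
  then show ?case by (cases g) (intro exI[of _ "[:0, 1:]"], simp)
next
  case one
  show ?case by (intro exI[of _ 1]) simp
next
  case zero
  show ?case by (intro exI[of _ 0]) simp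
next
  case (plus a b)
  then show ?case by (metis pev_add)
next
  case (times a b)
  then show ?case by (metis pev_mult)
next
  case (scale z a)
  then show ?case by (metis pev_smult)
qed

lemma opol1_comm: "(a :: unit opol) * b = b * a"
  using opol1_pev[of a] opol1_pev[of b] by (metis pev_mult mult.commute)

lemma opol1_homogeneous:
  "homogeneous p a \<Longrightarrow> \<exists>q. a = (if p = 0 then pev (xo * xo) q else xo * pev (xo * xo) q)"
proof (induction rule: homogeneous.induct)
  case (homogeneous_gen g)
  show ?case by (cases g) (intro exI[of _ 1], simp add: gen_parity_opol_gen_def)
next
  case homogeneous_one
  show ?case by (intro exI[of _ 1]) simp
next
  case (homogeneous_zero p)
  show ?case by (intro exI[of _ 0]) simp
next
  case (homogeneous_plus p a b)
  then obtain q r where "a = (if p = 0 then pev (xo * xo) q else xo * pev (xo * xo) q)"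
    "b = (if p = 0 then pev (xo * xo) r else xo * pev (xo * xo) r)" by blast
  then show ?case by (intro exI[of _ "q + r"]) (simp add: pev_add distrib_left)
next
  case (homogeneous_csc p a z)
  then obtain q where "a = (if p = 0 then pev (xo * xo) q else xo * pev (xo * xo) q)" by blast
  then show ?case by (intro exI[of _ "smult z q"]) (simp add: pev_smult)
next
  case (homogeneous_times p a p' b)
  then obtain q r where *: "a = (if p = 0 then pev (xo * xo) q else xo * pev (xo * xo) q)"
    "b = (if p' = 0 then pev (xo * xo) r else xo * pev (xo * xo) r)" by blast
  have m: "pev (xo * xo) q * (xo * c) = xo * (pev (xo * xo) q * c)" for c
    by (simp only: opol1_comm[of "pev (xo * xo) q" "xo"] flip: mult.assoc)
  show ?case
    by (intro exI[of _ "(if p = 1 \<and> p' = 1 then pCons 0 (q * r) else q * r)"])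
      (cases "p = 0"; cases "p' = 0"; simp add: * pev_mult m mult.assoc)
qed

text \<open>The homomorphism \<open>x\<^sub>i \<mapsto> c\<^sub>i x\<^sub>i / w\<close>, which extends the restriction of \<open>psi\<close> to any number of
  variables.\<close>

definition opol_into_polcl :: "complex \<Rightarrow> 'i opol \<Rightarrow> 'i polcl" where
  "opol_into_polcl w = alg_ext (\<lambda>g. case g of Ox i \<Rightarrow> csc (1 / w) (pcc i * pcx i))"

lemma opol_into_polcl_rel:
  assumes "gen_rel s t"
  shows "fa_eval (\<lambda>g. case g of Ox i \<Rightarrow> csc (1 / w) (pcc i * pcx i)) s =
    fa_eval (\<lambda>g. case g of Ox i \<Rightarrow> csc (1 / w) (pcc i * pcx i)) t"
  using assms
proof (cases rule: gen_rel_opol_gen.cases)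
  case (1 i j)
  have *: "pcc k * pcx k * (pcc l * pcx l) = pcc k * pcc l * (pcx k * pcx l)" if "k \<noteq> l" for k l
    using polcl_rels(4)[of l k] that by (metis mult.assoc)
  have "pcc i * pcx i * (pcc j * pcx j) = - (pcc j * pcx j * (pcc i * pcx i))"
    using 1(3) *[of i j] *[of j i] polcl_rels(3)[of i j] polcl_rels(5)[of i j] by simp
  then show ?thesis by (simp add: 1 csc_minus_one)
qed

lemma opol_into_polcl_hom: "alg_hom (opol_into_polcl w)"
  unfolding opol_into_polcl_def by (rule alg_hom_alg_ext) (rule opol_into_polcl_rel)

lemma opol_into_polcl_gen [simp]: "opol_into_polcl w (ox i) = csc (1 / w) (pcc i * pcx i)"
  using alg_ext(2)[OF opol_into_polcl_rel, of w "Ox i"] by (simp add: opol_into_polcl_def)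

lemma psi_E_eq: "psi_E w = opol_into_polcl w"
proof
  fix a
  have hom: "alg_hom (\<lambda>a. psi w (opol_to_opolcl a))"
    unfolding psi_def opol_to_opolcl_def
    by (rule alg_hom_comp[OF alg_hom_alg_ext[OF psi_rel] alg_hom_alg_ext[OF opol_to_opolcl_rel]])
  show "psi_E w a = opol_into_polcl w a"
    unfolding psi_E_def
  proof (rule alg_hom_eqI[OF hom opol_into_polcl_hom])
    fix g
    show "psi w (opol_to_opolcl (sgen g)) = opol_into_polcl w (sgen g)"
      by (cases g) (simp add: psi_def opol_to_opolcl_def alg_ext(2)[OF psi_rel] alg_ext(2)[OF opol_to_opolcl_rel])
  qed
qed

lemma psi_E_hom: "alg_hom (psi_E w)"
  unfolding psi_E_eq by (rule opol_into_polcl_hom)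

lemma psi_E_square: "w\<^sup>2 = -2 \<Longrightarrow> psi_E w (xo * xo) = csc (1/2) (px * px)"
proof -
  assume "w\<^sup>2 = -2"
  then have "1 / (w * w) = - 1 / 2" by (simp add: power2_eq_square)
  then show ?thesis
    by (simp add: psi_E_eq alg_homD[OF opol_into_polcl_hom] mult.assoc pc_px pc_square)
qed

lemma pev_half_square: "pev (csc z (px * px)) q = pev (px * px) (pcompose q [:0, z:])"
  by (simp add: pev_pcompose)

text \<open>The image of \<open>x\<close> has square \<open>x\<^sup>2 / 2\<close>. So the even part of a polynomial in \<open>x\<close> goes to a polynomial
  in \<open>x\<close>, the odd part to \<open>c\<close> times one, and these are independent.\<close>

lemma psi_E_injective:
  assumes w: "w\<^sup>2 = -2" and zero: "psi_E w a = 0"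
  shows "a = 0"
proof -
  note hom = psi_E_hom[of w]
  obtain q where q: "a = pev xo q" using opol1_pev by blast
  obtain r s where rs: "q = pcompose r [:0, 0, 1:] + pCons 0 (pcompose s [:0, 0, 1:])"
    using poly_even_odd by blast
  let ?r = "\<lambda>r :: complex poly. pcompose (pcompose r [:0, 1/2:]) [:0, 0, 1:]"
  have a: "a = pev (xo * xo) r + xo * pev (xo * xo) s"
    by (simp add: q rs pev_add pev_square)
  have "psi_E w a = pev px (?r r) + pc * pev px (smult (1/w) (pCons 0 (?r s)))"
  proof -
    have "psi_E w a = pev (psi_E w (xo * xo)) r + psi_E w xo * pev (psi_E w (xo * xo)) s"
      by (simp only: a alg_homD(2)[OF hom] alg_homD(3)[OF hom, of xo "pev (xo * xo) s"] pev_hom[OF hom])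
    moreover have "psi_E w xo = csc (1 / w) (pc * px)" by (simp add: psi_E_eq)
    ultimately show ?thesis
      by (simp add: psi_E_square[OF w] pev_half_square pev_smult pev_square mult.assoc)
  qed
  with zero have "pev px (?r r) + pc * pev px (smult (1/w) (pCons 0 (?r s))) = pev px 0 + pc * pev px 0"
    by simp
  from polcl1_independent[OF this] have "?r r = 0" "?r s = 0" using w by auto
  moreover have "r = 0" if "?r r = 0" for r
    using that pcompose_eq_0[of "pcompose r [:0, 1/2:]" "[:0, 0, 1:]"] pcompose_eq_0[of r "[:0, 1/2:]"] by simp
  ultimately have "r = 0" "s = 0" by blast+
  then show "a = 0" by (simp add: a)
qed

text \<open>The algebra is commutative; regularity is pulled back along the injective homomorphism
  \<open>psi_E w\<close>.\<close>

lemma EE_opol: "EE = {pev (xo * xo) q | q. q \<noteq> 0}" if w: "w\<^sup>2 = -2" for w :: complex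
proof (intro equalityI subsetI)
  fix Q assume Q: "Q \<in> (EE :: unit opol set)"
  then obtain q where q: "Q = pev (xo * xo) q"
    using opol1_homogeneous[of 0 Q] by (auto simp: EE_def)
  have "q \<noteq> 0"
  proof
    assume "q = 0"
    then have "(1 :: unit opol) = 0" using Q q by (auto simp: EE_def regular_def)
    then have "psi_E w 1 = psi_E w 0" by (simp only:)
    then have "(1 :: unit polcl) = 0" by (simp add: psi_E_eq alg_homD[OF opol_into_polcl_hom])
    then have "polcl_mod 1 (1, 0) = polcl_mod 0 (1, 0)" by (simp only:)
    then show False by (simp add: polcl_mod_simps)
  qed
  then show "Q \<in> {pev (xo * xo) q | q. q \<noteq> 0}" using q by blast
next
  note hom = psi_E_hom[of w]
  fix Q assume "Q \<in> {pev (xo * xo) q | q. q \<noteq> 0}"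
  then obtain q where q: "Q = pev (xo * xo) q" "q \<noteq> 0" by blast
  have "homogeneous 1 xo" using homogeneous_gen[of "Ox ()"] by (simp add: gen_parity_opol_gen_def)
  then have "homogeneous (1 + 1) (xo * xo)" by (intro homogeneous_times)
  then have "homogeneous 0 Q" unfolding q(1) by (intro pev_homogeneous) simp
  moreover have "b = 0" if "Q * b = 0" for b
  proof (rule psi_E_injective[OF w])
    have "psi_E w Q = pev (px * px) (pcompose q [:0, 1/2:])"
      by (simp add: q(1) pev_hom[OF hom] psi_E_square[OF w] pev_half_square)
    moreover have "pcompose q [:0, 1/2:] \<noteq> 0"
      using q(2) pcompose_eq_0[of q "[:0, 1/2:]"] by auto
    ultimately have "psi_E w Q \<in> EE" unfolding EE_polcl by blast
    moreover have "psi_E w Q * psi_E w b = 0" using that by (metis alg_homD(3,5)[OF hom])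
    ultimately show "psi_E w b = 0" unfolding EE_def regular_def by blast
  qed
  moreover have "b * Q = Q * b" for b by (rule opol1_comm)
  ultimately show "Q \<in> EE"
    by (simp add: EE_def supercentral_def sign_def regular_def)
qed

lemma psi_E_bij:
  assumes w: "w\<^sup>2 = -2"
  shows "bij_betw (psi_E w) EE EE"
  unfolding bij_betw_def
proof
  note hom = psi_E_hom[of w]
  show "inj_on (psi_E w) EE"
  proof (rule inj_onI)
    fix a b assume "psi_E w a = psi_E w b"
    then have "psi_E w a + csc (-1) (psi_E w b) = 0" by (simp add: csc_minus_one)
    then have "psi_E w (a + csc (-1) b) = 0" by (simp only: alg_homD[OF hom])
    from psi_E_injective[OF w this] show "a = b" by (simp add: csc_minus_one)
  qed
  have *: "psi_E w (pev (xo * xo) q) = pev (px * px) (pcompose q [:0, 1/2:])" for q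
    by (simp add: pev_hom[OF hom] psi_E_square[OF w] pev_half_square)
  have 2: "pcompose (pcompose q [:0, 2:]) [:0, 1/2:] = q" for q :: "complex poly"
    by (simp flip: pcompose_assoc add: pcompose_pCons)
  have nz: "pcompose q [:0, z:] \<noteq> 0" if "q \<noteq> 0" "z \<noteq> 0" for q and z :: complex
    using that pcompose_eq_0[of q "[:0, z:]"] by auto
  show "psi_E w ` EE = EE"
    unfolding EE_polcl EE_opol[OF w]
  proof (intro equalityI subsetI)
    fix a assume "a \<in> psi_E w ` {pev (xo * xo) q | q. q \<noteq> 0}"
    then show "a \<in> {pev (px * px) q | q. q \<noteq> 0}" using * nz[of _ "1/2"] by auto
  next
    fix a assume "a \<in> {pev (px * px) q | q. q \<noteq> 0}"
    then obtain q where "a = pev (px * px) q" "q \<noteq> 0" by blast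
    then have "a = psi_E w (pev (xo * xo) (pcompose q [:0, 2:]))" "pcompose q [:0, 2:] \<noteq> 0"
      using *[of "pcompose q [:0, 2:]"] 2[of q] nz[of q 2] by simp_all
    then show "a \<in> psi_E w ` {pev (xo * xo) q | q. q \<noteq> 0}" by blast
  qed
qed

lemma psi_E_inv:
  assumes w: "w\<^sup>2 = -2"
  shows "Q \<in> EE \<Longrightarrow> psi_E w Q \<in> EE" "Q \<in> EE \<Longrightarrow> psi_E_inv w (psi_E w Q) = Q"
    "Q' \<in> EE \<Longrightarrow> psi_E_inv w Q' \<in> EE" "Q' \<in> EE \<Longrightarrow> psi_E w (psi_E_inv w Q') = Q'"
  using psi_E_bij[OF w] unfolding psi_E_inv_def bij_betw_def
  by (auto simp: inv_into_into f_inv_into_f)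

lemma EE_polcl_expansion:
  assumes "Q \<in> (EE :: unit polcl set)"
  shows "\<exists>n \<mu>. Q = (\<Sum>k\<le>n. csc (\<mu> k) (px ^ k))"
proof -
  obtain q where "Q = pev (px * px) q" using assms by (auto simp: EE_polcl)
  then have "Q = pev px (pcompose q [:0, 0, 1:])" by (simp add: pev_square)
  then show ?thesis using pev_expand by blast
qed

lemma opol1_expansion: "\<exists>n \<mu>. (a :: unit opol) = (\<Sum>k\<le>n. csc (\<mu> k) (xo ^ k))"
  using opol1_pev[of a] pev_expand by metis

section \<open>The two Demazure operators\<close>

lemma odd_demazure_linear:
  "odd_demazure (f + g) = odd_demazure f + odd_demazure g" "odd_demazure (csc z f) = csc z (odd_demazure f)"
  "odd_demazure 1 = 0" "odd_demazure (ox i) = 1"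
  using odd_demazure by (cases i; simp add: is_odd_demazure_def clinear_def)+

lemma odd_demazure_mult:
  "homogeneous p f \<Longrightarrow> odd_demazure (f * g) = odd_demazure f * g + csc (sign p) (opol_swap f * odd_demazure g)"
  using odd_demazure by (simp add: is_odd_demazure_def)

lemma clifford_demazure_linear:
  "clifford_demazure (f + g) = clifford_demazure f + clifford_demazure g"
  "clifford_demazure (csc z f) = csc z (clifford_demazure f)"
  "clifford_demazure 1 = 0" "clifford_demazure (pcc i) = 0"
  "clifford_demazure (pcx First) = 1 + pcc First * pcc Second"
  "clifford_demazure (pcx Second) = -1 + pcc First * pcc Second"
  "clifford_demazure (f * g) = clifford_demazure f * g + polcl_swap f * clifford_demazure g"
  using clifford_demazure
  by (cases i; simp add: is_clifford_demazure_def clinear_def subalg.intros)+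

lemma csc_diff: "csc z (a - b) = csc z a - csc z b"
  using csc_simps(1)[of z a "- b"] by simp

abbreviation "cdiff \<equiv> pcc First - pcc Second"

lemma zero_of_linear: "(\<And>z f. D (csc z f) = csc z (D f)) \<Longrightarrow> D 0 = 0"
  by (metis csc_0_left)

text \<open>The odd and the even Demazure operator obey different Leibniz rules. Moving \<open>c\<^sub>1 - c\<^sub>2\<close> past an
  element produces the sign by which they differ; the identity is multiplicative in \<open>f\<close>, so the
  generators decide.\<close>

lemma opol_into_polcl_swap:
  "homogeneous p f \<Longrightarrow>
    csc (sign p) (opol_into_polcl w (opol_swap f) * cdiff) = cdiff * polcl_swap (opol_into_polcl w f)"
proof (induction rule: homogeneous.induct)
  note hom = alg_homD[OF opol_into_polcl_hom]
  {
    case (homogeneous_gen g)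
    obtain i where "g = Ox i" by (cases g)
    then show ?case
      by (cases i) (simp_all add: opol_swap_simps polcl_swap_simps gen_parity_opol_gen_def sign_def
          pcx_move algebra_simps csc_diff)
  next
    case (homogeneous_csc p a z)
    have "csc (sign p) (opol_into_polcl w (opol_swap (csc z a)) * cdiff) =
        csc z (csc (sign p) (opol_into_polcl w (opol_swap a) * cdiff))"
      by (simp only: opol_swap_simps hom csc_simps mult.commute[of z])
    then show ?case by (simp only: homogeneous_csc.IH polcl_swap_simps hom csc_simps)
  next
    case (homogeneous_times p a q b)
    note IH = homogeneous_times.IH
    have "csc (sign (p + q)) (opol_into_polcl w (opol_swap (a * b)) * cdiff) =
        csc (sign p) (opol_into_polcl w (opol_swap a) * csc (sign q) (opol_into_polcl w (opol_swap b) * cdiff))"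
      by (simp only: opol_swap_simps hom csc_simps mult.assoc) (simp add: sign_def)
    also have "\<dots> = csc (sign p) (opol_into_polcl w (opol_swap a) * cdiff) * polcl_swap (opol_into_polcl w b)"
      by (simp only: IH(2) csc_simps mult.assoc)
    also have "\<dots> = cdiff * polcl_swap (opol_into_polcl w (a * b))"
      by (simp only: IH(1) polcl_swap_simps hom mult.assoc)
    finally show ?case .
  }
qed (simp_all add: opol_swap_simps polcl_swap_simps alg_homD[OF opol_into_polcl_hom] sign_def distrib_left distrib_right
   csc_minus_one)

text \<open>By the preceding lemma both sides obey the same Leibniz rule, and they agree on \<open>x\<^sub>1\<close> and \<open>x\<^sub>2\<close>.\<close>

lemma demazure_compare:
  assumes w: "w\<^sup>2 = -2"
  shows "opol_into_polcl w (odd_demazure f) = csc (1 / w) (cdiff * clifford_demazure (opol_into_polcl w f))"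
proof -
  note hom = alg_homD[OF opol_into_polcl_hom]
  have z: "odd_demazure 0 = 0" "clifford_demazure 0 = 0"
    by (rule zero_of_linear, simp add: odd_demazure_linear clifford_demazure_linear)+
  have w_reciprocal: "1 / (w * w) = - 1 / 2" using w by (simp add: power2_eq_square)
  have *: "opol_into_polcl w (odd_demazure f) = csc (1 / w) (cdiff * clifford_demazure (opol_into_polcl w f))"
    if "homogeneous p f" for p f using that
  proof induction
    case (homogeneous_gen g)
    have half: "csc (1/2) a + csc (1/2) a = a" for a :: "two polcl"
      using csc_plus[of "1/2" "1/2" a] by simp
    obtain i where "g = Ox i" by (cases g)
    then show ?case
      by (cases i) (simp_all add: odd_demazure_linear clifford_demazure_linear hom w_reciprocal polcl_swap_simps
          pcx_move algebra_simps csc_diff half)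
  next
    case (homogeneous_times p a q b)
    note IH = homogeneous_times.IH
    have "opol_into_polcl w (odd_demazure (a * b)) =
        opol_into_polcl w (odd_demazure a) * opol_into_polcl w b +
        csc (sign p) (opol_into_polcl w (opol_swap a) * opol_into_polcl w (odd_demazure b))"
      by (simp only: odd_demazure_mult[OF homogeneous_times.hyps(1)] hom)
    also have "\<dots> = csc (1 / w) (cdiff * clifford_demazure (opol_into_polcl w a)) * opol_into_polcl w b +
        csc (1 / w) (csc (sign p) (opol_into_polcl w (opol_swap a) * cdiff) * clifford_demazure (opol_into_polcl w b))"
      by (simp only: IH csc_simps mult.assoc mult.commute[of "sign p"])
    also have "\<dots> = csc (1 / w) (cdiff * clifford_demazure (opol_into_polcl w (a * b)))"
      by (simp only: opol_into_polcl_swap[OF homogeneous_times.hyps(1)] clifford_demazure_linear(7) hom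
          csc_simps mult.assoc distrib_left)
    finally show ?case .
  qed (simp_all add: z odd_demazure_linear clifford_demazure_linear hom distrib_left mult.commute)
  obtain b c where "homogeneous 0 b" "homogeneous 1 c" "f = b + c" using homog_decomp by blast
  then show ?thesis
    using * by (simp add: odd_demazure_linear clifford_demazure_linear hom distrib_left)
qed

lemma opol_into_polcl_at1: "opol_into_polcl w (opol_at1 Q) = polcl_at1 (psi_E w Q)"
proof -
  have at1: "alg_hom opol_at1" "alg_hom polcl_at1"
    unfolding opol_at1_def polcl_at1_def
    by (rule alg_hom_alg_ext, erule opol_at1_rel, rule alg_hom_alg_ext, erule polcl_at1_rel)
  note simps = alg_ext[OF opol_at1_rel, folded opol_at1_def] alg_ext[OF polcl_at1_rel, folded polcl_at1_def]
  show ?thesis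
  proof (rule alg_hom_eqI[of "\<lambda>a. opol_into_polcl w (opol_at1 a)" "\<lambda>a. polcl_at1 (psi_E w a)"])
    fix g show "opol_into_polcl w (opol_at1 (sgen g)) = polcl_at1 (psi_E w (sgen g))"
      by (cases g) (simp add: psi_E_eq simps)
  qed (rule alg_hom_comp[OF opol_into_polcl_hom at1(1)] alg_hom_comp[OF at1(2) psi_E_hom])+
qed

definition parity_aut :: "'g::presentation salg \<Rightarrow> 'g salg" where
  "parity_aut = alg_ext (\<lambda>g. csc (sign (gen_parity g)) (sgen g))"

lemma parity_rel_opol:
  "gen_rel s t \<Longrightarrow> fa_eval (\<lambda>g :: 'i opol_gen. csc (sign (gen_parity g)) (sgen g)) s =
    fa_eval (\<lambda>g. csc (sign (gen_parity g)) (sgen g)) t"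
  by (erule gen_rel_opol_gen.cases) (auto simp: gen_parity_opol_gen_def sign_def csc_minus_one intro!: ox_anticommute)

lemma parity_rel_polcl:
  "gen_rel s t \<Longrightarrow> fa_eval (\<lambda>g :: 'i polcl_gen. csc (sign (gen_parity g)) (sgen g)) s =
    fa_eval (\<lambda>g. csc (sign (gen_parity g)) (sgen g)) t"
  by (erule gen_rel_polcl_gen.cases)
    (auto simp: gen_parity_polcl_gen_def sign_def csc_minus_one polcl_rels(2) intro!: polcl_rels)

lemma parity_aut_homogeneous:
  fixes a :: "'g::presentation salg"
  assumes rel: "\<And>s t. gen_rel s t \<Longrightarrow> fa_eval (\<lambda>g :: 'g. csc (sign (gen_parity g)) (sgen g)) s =
    fa_eval (\<lambda>g. csc (sign (gen_parity g)) (sgen g)) t"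
    and a: "homogeneous p a"
  shows "parity_aut a = csc (sign p) a"
  using a
proof induction
  note simps = alg_ext[OF rel, folded parity_aut_def]
  {
    case (homogeneous_times p a q b)
    have "sign p * sign q = sign (p + q)" by (cases p; cases q) (auto simp: sign_def)
    with homogeneous_times show ?case by (simp only: simps csc_simps) (simp add: mult.commute)
  next
    case homogeneous_one
    then show ?case by (simp add: simps sign_def)
  }
qed (simp_all add: alg_ext[OF rel, folded parity_aut_def] mult.commute)

lemma polcl_swap_homogeneous: "homogeneous p f \<Longrightarrow> homogeneous p (polcl_swap f)"
proof (induction rule: homogeneous.induct)
  case (homogeneous_gen g)
  have "homogeneous (gen_parity g) (sgen (case g of PCc i \<Rightarrow> PCc (flip i) | PCx i \<Rightarrow> PCx (flip i)))"
    using homogeneous.homogeneous_gen[of "case g of PCc i \<Rightarrow> PCc (flip i) | PCx i \<Rightarrow> PCx (flip i)"]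
    by (cases g) (simp_all add: gen_parity_polcl_gen_def)
  then show ?case by (cases g) (simp_all add: polcl_swap_simps)
qed (simp_all only: polcl_swap_simps homogeneous.intros)

lemma clifford_demazure_homogeneous: "homogeneous p f \<Longrightarrow> homogeneous p (clifford_demazure f)"
proof (induction rule: homogeneous.induct)
  have c: "homogeneous 1 (pcc i)" for i :: two
    using homogeneous_gen[of "PCc i"] by (simp add: gen_parity_polcl_gen_def)
  have cc: "homogeneous 0 (pcc First * pcc Second)"
    using homogeneous_times[OF c c, of First Second] by simp
  have one: "homogeneous 0 (-1 :: two polcl)"
    using homogeneous_csc[OF homogeneous_one, of "-1"] by (simp add: csc_minus_one)
  {
    case (homogeneous_gen g)
    show ?case
    proof (cases g)
      case (PCc i)
      then show ?thesis by (simp add: clifford_demazure_linear homogeneous_zero)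
    next
      case (PCx i)
      then show ?thesis
        using homogeneous_plus[OF homogeneous_one cc] homogeneous_plus[OF one cc]
        by (cases i) (simp_all add: clifford_demazure_linear gen_parity_polcl_gen_def)
    qed
  next
    case (homogeneous_zero p)
    have "clifford_demazure 0 = 0" by (rule zero_of_linear) (rule clifford_demazure_linear)
    then show ?case by (simp add: homogeneous.homogeneous_zero)
  }
qed (simp_all only: clifford_demazure_linear homogeneous.intros polcl_swap_homogeneous)

lemma odd_demazure_homogeneous: "homogeneous p f \<Longrightarrow> homogeneous (p + 1) (odd_demazure f)"
  using odd_demazure by (simp add: is_odd_demazure_def)

lemma opol_at1_homogeneous: "homogeneous p Q \<Longrightarrow> homogeneous p (opol_at1 Q)"
proof (induction rule: homogeneous.induct)
  note simps = alg_ext[OF opol_at1_rel, folded opol_at1_def]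
  {
    case (homogeneous_gen g)
    show ?case
      using homogeneous.homogeneous_gen[of "Ox First"] by (cases g) (simp add: simps gen_parity_opol_gen_def)
  }
qed (simp_all only: alg_ext[OF opol_at1_rel, folded opol_at1_def] homogeneous.intros)

lemma polcl_at1_homogeneous: "homogeneous p Q \<Longrightarrow> homogeneous p (polcl_at1 Q)"
proof (induction rule: homogeneous.induct)
  note simps = alg_ext[OF polcl_at1_rel, folded polcl_at1_def]
  {
    case (homogeneous_gen g)
    show ?case
      using homogeneous.homogeneous_gen[of "PCc First"] homogeneous.homogeneous_gen[of "PCx First"]
      by (cases g) (simp_all add: simps gen_parity_polcl_gen_def)
  }
qed (simp_all only: alg_ext[OF polcl_at1_rel, folded polcl_at1_def] homogeneous.intros)

section \<open>Expansions in monomials\<close>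

text \<open>The span of the monomials contains \<open>1\<close> and is stable under left multiplication by generators,
  so it is the whole algebra.\<close>

lemma monomial_expansion:
  fixes m :: "'i \<Rightarrow> 'g::presentation salg"
  assumes one: "1 \<in> m ` I" and closed: "\<And>g i. i \<in> I \<Longrightarrow> \<exists>z. \<exists>j\<in>I. sgen g * m i = csc z (m j)"
  shows "\<exists>F \<mu>. finite F \<and> F \<subseteq> I \<and> (\<forall>i. i \<notin> F \<longrightarrow> \<mu> i = 0) \<and> a = (\<Sum>i\<in>F. csc (\<mu> i) (m i))"
proof -
  define S where "S = {a. \<exists>F \<mu>. finite F \<and> F \<subseteq> I \<and> (\<forall>i. i \<notin> F \<longrightarrow> \<mu> i = 0) \<and> a = (\<Sum>i\<in>F. csc (\<mu> i) (m i))}"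
  have mono: "csc z (m i) \<in> S" if "i \<in> I" for z i
    using that
    unfolding S_def by (intro CollectI exI[of _ "{i}"] exI[of _ "(\<lambda>_. 0)(i := z)"]) simp
  have zero: "0 \<in> S"
    unfolding S_def by (intro CollectI exI[of _ "{}"] exI[of _ "\<lambda>_. 0"]) simp
  have plus: "a + b \<in> S" if a: "a \<in> S" and b: "b \<in> S" for a b
  proof -
    obtain F \<mu> where F: "finite F" "F \<subseteq> I" "\<forall>i. i \<notin> F \<longrightarrow> \<mu> i = 0" "a = (\<Sum>i\<in>F. csc (\<mu> i) (m i))"
      using a by (auto simp: S_def)
    obtain G \<nu> where G: "finite G" "G \<subseteq> I" "\<forall>i. i \<notin> G \<longrightarrow> \<nu> i = 0" "b = (\<Sum>i\<in>G. csc (\<nu> i) (m i))"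
      using b by (auto simp: S_def)
    have "a = (\<Sum>i\<in>F \<union> G. csc (\<mu> i) (m i))" "b = (\<Sum>i\<in>F \<union> G. csc (\<nu> i) (m i))"
      using F G by (auto intro!: sum.mono_neutral_left)
    then have "a + b = (\<Sum>i\<in>F \<union> G. csc (\<mu> i + \<nu> i) (m i))"
      by (simp add: csc_plus sum.distrib)
    then show ?thesis
      using F G unfolding S_def by (intro CollectI exI[of _ "F \<union> G"] exI[of _ "\<lambda>i. \<mu> i + \<nu> i"]) simp
  qed
  have sum: "finite F \<Longrightarrow> (\<And>i. i \<in> F \<Longrightarrow> f i \<in> S) \<Longrightarrow> (\<Sum>i\<in>F. f i) \<in> S" for F and f :: "'i \<Rightarrow> 'g salg"
    by (induction F rule: finite_induct) (simp_all add: zero plus)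
  have scale: "csc z a \<in> S" if "a \<in> S" for z a
  proof -
    obtain F \<mu> where F: "finite F" "F \<subseteq> I" "a = (\<Sum>i\<in>F. csc (\<mu> i) (m i))" using \<open>a \<in> S\<close> by (auto simp: S_def)
    have "csc z (\<Sum>i\<in>F. csc (\<mu> i) (m i)) = (\<Sum>i\<in>F. csc (z * \<mu> i) (m i))"
      using F(1) by (induction F rule: finite_induct) simp_all
    then show ?thesis using sum[OF F(1), of "\<lambda>i. csc (z * \<mu> i) (m i)"] mono F(2,3) by auto
  qed
  have gen: "sgen g * a \<in> S" if "a \<in> S" for g a
  proof -
    obtain F \<mu> where F: "finite F" "F \<subseteq> I" "a = (\<Sum>i\<in>F. csc (\<mu> i) (m i))" using \<open>a \<in> S\<close> by (auto simp: S_def)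
    have "sgen g * csc (\<mu> i) (m i) \<in> S" if i: "i \<in> F" for i
    proof -
      obtain z j where "j \<in> I" "sgen g * m i = csc z (m j)" using closed i F(2) by blast
      then show ?thesis using mono[of j "\<mu> i * z"] by simp
    qed
    then show ?thesis using sum[OF F(1)] by (simp add: F(3) sum_distrib_left)
  qed
  have mult: "a * b \<in> S" if "b \<in> S" for a b
    using that
  proof (induction a arbitrary: b rule: salg_induct)
    case (times a1 a2)
    then show ?case by (simp add: mult.assoc)
  qed (simp_all add: gen zero plus scale distrib_right)
  obtain i where "i \<in> I" "m i = 1" using one by auto
  then have "1 \<in> S" using mono[of i 1] by simp
  then have "a * 1 \<in> S" by (rule mult)
  then show ?thesis by (simp add: S_def)
qed

lemma power_anticommute: "a * b = - (b * a) \<Longrightarrow> a * b ^ n = csc ((-1) ^ n) (b ^ n * a)"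
  for a b :: "'g::presentation salg"
proof (induction n)
  case (Suc n)
  have "a * b ^ Suc n = - (b * (a * b ^ n))" using Suc(2) by (simp flip: mult.assoc)
  then show ?case using Suc by (simp add: mult.assoc)
qed simp

lemma power_commute: "a * b = b * a \<Longrightarrow> a * b ^ n = b ^ n * a"
  for a b :: "'g::presentation salg"
  by (induction n) (simp_all add: mult.assoc, metis mult.assoc)

lemma opol2_expansion:
  "\<exists>n \<mu>. (f :: two opol) = (\<Sum>r\<le>n. \<Sum>s\<le>n. csc (\<mu> r s) (ox First ^ r * ox Second ^ s))"
proof -
  let ?m = "\<lambda>(r, s). ox First ^ r * ox Second ^ s"
  have "1 \<in> ?m ` UNIV" by (rule image_eqI[of _ _ "(0, 0)"]) simp_all
  moreover have "\<exists>z. \<exists>j\<in>UNIV. sgen g * ?m i = csc z (?m j)" for g i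
  proof (cases i)
    case (Pair r s)
    obtain k where g: "g = Ox k" by (cases g)
    show ?thesis
    proof (cases k)
      case First
      then show ?thesis
        by (intro exI[of _ 1] bexI[of _ "(Suc r, s)"]) (simp_all add: g Pair mult.assoc)
    next
      case Second
      have "ox Second * ox First ^ r = csc ((-1) ^ r) (ox First ^ r * ox Second)"
        by (intro power_anticommute ox_anticommute) simp
      then have "ox Second * (ox First ^ r * ox Second ^ s) = csc ((-1) ^ r) (ox First ^ r * ox Second ^ Suc s)"
        by (simp flip: mult.assoc)
      then show ?thesis
        using Second by (intro exI[of _ "(-1) ^ r"] bexI[of _ "(r, Suc s)"]) (simp_all add: g Pair)
    qed
  qed
  ultimately obtain F \<mu> where F: "finite F" "\<forall>i. i \<notin> F \<longrightarrow> \<mu> i = 0" "f = (\<Sum>i\<in>F. csc (\<mu> i) (?m i))"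
    using monomial_expansion[of ?m UNIV f] by blast
  define n where "n = Max (insert 0 (fst ` F \<union> snd ` F))"
  have "F \<subseteq> {..n} \<times> {..n}"
    using F(1) unfolding n_def by (force intro!: Max_ge)
  then have "f = (\<Sum>i\<in>{..n} \<times> {..n}. csc (\<mu> i) (?m i))"
    using F by (auto intro!: sum.mono_neutral_left)
  also have "\<dots> = (\<Sum>r\<le>n. \<Sum>s\<le>n. csc (\<mu> (r, s)) (ox First ^ r * ox Second ^ s))"
    by (simp add: sum.cartesian_product case_prod_unfold)
  finally show ?thesis by (intro exI[of _ n] exI[of _ "\<lambda>r s. \<mu> (r, s)"])
qed

lemma polcl2_expansion:
  "\<exists>n \<mu>. (f :: two polcl) = (\<Sum>a\<le>1. \<Sum>b\<le>1. \<Sum>r\<le>n. \<Sum>s\<le>n.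
     csc (\<mu> a b r s) (pcc First ^ a * pcc Second ^ b * pcx First ^ r * pcx Second ^ s))"
proof -
  let ?m = "\<lambda>(a, b, r, s). pcc First ^ a * pcc Second ^ b * pcx First ^ r * pcx Second ^ s"
  let ?I = "{..1 :: nat} \<times> {..1 :: nat} \<times> UNIV \<times> UNIV"
  have one: "1 \<in> ?m ` ?I" by (rule image_eqI[of _ _ "(0, 0, 0, 0)"]) simp_all
  have closed: "\<exists>z. \<exists>j\<in>?I. sgen g * ?m i = csc z (?m j)" if i: "i \<in> ?I" for g i
  proof (cases i)
    case (fields a b r s)
    have move: "pcx Second * (pcx First ^ r * v) = pcx First ^ r * (pcx Second * v)" for v
    proof -
      have "pcx Second * pcx First ^ r = pcx First ^ r * pcx Second"
        by (rule power_commute) (rule polcl_rels)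
      then show ?thesis by (simp flip: mult.assoc)
    qed
    have ab: "a = 0 \<or> a = 1" "b = 0 \<or> b = 1" using i by (auto simp: fields)
    show ?thesis
    proof (cases g)
      case (PCc k)
      then show ?thesis
        using ab by (intro exI[of _ "if k = Second \<and> a = 1 then -1 else 1"]
            bexI[of _ "if k = First then (1 - a, b, r, s) else (a, 1 - b, r, s)"]; cases k)
          (auto simp: fields pcx_move mult.assoc csc_minus_one)
    next
      case (PCx k)
      then show ?thesis
        using ab by (intro exI[of _ "if (if k = First then a else b) = 1 then -1 else 1"]
            bexI[of _ "if k = First then (a, b, Suc r, s) else (a, b, r, Suc s)"]; cases k)
          (auto simp: fields pcx_move move mult.assoc csc_minus_one)
    qed
  qed
  have "\<exists>F \<mu>. finite F \<and> F \<subseteq> ?I \<and> (\<forall>i. i \<notin> F \<longrightarrow> \<mu> i = 0) \<and>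
      f = (\<Sum>i\<in>F. csc (\<mu> i) (?m i))"
    by (rule monomial_expansion[OF one closed])
  then obtain F \<mu> where F: "finite F" "F \<subseteq> ?I" "\<forall>i. i \<notin> F \<longrightarrow> \<mu> i = 0"
    "f = (\<Sum>i\<in>F. csc (\<mu> i) (?m i))"
    by - (elim exE conjE, erule (3) that)
  define n where "n = Max (insert 0 ((\<lambda>i. fst (snd (snd i))) ` F \<union> (\<lambda>i. snd (snd (snd i))) ` F))"
  let ?J = "{..1 :: nat} \<times> {..1 :: nat} \<times> {..n} \<times> {..n}"
  have "F \<subseteq> ?J"
  proof
    fix i assume i: "i \<in> F"
    then have "fst (snd (snd i)) \<le> n" "snd (snd (snd i)) \<le> n"
      using F(1) unfolding n_def by (auto intro!: Max_ge)
    then show "i \<in> ?J" using i F(2) by (cases i) auto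
  qed
  then have "f = (\<Sum>i\<in>?J. csc (\<mu> i) (?m i))"
    unfolding F(4) using F(3) by (intro sum.mono_neutral_left) auto
  also have "\<dots> = (\<Sum>a\<le>1. \<Sum>b\<le>1. \<Sum>r\<le>n. \<Sum>s\<le>n. csc (\<mu> (a, b, r, s))
      (pcc First ^ a * pcc Second ^ b * pcx First ^ r * pcx Second ^ s))"
    by (simp add: sum.cartesian_product case_prod_unfold)
  finally show ?thesis by (intro exI[of _ n] exI[of _ "\<lambda>a b r s. \<mu> (a, b, r, s)"])
qed

section \<open>Calculations in a supercategory\<close>

context word_supercategory
begin

abbreviation comp_syntax (infixr "\<odot>" 70) where "f \<odot> g \<equiv> Comp M f g"
abbreviation tens_syntax (infixr "\<star>" 75) where "f \<star> g \<equiv> Tens M f g"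
abbreviation add_syntax (infixl "\<^bold>+" 65) where "f \<^bold>+ g \<equiv> Add M f g"
abbreviation scal_syntax (infixr "\<^bold>*" 80) where "z \<^bold>* f \<equiv> Scal M z f"
abbreviation ident_syntax ("\<^bold>1") where "\<^bold>1 a \<equiv> Ident M a"

text \<open>With source and target as functions of the morphism, typing conditions become equations between
  words, and the axioms become conditional rewrite rules.\<close>

definition arr :: "'m \<Rightarrow> bool" where "arr f \<longleftrightarrow> (\<exists>a b. f \<in> Hom M a b)"
definition dm :: "'m \<Rightarrow> 'k list" where "dm f = (THE a. \<exists>b. f \<in> Hom M a b)"
definition cd :: "'m \<Rightarrow> 'k list" where "cd f = (THE b. \<exists>a. f \<in> Hom M a b)"

lemma homD:
  assumes "f \<in> Hom M a b"
  shows "arr f" "dm f = a" "cd f = b"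
proof -
  show "arr f" using assms by (auto simp: arr_def)
  show "dm f = a" unfolding dm_def using assms hom_disjoint by (intro the_equality) blast+
  show "cd f = b" unfolding cd_def using assms hom_disjoint by (intro the_equality) blast+
qed

lemma hom_iff: "f \<in> Hom M a b \<longleftrightarrow> arr f \<and> dm f = a \<and> cd f = b"
  using homD unfolding arr_def by metis

lemma arr_hom: "arr f \<Longrightarrow> f \<in> Hom M (dm f) (cd f)"
  by (simp add: hom_iff)

lemma nil_obj [simp]: "[] \<in> Obj M"
  using unit_obj by (simp add: unit_word)

lemma append_obj: "a \<in> Obj M \<Longrightarrow> b \<in> Obj M \<Longrightarrow> a @ b \<in> Obj M"
  using tens_obj by (simp add: tens_words)

lemma cons_obj [simp]: "[x] \<in> Obj M \<Longrightarrow> y # a \<in> Obj M \<Longrightarrow> x # y # a \<in> Obj M"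
  using append_obj[of "[x]" "y # a"] by simp

lemma arr_obj [simp]: "arr f \<Longrightarrow> dm f \<in> Obj M" "arr f \<Longrightarrow> cd f \<in> Obj M"
  using hom_obj arr_hom by blast+

lemma typing [simp]:
  "a \<in> Obj M \<Longrightarrow> arr (\<^bold>1 a)" "a \<in> Obj M \<Longrightarrow> dm (\<^bold>1 a) = a" "a \<in> Obj M \<Longrightarrow> cd (\<^bold>1 a) = a"
  "arr f \<Longrightarrow> arr (z \<^bold>* f)" "arr f \<Longrightarrow> dm (z \<^bold>* f) = dm f" "arr f \<Longrightarrow> cd (z \<^bold>* f) = cd f"
  "\<lbrakk>arr f; arr g; dm f = cd g\<rbrakk> \<Longrightarrow> arr (f \<odot> g)"
  "\<lbrakk>arr f; arr g; dm f = cd g\<rbrakk> \<Longrightarrow> dm (f \<odot> g) = dm g"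
  "\<lbrakk>arr f; arr g; dm f = cd g\<rbrakk> \<Longrightarrow> cd (f \<odot> g) = cd f"
  "\<lbrakk>arr f; arr g; dm f = dm g; cd f = cd g\<rbrakk> \<Longrightarrow> arr (f \<^bold>+ g)"
  "\<lbrakk>arr f; arr g; dm f = dm g; cd f = cd g\<rbrakk> \<Longrightarrow> dm (f \<^bold>+ g) = dm g"
  "\<lbrakk>arr f; arr g; dm f = dm g; cd f = cd g\<rbrakk> \<Longrightarrow> cd (f \<^bold>+ g) = cd g"
  "\<lbrakk>arr f; arr g\<rbrakk> \<Longrightarrow> arr (f \<star> g)"
  "\<lbrakk>arr f; arr g\<rbrakk> \<Longrightarrow> dm (f \<star> g) = dm f @ dm g"
  "\<lbrakk>arr f; arr g\<rbrakk> \<Longrightarrow> cd (f \<star> g) = cd f @ cd g"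
  using homD[OF part_hom[OF id_part]] homD[OF scal_hom[OF arr_hom]]
    homD[OF comp_hom, of f "dm f" "cd f" g "dm g"] homD[OF add_hom, of f "dm f" "cd f" g]
    homD[OF tens_hom, OF arr_hom arr_hom, of f g]
  by (simp_all add: hom_iff tens_words)

lemma calc:
  "\<lbrakk>arr f; arr g; arr h; dm f = cd g; dm g = cd h\<rbrakk> \<Longrightarrow> (f \<odot> g) \<odot> h = f \<odot> g \<odot> h"
  "\<lbrakk>arr f; cd f = a\<rbrakk> \<Longrightarrow> \<^bold>1 a \<odot> f = f"
  "\<lbrakk>arr f; dm f = a\<rbrakk> \<Longrightarrow> f \<odot> \<^bold>1 a = f"
  "\<lbrakk>arr f; arr g; arr h; dm f = dm g; cd f = cd g; dm f = cd h\<rbrakk> \<Longrightarrow> (f \<^bold>+ g) \<odot> h = f \<odot> h \<^bold>+ g \<odot> h"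
  "\<lbrakk>arr f; arr g; arr h; dm g = dm h; cd g = cd h; dm f = cd g\<rbrakk> \<Longrightarrow> f \<odot> (g \<^bold>+ h) = f \<odot> g \<^bold>+ f \<odot> h"
  "\<lbrakk>arr f; arr g; dm f = cd g\<rbrakk> \<Longrightarrow> (z \<^bold>* f) \<odot> g = z \<^bold>* (f \<odot> g)"
  "\<lbrakk>arr f; arr g; dm f = cd g\<rbrakk> \<Longrightarrow> f \<odot> (z \<^bold>* g) = z \<^bold>* (f \<odot> g)"
  "\<lbrakk>arr f; arr g; arr h\<rbrakk> \<Longrightarrow> (f \<star> g) \<star> h = f \<star> g \<star> h"
  "arr f \<Longrightarrow> \<^bold>1 [] \<star> f = f"
  "arr f \<Longrightarrow> f \<star> \<^bold>1 [] = f"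
  "\<lbrakk>a \<in> Obj M; b \<in> Obj M\<rbrakk> \<Longrightarrow> \<^bold>1 a \<star> \<^bold>1 b = \<^bold>1 (a @ b)"
  "\<lbrakk>arr f; arr g; arr h; dm f = dm g; cd f = cd g\<rbrakk> \<Longrightarrow> (f \<^bold>+ g) \<star> h = f \<star> h \<^bold>+ g \<star> h"
  "\<lbrakk>arr f; arr g; arr h; dm g = dm h; cd g = cd h\<rbrakk> \<Longrightarrow> f \<star> (g \<^bold>+ h) = f \<star> g \<^bold>+ f \<star> h"
  "\<lbrakk>arr f; arr g\<rbrakk> \<Longrightarrow> (z \<^bold>* f) \<star> g = z \<^bold>* (f \<star> g)"
  "\<lbrakk>arr f; arr g\<rbrakk> \<Longrightarrow> f \<star> (z \<^bold>* g) = z \<^bold>* (f \<star> g)"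
  "\<lbrakk>arr f; arr g; dm f = dm g; cd f = cd g\<rbrakk> \<Longrightarrow> z \<^bold>* (f \<^bold>+ g) = z \<^bold>* f \<^bold>+ z \<^bold>* g"
  "arr f \<Longrightarrow> z \<^bold>* (z' \<^bold>* f) = (z * z') \<^bold>* f"
  "arr f \<Longrightarrow> 1 \<^bold>* f = f"
  "\<lbrakk>arr f; a \<in> Obj M; b \<in> Obj M\<rbrakk> \<Longrightarrow> \<^bold>1 a \<star> (\<^bold>1 b \<star> f) = \<^bold>1 (a @ b) \<star> f"
proof -
  note h = arr_hom
  show "\<lbrakk>arr f; arr g; arr h; dm f = cd g; dm g = cd h\<rbrakk> \<Longrightarrow> (f \<odot> g) \<odot> h = f \<odot> g \<odot> h"
    using comp_assoc[OF h[of f], of g "dm g" h "dm h"] by (simp add: hom_iff)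
  show "\<lbrakk>arr f; cd f = a\<rbrakk> \<Longrightarrow> \<^bold>1 a \<odot> f = f" "\<lbrakk>arr f; dm f = a\<rbrakk> \<Longrightarrow> f \<odot> \<^bold>1 a = f"
    using id_comp[OF h[of f]] comp_id[OF h[of f]] by simp_all
  show "\<lbrakk>arr f; arr g; arr h; dm f = dm g; cd f = cd g; dm f = cd h\<rbrakk> \<Longrightarrow> (f \<^bold>+ g) \<odot> h = f \<odot> h \<^bold>+ g \<odot> h"
    using comp_add_left[OF h[of f], of g h "dm h"] by (simp add: hom_iff)
  show "\<lbrakk>arr f; arr g; arr h; dm g = dm h; cd g = cd h; dm f = cd g\<rbrakk> \<Longrightarrow> f \<odot> (g \<^bold>+ h) = f \<odot> g \<^bold>+ f \<odot> h"
    using comp_add_right[OF h[of f], of g "dm g" h] by (simp add: hom_iff)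
  show "\<lbrakk>arr f; arr g; dm f = cd g\<rbrakk> \<Longrightarrow> (z \<^bold>* f) \<odot> g = z \<^bold>* (f \<odot> g)"
    "\<lbrakk>arr f; arr g; dm f = cd g\<rbrakk> \<Longrightarrow> f \<odot> (z \<^bold>* g) = z \<^bold>* (f \<odot> g)"
    using comp_scal_left[OF h[of f], of g "dm g"] comp_scal_right[OF h[of f], of g "dm g"]
    by (simp_all add: hom_iff)
  show assoc: "\<lbrakk>arr f; arr g; arr h\<rbrakk> \<Longrightarrow> (f \<star> g) \<star> h = f \<star> g \<star> h" for f g h
    using tens_assoc[OF h[of f] h[of g] h[of h]] by simp
  show "arr f \<Longrightarrow> \<^bold>1 [] \<star> f = f" "arr f \<Longrightarrow> f \<star> \<^bold>1 [] = f"
    using unit_tens[OF h[of f]] tens_unit[OF h[of f]] by (simp_all add: unit_word)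
  show id: "\<lbrakk>a \<in> Obj M; b \<in> Obj M\<rbrakk> \<Longrightarrow> \<^bold>1 a \<star> \<^bold>1 b = \<^bold>1 (a @ b)"
    using tens_id by (simp add: tens_words)
  show "\<lbrakk>arr f; arr g; arr h; dm f = dm g; cd f = cd g\<rbrakk> \<Longrightarrow> (f \<^bold>+ g) \<star> h = f \<star> h \<^bold>+ g \<star> h"
    using tens_add_left[OF h[of f] _ h[of h], of g] by (simp add: hom_iff)
  show "\<lbrakk>arr f; arr g; arr h; dm g = dm h; cd g = cd h\<rbrakk> \<Longrightarrow> f \<star> (g \<^bold>+ h) = f \<star> g \<^bold>+ f \<star> h"
    using tens_add_right[OF h[of f] h[of g], of h] by (simp add: hom_iff)
  show "\<lbrakk>arr f; arr g\<rbrakk> \<Longrightarrow> (z \<^bold>* f) \<star> g = z \<^bold>* (f \<star> g)" "\<lbrakk>arr f; arr g\<rbrakk> \<Longrightarrow> f \<star> (z \<^bold>* g) = z \<^bold>* (f \<star> g)"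
    using tens_scal_left[OF h[of f] h[of g]] tens_scal_right[OF h[of f] h[of g]] by simp_all
  show "\<lbrakk>arr f; arr g; dm f = dm g; cd f = cd g\<rbrakk> \<Longrightarrow> z \<^bold>* (f \<^bold>+ g) = z \<^bold>* f \<^bold>+ z \<^bold>* g"
    using scal_add[OF h[of f], of g] by (simp add: hom_iff)
  show "arr f \<Longrightarrow> z \<^bold>* (z' \<^bold>* f) = (z * z') \<^bold>* f" "arr f \<Longrightarrow> 1 \<^bold>* f = f"
    using scal_scal[OF h[of f]] scal_one[OF h[of f]] by simp_all
  show "\<lbrakk>arr f; a \<in> Obj M; b \<in> Obj M\<rbrakk> \<Longrightarrow> \<^bold>1 a \<star> (\<^bold>1 b \<star> f) = \<^bold>1 (a @ b) \<star> f"
    by (simp add: id flip: assoc)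
qed

lemma hom_parts:
  assumes "arr f"
  obtains g h where "f = g \<^bold>+ h" "g \<in> Part M 0 (dm f) (cd f)" "h \<in> Part M 1 (dm f) (cd f)"
  using part_sum[OF arr_hom[OF assms]] by blast

lemma tens_comp:
  assumes g: "g \<in> Part M p (dm g) (cd g)" and h: "h \<in> Part M q (dm h) (cd h)"
    and "arr f" "arr k" "dm f = cd g" "dm h = cd k"
  shows "(f \<star> h) \<odot> (g \<star> k) = sign (p * q) \<^bold>* ((f \<odot> g) \<star> (h \<odot> k))"
  using interchange[OF _ g h, of f "cd f" k "dm k"] assms by (simp add: hom_iff)

text \<open>The interchange law speaks of homogeneous morphisms; the general case follows by splitting \<open>g\<close>
  into its even and odd parts.\<close>

lemma comp_whisker_right:
  assumes "arr f" "arr g" "dm f = cd g" "a \<in> Obj M"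
  shows "(f \<star> \<^bold>1 a) \<odot> (g \<star> \<^bold>1 a) = (f \<odot> g) \<star> \<^bold>1 a"
proof -
  have *: "(f \<star> \<^bold>1 a) \<odot> (k \<star> \<^bold>1 a) = (f \<odot> k) \<star> \<^bold>1 a" if "k \<in> Part M p (dm g) (cd g)" for k p
  proof -
    note k = homD[OF part_hom[OF that]]
    show ?thesis
      using tens_comp[of k p "\<^bold>1 a" 0 f "\<^bold>1 a"] that id_part[OF assms(4)] assms k by (simp add: calc sign_def)
  qed
  obtain g0 g1 where g: "g = g0 \<^bold>+ g1" "g0 \<in> Part M 0 (dm g) (cd g)" "g1 \<in> Part M 1 (dm g) (cd g)"
    using hom_parts[OF assms(2)] by blast
  note t = homD[OF part_hom[OF g(2)]] homD[OF part_hom[OF g(3)]]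
  show ?thesis
    using t assms(1,3,4) *[OF g(2)] *[OF g(3)] by (subst (1 2) g(1)) (simp add: calc)
qed

lemma comp_whisker_left:
  assumes "arr f" "arr g" "dm f = cd g" "a \<in> Obj M"
  shows "(\<^bold>1 a \<star> f) \<odot> (\<^bold>1 a \<star> g) = \<^bold>1 a \<star> (f \<odot> g)"
proof -
  have *: "(\<^bold>1 a \<star> k) \<odot> (\<^bold>1 a \<star> g) = \<^bold>1 a \<star> (k \<odot> g)" if "k \<in> Part M p (dm f) (cd f)" for k p
  proof -
    note k = homD[OF part_hom[OF that]]
    show ?thesis
      using tens_comp[of "\<^bold>1 a" 0 k p "\<^bold>1 a" g] that id_part[OF assms(4)] assms k by (simp add: calc sign_def)
  qed
  obtain f0 f1 where f: "f = f0 \<^bold>+ f1" "f0 \<in> Part M 0 (dm f) (cd f)" "f1 \<in> Part M 1 (dm f) (cd f)"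
    using hom_parts[OF assms(1)] by blast
  note t = homD[OF part_hom[OF f(2)]] homD[OF part_hom[OF f(3)]]
  show ?thesis
    using t assms(2-4) *[OF f(2)] *[OF f(3)] by (subst (1 2) f(1)) (simp add: calc)
qed

lemma tens_left_first:
  assumes "arr f" "arr g" "a = cd g" "b = dm f"
  shows "(f \<star> \<^bold>1 a) \<odot> (\<^bold>1 b \<star> g) = f \<star> g"
proof -
  have "\<^bold>1 b \<in> Part M 0 (dm (\<^bold>1 b)) (cd (\<^bold>1 b))" "\<^bold>1 a \<in> Part M 0 (dm (\<^bold>1 a)) (cd (\<^bold>1 a))"
    using id_part assms by simp_all
  from tens_comp[OF this assms(1,2)]
  have "(f \<star> \<^bold>1 a) \<odot> (\<^bold>1 b \<star> g) = sign (0 * 0) \<^bold>* ((f \<odot> \<^bold>1 b) \<star> (\<^bold>1 a \<odot> g))"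
    using assms by simp
  also have "\<dots> = f \<star> g" using assms by (simp add: calc sign_def)
  finally show ?thesis .
qed

lemma tens_right_first:
  assumes f: "f \<in> Part M p b c" and g: "g \<in> Part M q b' c'"
  shows "(\<^bold>1 c \<star> g) \<odot> (f \<star> \<^bold>1 b') = sign (p * q) \<^bold>* (f \<star> g)"
proof -
  note h = homD[OF part_hom[OF f]] homD[OF part_hom[OF g]]
  show ?thesis
    using tens_comp[of f p g q "\<^bold>1 c" "\<^bold>1 b'"] f g h arr_obj[of f] arr_obj[of g] by (simp add: calc)
qed

lemma exchange:
  assumes f: "f \<in> Part M p b c" and g: "g \<in> Part M q b' c'"
  shows "(\<^bold>1 c \<star> g) \<odot> (f \<star> \<^bold>1 b') = sign (p * q) \<^bold>* ((f \<star> \<^bold>1 c') \<odot> (\<^bold>1 b \<star> g))"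
  using tens_right_first[OF f g] tens_left_first[of f g c' b] homD[OF part_hom[OF f]] homD[OF part_hom[OF g]]
  by simp

end

text \<open>Homomorphisms from presented superalgebras to endomorphism algebras. They transport identities
  that are proved by rewriting in a ring type.\<close>

primrec feval :: "('k list, 'm) smcat \<Rightarrow> 'k list \<Rightarrow> ('g \<Rightarrow> 'm) \<Rightarrow> 'g fa \<Rightarrow> 'm" where
  "feval M a \<rho> (Gen g) = \<rho> g"
| "feval M a \<rho> One = Ident M a"
| "feval M a \<rho> Zero = ZeroM M a a"
| "feval M a \<rho> (Plus s t) = Add M (feval M a \<rho> s) (feval M a \<rho> t)"
| "feval M a \<rho> (Times s t) = Comp M (feval M a \<rho> s) (feval M a \<rho> t)"
| "feval M a \<rho> (Scale z t) = Scal M z (feval M a \<rho> t)"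

definition aeval :: "('k list, 'm) smcat \<Rightarrow> 'k list \<Rightarrow> ('g::presentation \<Rightarrow> 'm) \<Rightarrow> 'g salg \<Rightarrow> 'm" where
  "aeval M a \<rho> x = feval M a \<rho> (rep_salg x)"

lemma (in word_supercategory) aeval:
  fixes \<rho> :: "'g::presentation \<Rightarrow> 'm"
  assumes a: "a \<in> Obj M" and \<rho>: "\<And>g. \<rho> g \<in> Hom M a a"
    and rel: "\<And>s t. gen_rel s t \<Longrightarrow> feval M a \<rho> s = feval M a \<rho> t"
  shows "arr (aeval M a \<rho> x)" "dm (aeval M a \<rho> x) = a" "cd (aeval M a \<rho> x) = a"
    and "aeval M a \<rho> (sgen g) = \<rho> g"
    and "aeval M a \<rho> 1 = \<^bold>1 a"
    and "aeval M a \<rho> 0 = ZeroM M a a"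
    and "aeval M a \<rho> (x + y) = aeval M a \<rho> x \<^bold>+ aeval M a \<rho> y"
    and "aeval M a \<rho> (x * y) = aeval M a \<rho> x \<odot> aeval M a \<rho> y"
    and "aeval M a \<rho> (csc z x) = z \<^bold>* aeval M a \<rho> x"
proof -
  have hom: "feval M a \<rho> t \<in> Hom M a a" for t
    by (induction t) (use \<rho> a in \<open>auto intro: zero_hom add_hom scal_hom comp_hom part_hom id_part\<close>)
  note h = hom[THEN homD(1)] hom[THEN homD(2)] hom[THEN homD(3)]
  have wd: "feval M a \<rho> s = feval M a \<rho> t" if "fa_eq s t" for s t
    using that
  proof induction
    case (fa_rel s t)
    then show ?case by (rule rel)
  next
    case (fa_plus_assoc s t u)
    then show ?case by (simp add: add_assoc[OF hom hom hom])
  next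
    case (fa_plus_comm s t)
    then show ?case by (simp add: add_comm[OF hom hom])
  next
    case (fa_plus_zero t)
    then show ?case using add_zero[OF hom[of t]] add_comm[OF hom[of t] zero_hom[OF a a]] by simp
  next
    case (fa_plus_neg t)
    then show ?case using add_neg[OF hom[of t]] add_comm[OF hom[of t] scal_hom[OF hom[of t]], of "-1"] by simp
  next
    case (fa_plus_scale z z' t)
    then show ?case by (simp add: add_scal[OF hom])
  qed (simp_all add: calc h a)
  have abs: "aeval M a \<rho> (abs_salg t) = feval M a \<rho> t" for t
    unfolding aeval_def by (rule wd) (rule fa_rep_abs)
  obtain s t where st: "x = abs_salg s" "y = abs_salg t"
    by (metis Quotient3_abs_rep Quotient3_salg)
  show "arr (aeval M a \<rho> x)" "dm (aeval M a \<rho> x) = a" "cd (aeval M a \<rho> x) = a"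
    by (simp_all add: aeval_def h)
  show "aeval M a \<rho> (sgen g) = \<rho> g" "aeval M a \<rho> 1 = \<^bold>1 a" "aeval M a \<rho> 0 = ZeroM M a a"
    by (simp_all add: sgen.abs_eq zero_salg_def one_salg_def abs)
  show "aeval M a \<rho> (x + y) = aeval M a \<rho> x \<^bold>+ aeval M a \<rho> y"
    "aeval M a \<rho> (x * y) = aeval M a \<rho> x \<odot> aeval M a \<rho> y"
    "aeval M a \<rho> (csc z x) = z \<^bold>* aeval M a \<rho> x"
    by (simp_all only: st plus_salg.abs_eq times_salg.abs_eq csc.abs_eq abs feval.simps)
qed

section \<open>Tokens, dots and pins\<close>

text \<open>What the two supercategories share: a strand \<open>i\<close> with its token \<open>C\<close>, pins \<open>p j\<close> with the morphisms
  that carry the strand past them, and an even dot \<open>X\<close>. Where the given dot \<open>x\<close> is odd, \<open>X\<close> is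
  \<open>w C x\<close>. The parameter \<open>q\<close> gives the polynomial in \<open>x\<close> that belongs to a pin.\<close>

locale affine_frame = word_supercategory M
  for M :: "('k list, 'm) smcat" +
  fixes w :: complex and i :: 'k and J :: "'j set" and p :: "'j \<Rightarrow> 'k" and q :: "'j \<Rightarrow> unit polcl"
    and C X :: 'm and R L :: "'j \<Rightarrow> 'm"
  assumes w: "w\<^sup>2 = -2"
    and i_obj [simp]: "[i] \<in> Obj M" and p_obj [simp]: "j \<in> J \<Longrightarrow> [p j] \<in> Obj M"
    and C_part: "C \<in> Part M 1 [i] [i]" and X_part: "X \<in> Part M 0 [i] [i]"
    and R_part: "j \<in> J \<Longrightarrow> R j \<in> Part M 0 [p j, i] [i, p j]"
    and L_part: "j \<in> J \<Longrightarrow> L j \<in> Part M 0 [i, p j] [p j, i]"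
    and CC: "C \<odot> C = \<^bold>1 [i]" and CX: "C \<odot> X = (-1) \<^bold>* (X \<odot> C)"
    and L_slide: "j \<in> J \<Longrightarrow> Y \<in> {C, X} \<Longrightarrow> L j \<odot> (Y \<star> \<^bold>1 [p j]) = (\<^bold>1 [p j] \<star> Y) \<odot> L j"
    and R_slide: "j \<in> J \<Longrightarrow> Y \<in> {C, X} \<Longrightarrow> R j \<odot> (\<^bold>1 [p j] \<star> Y) = (Y \<star> \<^bold>1 [p j]) \<odot> R j"
begin

lemmas CX_typing [simp] = homD[OF part_hom[OF C_part]] homD[OF part_hom[OF X_part]]
lemmas RL_typing [simp] = homD[OF part_hom[OF R_part]] homD[OF part_hom[OF L_part]]

definition ev1 :: "unit polcl \<Rightarrow> 'm" where
  "ev1 = aeval M [i] (\<lambda>g. case g of PCc _ \<Rightarrow> C | PCx _ \<Rightarrow> X)"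

lemma ev1_rel:
  "gen_rel s t \<Longrightarrow> feval M [i] (\<lambda>g. case g of PCc (_ :: unit) \<Rightarrow> C | PCx _ \<Rightarrow> X) s =
    feval M [i] (\<lambda>g. case g of PCc _ \<Rightarrow> C | PCx _ \<Rightarrow> X) t"
  by (erule gen_rel_polcl_gen.cases) (auto simp: CC CX)

lemma ev1_gen: "(case g of PCc (_ :: unit) \<Rightarrow> C | PCx _ \<Rightarrow> X) \<in> Hom M [i] [i]"
  by (cases g) (simp_all add: hom_iff)

lemmas ev1 [simp] = aeval[OF i_obj ev1_gen ev1_rel, folded ev1_def]

text \<open>Tokens and dots on the two outer strands of the word \<open>i u i\<close>. The cases of interest are that \<open>u\<close>
  is empty, a strand, or a pin.\<close>

definition ends :: "'k list \<Rightarrow> two polcl_gen \<Rightarrow> 'm" where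
  "ends u g = (case g of
     PCc First \<Rightarrow> C \<star> \<^bold>1 (u @ [i]) | PCc Second \<Rightarrow> \<^bold>1 (i # u) \<star> C
   | PCx First \<Rightarrow> X \<star> \<^bold>1 (u @ [i]) | PCx Second \<Rightarrow> \<^bold>1 (i # u) \<star> X)"

definition ev :: "'k list \<Rightarrow> two polcl \<Rightarrow> 'm" where
  "ev u = aeval M (i # u @ [i]) (ends u)"

lemma words [simp]:
  assumes "u \<in> Obj M"
  shows "i # u \<in> Obj M" "u @ [i] \<in> Obj M" "i # u @ [i] \<in> Obj M"
  using append_obj[of "[i]" u] append_obj[of u "[i]"] append_obj[of "[i]" "u @ [i]"] assms by simp_all

lemma ends_hom: "u \<in> Obj M \<Longrightarrow> ends u g \<in> Hom M (i # u @ [i]) (i # u @ [i])"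
  by (auto simp: hom_iff ends_def split: polcl_gen.split two.split)

lemma ends_rel:
  assumes u: "u \<in> Obj M" and "gen_rel s t"
  shows "feval M (i # u @ [i]) (ends u) s = feval M (i # u @ [i]) (ends u) t"
proof -
  have ex: "(\<^bold>1 (i # u) \<star> g) \<odot> (f \<star> \<^bold>1 (u @ [i])) = sign (r * s) \<^bold>* ((f \<star> \<^bold>1 (u @ [i])) \<odot> (\<^bold>1 (i # u) \<star> g))"
    if f: "f \<in> Part M r [i] [i]" and g: "g \<in> Part M s [i] [i]" for f g r s
  proof -
    have id: "\<^bold>1 u \<in> Part M 0 u u" using u by (rule id_part)
    have g': "\<^bold>1 u \<star> g \<in> Part M s (u @ [i]) (u @ [i])"
      using tens_part[OF id g] by (simp only: tens_words add_0)
    have e: "\<^bold>1 (i # u) \<star> g = \<^bold>1 [i] \<star> (\<^bold>1 u \<star> g)"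
      using u homD[OF part_hom[OF g]] by (simp add: calc)
    show ?thesis unfolding e by (rule exchange[OF f g'])
  qed
  note exs = ex[OF C_part C_part] ex[OF C_part X_part] ex[OF X_part C_part] ex[OF X_part X_part]
  show ?thesis
    using assms(2)
  proof (cases rule: gen_rel_polcl_gen.cases)
    case (1 k)
    then show ?thesis using u
      by (cases k) (simp_all add: ends_def comp_whisker_left comp_whisker_right CC calc)
  next
    case (2 k)
    then show ?thesis using u
      by (cases k) (simp_all add: ends_def comp_whisker_left comp_whisker_right CX calc)
  next
    case (3 k l)
    then show ?thesis using u
      by (cases k; cases l) (simp_all add: ends_def exs sign_def calc)
  next
    case (4 k l)
    then show ?thesis using u
      by (cases k; cases l) (simp_all add: ends_def exs sign_def calc)
  next
    case (5 k l)
    then show ?thesis using u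
      by (cases k; cases l) (simp_all add: ends_def exs sign_def calc)
  qed
qed

lemmas ev = aeval[of "i # u @ [i]" "ends u" for u, OF words(3) ends_hom ends_rel, folded ev_def]

lemma ev_gen [simp]:
  assumes "u \<in> Obj M"
  shows "ev u (pcc First) = C \<star> \<^bold>1 (u @ [i])" "ev u (pcc Second) = \<^bold>1 (i # u) \<star> C"
    "ev u (pcx First) = X \<star> \<^bold>1 (u @ [i])" "ev u (pcx Second) = \<^bold>1 (i # u) \<star> X"
  using ev(4)[OF assms assms assms] by (simp_all add: ends_def)

lemma ev_typing [simp]:
  assumes "u \<in> Obj M"
  shows "arr (ev u a)" "dm (ev u a) = i # u @ [i]" "cd (ev u a) = i # u @ [i]"
  using ev(1-3)[OF assms assms assms] by simp_all

lemma ev_hom: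
  assumes "u \<in> Obj M"
  shows "ev u 1 = \<^bold>1 (i # u @ [i])" "ev u 0 = ZeroM M (i # u @ [i]) (i # u @ [i])"
    "ev u (a + b) = ev u a \<^bold>+ ev u b" "ev u (a * b) = ev u a \<odot> ev u b"
    "ev u (csc z a) = z \<^bold>* ev u a"
  using ev(5-9)[OF assms assms assms] by simp_all

end

context word_supercategory
begin

lemma uminus_add_cancel:
  assumes "g \<in> Hom M a b" "h \<in> Hom M a b"
  shows "(-1) \<^bold>* g \<^bold>+ (g \<^bold>+ h) = h"
proof -
  have g': "(-1) \<^bold>* g \<in> Hom M a b" by (rule scal_hom) fact
  have z: "ZeroM M a b \<in> Hom M a b" using hom_obj[OF assms(1)] by (intro zero_hom) auto
  have "(-1) \<^bold>* g \<^bold>+ (g \<^bold>+ h) = (g \<^bold>+ (-1) \<^bold>* g) \<^bold>+ h"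
    using add_assoc[OF g' assms] add_comm[OF g' assms(1)] by simp
  also have "\<dots> = h"
    using add_neg[OF assms(1)] add_comm[OF z assms(2)] add_zero[OF assms(2)] by simp
  finally show ?thesis .
qed

lemma add_uminus_cancel:
  assumes "f \<in> Hom M a b" "g \<in> Hom M a b" "h \<in> Hom M a b"
  shows "(f \<^bold>+ (-1) \<^bold>* g) \<^bold>+ (g \<^bold>+ h) = f \<^bold>+ h"
  using add_assoc[OF assms(1) scal_hom[OF assms(2)] add_hom[OF assms(2,3)]]
    uminus_add_cancel[OF assms(2,3)] by simp

lemma add_eq_iff:
  assumes "f \<in> Hom M a b" "g \<in> Hom M a b" "f \<^bold>+ g = h"
  shows "f = h \<^bold>+ (-1) \<^bold>* g"
proof -
  have g': "(-1) \<^bold>* g \<in> Hom M a b" by (rule scal_hom) fact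
  have "h \<^bold>+ (-1) \<^bold>* g = f \<^bold>+ (g \<^bold>+ (-1) \<^bold>* g)"
    using add_assoc[OF assms(1,2) g'] assms(3) by simp
  then show ?thesis using add_neg[OF assms(2)] add_zero[OF assms(1)] by simp
qed

lemma comp_extend:
  assumes "f \<odot> g = h \<odot> k" "f \<in> Hom M b c" "g \<in> Hom M a b" "h \<in> Hom M b' c" "k \<in> Hom M a b'"
    and "x \<in> Hom M d a"
  shows "f \<odot> g \<odot> x = h \<odot> k \<odot> x"
  using comp_assoc[OF assms(2,3,6)] comp_assoc[OF assms(4,5,6)] assms(1) by simp

lemma comp_extend_scal:
  assumes "f \<odot> g = z \<^bold>* h" "f \<in> Hom M b c" "g \<in> Hom M a b" "h \<in> Hom M a c" "x \<in> Hom M d a"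
  shows "f \<odot> g \<odot> x = z \<^bold>* (h \<odot> x)"
  using comp_assoc[OF assms(2,3,5)] comp_scal_left[OF assms(4,5)] assms(1) by simp

lemma comp_extend_id:
  assumes "f \<odot> g = z \<^bold>* \<^bold>1 a" "f \<in> Hom M b a" "g \<in> Hom M a b" "arr x" "cd x = a"
  shows "f \<odot> g \<odot> x = z \<^bold>* x"
  using comp_extend_scal[OF assms(1-3) part_hom[OF id_part] arr_hom[OF assms(4), unfolded assms(5)]]
    hom_obj[OF assms(2)] assms(4,5) by (simp add: calc)

text \<open>Put \<open>s = u + v\<close>. Moving the crossings to the right gives \<open>u s v\<close> and \<open>v s u\<close> in front of the two
  sides of the braid relation, and both are \<open>2 (u + v)\<close>.\<close>

lemma commuting_braid:
  assumes E: "u \<in> Hom M a a" "v \<in> Hom M a a" "t \<in> Hom M a a" "t' \<in> Hom M a a"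
    and sq: "u \<odot> u = 2 \<^bold>* \<^bold>1 a" "v \<odot> v = 2 \<^bold>* \<^bold>1 a" "t \<odot> t = \<^bold>1 a" "t' \<odot> t' = \<^bold>1 a"
    and tv: "t \<odot> v = (u \<^bold>+ v) \<odot> t" and tu: "t' \<odot> u = (u \<^bold>+ v) \<odot> t'"
    and braid: "t \<odot> t' \<odot> t = t' \<odot> t \<odot> t'"
  shows "(u \<odot> t) \<odot> (v \<odot> t') \<odot> (u \<odot> t) = (v \<odot> t') \<odot> (u \<odot> t) \<odot> (v \<odot> t')"
proof -
  define s where "s = u \<^bold>+ v"
  have s: "s \<in> Hom M a a" unfolding s_def using E by (intro add_hom)
  have a: "a \<in> Obj M" using hom_obj[OF E(1)] ..
  note h [simp] = E(1)[unfolded hom_iff] E(2)[unfolded hom_iff] E(3)[unfolded hom_iff]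
    E(4)[unfolded hom_iff] s[unfolded hom_iff] a
  note tv = tv[folded s_def] and tu = tu[folded s_def]
  have sq1: "t \<odot> t = 1 \<^bold>* \<^bold>1 a" "t' \<odot> t' = 1 \<^bold>* \<^bold>1 a" using sq by (simp_all add: calc)
  have ext: "t \<odot> v \<odot> x = s \<odot> t \<odot> x" "t' \<odot> u \<odot> x = s \<odot> t' \<odot> x"
    "t \<odot> t \<odot> x = x" "t' \<odot> t' \<odot> x = x" "u \<odot> u \<odot> x = 2 \<^bold>* x" "v \<odot> v \<odot> x = 2 \<^bold>* x"
    if "arr x" "cd x = a" for x
  proof -
    have x: "x \<in> Hom M (dm x) a" using that by (simp add: hom_iff)
    show "t \<odot> v \<odot> x = s \<odot> t \<odot> x" using comp_extend[OF tv E(3,2) s E(3) x] .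
    show "t' \<odot> u \<odot> x = s \<odot> t' \<odot> x" using comp_extend[OF tu E(4,1) s E(4) x] .
    show "t \<odot> t \<odot> x = x" "t' \<odot> t' \<odot> x = x"
      using comp_extend_id[OF sq1(1) E(3,3) that] comp_extend_id[OF sq1(2) E(4,4) that] that
      by (simp_all add: calc)
    show "u \<odot> u \<odot> x = 2 \<^bold>* x" "v \<odot> v \<odot> x = 2 \<^bold>* x"
      using comp_extend_id[OF sq(1) E(1,1) that] comp_extend_id[OF sq(2) E(2,2) that] .
  qed
  have "t \<odot> s = t \<odot> (s \<odot> t) \<odot> t" using sq by (simp add: calc)
  also have "\<dots> = t \<odot> (t \<odot> v) \<odot> t" by (simp only: tv)
  also have "\<dots> = v \<odot> t" by (simp add: calc ext(3))
  finally have ts: "t \<odot> s = v \<odot> t" .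
  have "t' \<odot> s = t' \<odot> (s \<odot> t') \<odot> t'" using sq by (simp add: calc)
  also have "\<dots> = t' \<odot> (t' \<odot> u) \<odot> t'" by (simp only: tu)
  also have "\<dots> = u \<odot> t'" by (simp add: calc ext(4))
  finally have ts': "t' \<odot> s = u \<odot> t'" .
  have ext': "t \<odot> s \<odot> x = v \<odot> t \<odot> x" "t' \<odot> s \<odot> x = u \<odot> t' \<odot> x" if "arr x" "cd x = a" for x
  proof -
    have x: "x \<in> Hom M (dm x) a" using that by (simp add: hom_iff)
    show "t \<odot> s \<odot> x = v \<odot> t \<odot> x" using comp_extend[OF ts E(3) s E(2,3) x] .
    show "t' \<odot> s \<odot> x = u \<odot> t' \<odot> x" using comp_extend[OF ts' E(4) s E(1,4) x] .
  qed
  have usv: "u \<odot> s \<odot> v = v \<odot> s \<odot> u"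
    unfolding s_def using add_comm[OF scal_hom[OF E(1)] scal_hom[OF E(2)]]
    by (simp add: calc sq ext)
  have "(u \<odot> t) \<odot> (v \<odot> t') \<odot> (u \<odot> t) = u \<odot> s \<odot> v \<odot> t \<odot> t' \<odot> t"
    by (simp add: calc ext ext')
  also have "\<dots> = (u \<odot> s \<odot> v) \<odot> (t' \<odot> t \<odot> t')" by (simp add: calc braid)
  also have "\<dots> = v \<odot> s \<odot> u \<odot> t' \<odot> t \<odot> t'" unfolding usv by (simp add: calc)
  also have "\<dots> = (v \<odot> t') \<odot> (u \<odot> t) \<odot> (v \<odot> t')" by (simp add: calc ext ext')
  finally show ?thesis .
qed

text \<open>Moving the crossings to the right gives \<open>- u v u\<close> and \<open>- v u v\<close> in front of the two sides of the
  braid relation. These agree: the three squares give \<open>u v + v u = -2\<close>.\<close>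

lemma anticommuting_braid:
  assumes E: "u \<in> Hom M a a" "v \<in> Hom M a a" "t \<in> Hom M a a" "t' \<in> Hom M a a"
    and sq: "u \<odot> u = 2 \<^bold>* \<^bold>1 a" "v \<odot> v = 2 \<^bold>* \<^bold>1 a" "(u \<^bold>+ v) \<odot> (u \<^bold>+ v) = 2 \<^bold>* \<^bold>1 a"
    and anti: "t \<odot> u = (-1) \<^bold>* (u \<odot> t)" "t \<odot> v = (-1) \<^bold>* (v \<odot> t)"
      "t' \<odot> u = (-1) \<^bold>* (u \<odot> t')" "t' \<odot> v = (-1) \<^bold>* (v \<odot> t')"
    and braid: "t \<odot> t' \<odot> t = t' \<odot> t \<odot> t'"
  shows "(u \<odot> t) \<odot> (v \<odot> t') \<odot> (u \<odot> t) = (v \<odot> t') \<odot> (u \<odot> t) \<odot> (v \<odot> t')"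
proof -
  have a: "a \<in> Obj M" using hom_obj[OF E(1)] ..
  note h [simp] = E(1)[unfolded hom_iff] E(2)[unfolded hom_iff] E(3)[unfolded hom_iff]
    E(4)[unfolded hom_iff] a
  have uvh: "u \<odot> v \<in> Hom M a a" "v \<odot> u \<in> Hom M a a" "\<^bold>1 a \<in> Hom M a a"
    by (rule comp_hom[OF E(1,2)] comp_hom[OF E(2,1)] part_hom[OF id_part[OF a]])+
  have two: "2 \<^bold>* \<^bold>1 a \<in> Hom M a a" by (rule scal_hom) (rule uvh)
  have "(2 \<^bold>* \<^bold>1 a \<^bold>+ v \<odot> u) \<^bold>+ (u \<odot> v \<^bold>+ 2 \<^bold>* \<^bold>1 a) = 2 \<^bold>* \<^bold>1 a"
    using sq by (simp add: calc)
  from add_eq_iff[OF add_hom[OF two uvh(2)] add_hom[OF uvh(1) two] this]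
  have "(-1) \<^bold>* 2 \<^bold>* \<^bold>1 a \<^bold>+ (2 \<^bold>* \<^bold>1 a \<^bold>+ v \<odot> u) =
      (-1) \<^bold>* 2 \<^bold>* \<^bold>1 a \<^bold>+ (2 \<^bold>* \<^bold>1 a \<^bold>+ (-1) \<^bold>* (u \<odot> v \<^bold>+ 2 \<^bold>* \<^bold>1 a))"
    by simp
  then have "v \<odot> u = (-1) \<^bold>* (u \<odot> v \<^bold>+ 2 \<^bold>* \<^bold>1 a)"
    unfolding uminus_add_cancel[OF two uvh(2)] uminus_add_cancel[OF two scal_hom[OF add_hom[OF uvh(1) two]]] .
  then have vu: "v \<odot> u = (-1) \<^bold>* (u \<odot> v) \<^bold>+ (-2) \<^bold>* \<^bold>1 a" by (simp add: calc)
  have ext: "t \<odot> u \<odot> x = (-1) \<^bold>* (u \<odot> t \<odot> x)" "t \<odot> v \<odot> x = (-1) \<^bold>* (v \<odot> t \<odot> x)"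
    "t' \<odot> u \<odot> x = (-1) \<^bold>* (u \<odot> t' \<odot> x)" "t' \<odot> v \<odot> x = (-1) \<^bold>* (v \<odot> t' \<odot> x)"
    "u \<odot> u \<odot> x = 2 \<^bold>* x" "v \<odot> v \<odot> x = 2 \<^bold>* x"
    if "arr x" "cd x = a" for x
  proof -
    have x: "x \<in> Hom M (dm x) a" using that by (simp add: hom_iff)
    show "t \<odot> u \<odot> x = (-1) \<^bold>* (u \<odot> t \<odot> x)" "t \<odot> v \<odot> x = (-1) \<^bold>* (v \<odot> t \<odot> x)"
      "t' \<odot> u \<odot> x = (-1) \<^bold>* (u \<odot> t' \<odot> x)" "t' \<odot> v \<odot> x = (-1) \<^bold>* (v \<odot> t' \<odot> x)"
      using comp_extend_scal[OF anti(1) E(3,1) comp_hom[OF E(1,3)] x]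
        comp_extend_scal[OF anti(2) E(3,2) comp_hom[OF E(2,3)] x]
        comp_extend_scal[OF anti(3) E(4,1) comp_hom[OF E(1,4)] x]
        comp_extend_scal[OF anti(4) E(4,2) comp_hom[OF E(2,4)] x] that
      by (simp_all add: calc)
    show "u \<odot> u \<odot> x = 2 \<^bold>* x" "v \<odot> v \<odot> x = 2 \<^bold>* x"
      using comp_extend_id[OF sq(1) E(1,1) that] comp_extend_id[OF sq(2) E(2,2) that] .
  qed
  have "u \<odot> v \<odot> u = (-2) \<^bold>* v \<^bold>+ (-2) \<^bold>* u" unfolding vu by (simp add: calc ext)
  also have "\<dots> = (v \<odot> u) \<odot> v"
    unfolding vu by (simp add: calc sq add_comm[OF scal_hom[OF E(1)] scal_hom[OF E(2)]])
  also have "\<dots> = v \<odot> u \<odot> v" by (simp add: calc)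
  finally have uvu: "u \<odot> v \<odot> u = v \<odot> u \<odot> v" .
  have "(u \<odot> t) \<odot> (v \<odot> t') \<odot> (u \<odot> t) = (-1) \<^bold>* ((u \<odot> v \<odot> u) \<odot> (t \<odot> t' \<odot> t))"
    by (simp add: calc ext)
  also have "\<dots> = (-1) \<^bold>* ((v \<odot> u \<odot> v) \<odot> (t' \<odot> t \<odot> t'))"
    by (simp only: uvu braid)
  also have "\<dots> = (v \<odot> t') \<odot> (u \<odot> t) \<odot> (v \<odot> t')" by (simp add: calc ext)
  finally show ?thesis .
qed

definition algebra_rep :: "('g::presentation salg \<Rightarrow> 'm) \<Rightarrow> 'k list \<Rightarrow> bool" where
  "algebra_rep \<Phi> a \<longleftrightarrow> a \<in> Obj M \<and> (\<forall>x. \<Phi> x \<in> Hom M a a) \<and> \<Phi> 1 = \<^bold>1 a \<and>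
     (\<forall>x y. \<Phi> (x + y) = \<Phi> x \<^bold>+ \<Phi> y) \<and> (\<forall>x y. \<Phi> (x * y) = \<Phi> x \<odot> \<Phi> y) \<and>
     (\<forall>z x. \<Phi> (csc z x) = z \<^bold>* \<Phi> x)"

text \<open>A morphism that intertwines the generators intertwines two representations of the algebra.
  Below, this moves polynomials in tokens and dots past pins.\<close>

lemma intertwine:
  fixes \<Phi> \<Psi> :: "'g::presentation salg \<Rightarrow> 'm"
  assumes \<Phi>: "algebra_rep \<Phi> a" and \<Psi>: "algebra_rep \<Psi> b" and N: "N \<in> Hom M b a"
    and gen: "\<And>g. N \<odot> \<Psi> (sgen g) = \<Phi> (sgen g) \<odot> N"
  shows "N \<odot> \<Psi> x = \<Phi> x \<odot> N"
proof -
  have t [simp]: "arr (\<Phi> x)" "dm (\<Phi> x) = a" "cd (\<Phi> x) = a" "arr (\<Psi> x)" "dm (\<Psi> x) = b" "cd (\<Psi> x) = b"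
    "arr N" "dm N = b" "cd N = a" for x
    using \<Phi> \<Psi> N unfolding algebra_rep_def hom_iff by blast+
  have simps: "\<Phi> 1 = \<^bold>1 a" "\<Psi> 1 = \<^bold>1 b" "\<Phi> (x + y) = \<Phi> x \<^bold>+ \<Phi> y" "\<Psi> (x + y) = \<Psi> x \<^bold>+ \<Psi> y"
    "\<Phi> (x * y) = \<Phi> x \<odot> \<Phi> y" "\<Psi> (x * y) = \<Psi> x \<odot> \<Psi> y"
    "\<Phi> (csc z x) = z \<^bold>* \<Phi> x" "\<Psi> (csc z x) = z \<^bold>* \<Psi> x" for x y z
    using \<Phi> \<Psi> unfolding algebra_rep_def by blast+
  have one: "N \<odot> \<Psi> 1 = \<Phi> 1 \<odot> N" by (simp add: simps calc)
  have scale: "N \<odot> \<Psi> x = \<Phi> x \<odot> N \<Longrightarrow> N \<odot> \<Psi> (csc z x) = \<Phi> (csc z x) \<odot> N" for z x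
    by (simp add: simps calc)
  show ?thesis
  proof (induction x rule: salg_induct)
    case zero
    show ?case using scale[OF one, of 0] by simp
  next
    case (times x y)
    have "N \<odot> \<Psi> (x * y) = (N \<odot> \<Psi> x) \<odot> \<Psi> y" by (simp add: simps calc)
    also have "\<dots> = \<Phi> x \<odot> (N \<odot> \<Psi> y)" by (simp add: times(1) calc)
    also have "\<dots> = \<Phi> (x * y) \<odot> N" by (simp add: times(2) simps calc)
    finally show ?case .
  next
    case (plus x y)
    then show ?case by (simp add: simps calc)
  qed (fact gen one scale)+
qed

end

lemma (in word_supercategory) algebra_rep_whisker:
  assumes "algebra_rep \<Phi> a" "b \<in> Obj M"
  shows "algebra_rep (\<lambda>x. \<^bold>1 b \<star> \<Phi> x) (b @ a)" "algebra_rep (\<lambda>x. \<Phi> x \<star> \<^bold>1 b) (a @ b)"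
  using assms unfolding algebra_rep_def hom_iff
  by (simp_all add: append_obj calc comp_whisker_left comp_whisker_right)

lemma csc_2: "csc 2 a = a + a"
  using csc_plus[of 1 1 a] by simp

lemma cdiff_square: "cdiff * cdiff = csc 2 1"
  by (simp add: algebra_simps pcx_move csc_2)

context affine_frame
begin

lemma ev_rep: "u \<in> Obj M \<Longrightarrow> algebra_rep (ev u) (i # u @ [i])"
  unfolding algebra_rep_def by (simp add: hom_iff ev_hom)

lemma token_dot:
  assumes "Y \<in> {C, X}"
  obtains r where "Y \<in> Part M r [i] [i]" "arr Y" "dm Y = [i]" "cd Y = [i]"
  using assms C_part X_part homD[OF part_hom[OF C_part]] homD[OF part_hom[OF X_part]] by blast

lemma pass_pin:
  assumes j [simp]: "j \<in> J" and Y: "Y \<in> {C, X}"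
  shows "(R j \<star> \<^bold>1 [i]) \<odot> (\<^bold>1 [p j] \<star> Y \<star> \<^bold>1 [i]) = (Y \<star> \<^bold>1 [p j, i]) \<odot> (R j \<star> \<^bold>1 [i])"
    and "(R j \<star> \<^bold>1 [i]) \<odot> (\<^bold>1 [p j, i] \<star> Y) = (\<^bold>1 [i, p j] \<star> Y) \<odot> (R j \<star> \<^bold>1 [i])"
    and "(\<^bold>1 [i] \<star> L j) \<odot> (Y \<star> \<^bold>1 [i, p j]) = (Y \<star> \<^bold>1 [p j, i]) \<odot> (\<^bold>1 [i] \<star> L j)"
    and "(\<^bold>1 [i] \<star> L j) \<odot> (\<^bold>1 [i] \<star> Y \<star> \<^bold>1 [p j]) = (\<^bold>1 [i, p j] \<star> Y) \<odot> (\<^bold>1 [i] \<star> L j)"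
    and "(\<^bold>1 [i] \<star> R j) \<odot> (Y \<star> \<^bold>1 [p j, i]) = (Y \<star> \<^bold>1 [i, p j]) \<odot> (\<^bold>1 [i] \<star> R j)"
    and "(\<^bold>1 [i] \<star> R j) \<odot> (\<^bold>1 [i, p j] \<star> Y) = (\<^bold>1 [i] \<star> Y \<star> \<^bold>1 [p j]) \<odot> (\<^bold>1 [i] \<star> R j)"
    and "(L j \<star> \<^bold>1 [i]) \<odot> (Y \<star> \<^bold>1 [p j, i]) = (\<^bold>1 [p j] \<star> Y \<star> \<^bold>1 [i]) \<odot> (L j \<star> \<^bold>1 [i])"
    and "(L j \<star> \<^bold>1 [i]) \<odot> (\<^bold>1 [i, p j] \<star> Y) = (\<^bold>1 [p j, i] \<star> Y) \<odot> (L j \<star> \<^bold>1 [i])"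
proof -
  obtain r where r: "Y \<in> Part M r [i] [i]" and [simp]: "arr Y" "dm Y = [i]" "cd Y = [i]"
    using token_dot[OF Y] .
  note e = exchange[OF R_part[OF j] r, simplified] exchange[OF L_part[OF j] r, simplified]
    exchange[OF r R_part[OF j], simplified] exchange[OF r L_part[OF j], simplified]
  have "(R j \<star> \<^bold>1 [i]) \<odot> ((\<^bold>1 [p j] \<star> Y) \<star> \<^bold>1 [i]) = ((Y \<star> \<^bold>1 [p j]) \<star> \<^bold>1 [i]) \<odot> (R j \<star> \<^bold>1 [i])"
    by (simp add: comp_whisker_right R_slide[OF j Y])
  then show "(R j \<star> \<^bold>1 [i]) \<odot> (\<^bold>1 [p j] \<star> Y \<star> \<^bold>1 [i]) = (Y \<star> \<^bold>1 [p j, i]) \<odot> (R j \<star> \<^bold>1 [i])"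
    by (simp add: calc)
  have "(\<^bold>1 [i] \<star> L j) \<odot> (\<^bold>1 [i] \<star> (Y \<star> \<^bold>1 [p j])) = (\<^bold>1 [i] \<star> (\<^bold>1 [p j] \<star> Y)) \<odot> (\<^bold>1 [i] \<star> L j)"
    by (simp add: comp_whisker_left L_slide[OF j Y])
  then show "(\<^bold>1 [i] \<star> L j) \<odot> (\<^bold>1 [i] \<star> Y \<star> \<^bold>1 [p j]) = (\<^bold>1 [i, p j] \<star> Y) \<odot> (\<^bold>1 [i] \<star> L j)"
    by (simp add: calc)
  have "(\<^bold>1 [i] \<star> R j) \<odot> (\<^bold>1 [i] \<star> (\<^bold>1 [p j] \<star> Y)) = (\<^bold>1 [i] \<star> (Y \<star> \<^bold>1 [p j])) \<odot> (\<^bold>1 [i] \<star> R j)"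
    by (simp add: comp_whisker_left R_slide[OF j Y])
  then show "(\<^bold>1 [i] \<star> R j) \<odot> (\<^bold>1 [i, p j] \<star> Y) = (\<^bold>1 [i] \<star> Y \<star> \<^bold>1 [p j]) \<odot> (\<^bold>1 [i] \<star> R j)"
    by (simp add: calc)
  have "(L j \<star> \<^bold>1 [i]) \<odot> ((Y \<star> \<^bold>1 [p j]) \<star> \<^bold>1 [i]) = ((\<^bold>1 [p j] \<star> Y) \<star> \<^bold>1 [i]) \<odot> (L j \<star> \<^bold>1 [i])"
    by (simp add: comp_whisker_right L_slide[OF j Y])
  then show "(L j \<star> \<^bold>1 [i]) \<odot> (Y \<star> \<^bold>1 [p j, i]) = (\<^bold>1 [p j] \<star> Y \<star> \<^bold>1 [i]) \<odot> (L j \<star> \<^bold>1 [i])"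
    by (simp add: calc)
  show "(R j \<star> \<^bold>1 [i]) \<odot> (\<^bold>1 [p j, i] \<star> Y) = (\<^bold>1 [i, p j] \<star> Y) \<odot> (R j \<star> \<^bold>1 [i])"
    "(L j \<star> \<^bold>1 [i]) \<odot> (\<^bold>1 [i, p j] \<star> Y) = (\<^bold>1 [p j, i] \<star> Y) \<odot> (L j \<star> \<^bold>1 [i])"
    "(\<^bold>1 [i] \<star> L j) \<odot> (Y \<star> \<^bold>1 [i, p j]) = (Y \<star> \<^bold>1 [p j, i]) \<odot> (\<^bold>1 [i] \<star> L j)"
    "(\<^bold>1 [i] \<star> R j) \<odot> (Y \<star> \<^bold>1 [p j, i]) = (Y \<star> \<^bold>1 [i, p j]) \<odot> (\<^bold>1 [i] \<star> R j)"
    using e by (simp_all add: sign_def calc)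
qed

lemma ev_pass_pin:
  assumes j [simp]: "j \<in> J"
  shows "(R j \<star> \<^bold>1 [i]) \<odot> (\<^bold>1 [p j] \<star> ev [] a) = ev [p j] a \<odot> (R j \<star> \<^bold>1 [i])"
    and "(\<^bold>1 [i] \<star> L j) \<odot> (ev [] a \<star> \<^bold>1 [p j]) = ev [p j] a \<odot> (\<^bold>1 [i] \<star> L j)"
    and "(\<^bold>1 [i] \<star> R j) \<odot> ev [p j] a = (ev [] a \<star> \<^bold>1 [p j]) \<odot> (\<^bold>1 [i] \<star> R j)"
    and "(L j \<star> \<^bold>1 [i]) \<odot> ev [p j] a = (\<^bold>1 [p j] \<star> ev [] a) \<odot> (L j \<star> \<^bold>1 [i])"
proof -
  note rep = ev_rep[of "[p j]", simplified] 
    algebra_rep_whisker[OF ev_rep[of "[]", simplified] p_obj[OF j], simplified]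
  have g: "P (sgen g)" if "P (pcc First)" "P (pcc Second)" "P (pcx First)" "P (pcx Second)" for P and g :: "two polcl_gen"
  proof (cases g)
    case (PCc k)
    then show ?thesis using that by (cases k) simp_all
  next
    case (PCx k)
    then show ?thesis using that by (cases k) simp_all
  qed
  note c = pass_pin[OF j, of C, simplified] and x = pass_pin[OF j, of X, simplified]
  show "(R j \<star> \<^bold>1 [i]) \<odot> (\<^bold>1 [p j] \<star> ev [] a) = ev [p j] a \<odot> (R j \<star> \<^bold>1 [i])"
    by (rule intertwine[OF rep(1,2)], simp add: hom_iff, rule g) (simp_all add: calc c x)
  show "(\<^bold>1 [i] \<star> L j) \<odot> (ev [] a \<star> \<^bold>1 [p j]) = ev [p j] a \<odot> (\<^bold>1 [i] \<star> L j)"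
    by (rule intertwine[OF rep(1,3)], simp add: hom_iff, rule g) (simp_all add: calc c x)
  show "(\<^bold>1 [i] \<star> R j) \<odot> ev [p j] a = (ev [] a \<star> \<^bold>1 [p j]) \<odot> (\<^bold>1 [i] \<star> R j)"
    by (rule intertwine[OF rep(3,1)], simp add: hom_iff, rule g) (simp_all add: calc c x)
  show "(L j \<star> \<^bold>1 [i]) \<odot> ev [p j] a = (\<^bold>1 [p j] \<star> ev [] a) \<odot> (L j \<star> \<^bold>1 [i])"
    by (rule intertwine[OF rep(2,1)], simp add: hom_iff, rule g) (simp_all add: calc c x)
qed

text \<open>The two sides of the relation that moves a crossing through a pin.\<close>

definition over_pin :: "'j \<Rightarrow> 'm \<Rightarrow> 'm" where
  "over_pin j T = (R j \<star> \<^bold>1 [i]) \<odot> (\<^bold>1 [p j] \<star> T) \<odot> (L j \<star> \<^bold>1 [i])"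

definition under_pin :: "'j \<Rightarrow> 'm \<Rightarrow> 'm" where
  "under_pin j T = (\<^bold>1 [i] \<star> L j) \<odot> (T \<star> \<^bold>1 [p j]) \<odot> (\<^bold>1 [i] \<star> R j)"

text \<open>The relations of a crossing that do not depend on the kind of crossing; \<open>r\<close> is its parity.\<close>

definition crossing :: "bit \<Rightarrow> 'm \<Rightarrow> bool" where
  "crossing r T \<longleftrightarrow> T \<in> Part M r [i, i] [i, i] \<and> T \<odot> T = \<^bold>1 [i, i] \<and>
    (T \<star> \<^bold>1 [i]) \<odot> (\<^bold>1 [i] \<star> T) \<odot> (T \<star> \<^bold>1 [i]) = (\<^bold>1 [i] \<star> T) \<odot> (T \<star> \<^bold>1 [i]) \<odot> (\<^bold>1 [i] \<star> T) \<and>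
    (\<forall>j\<in>J. (T \<star> \<^bold>1 [p j]) \<odot> (\<^bold>1 [i] \<star> R j) \<odot> (R j \<star> \<^bold>1 [i]) =
        (\<^bold>1 [i] \<star> R j) \<odot> (R j \<star> \<^bold>1 [i]) \<odot> (\<^bold>1 [p j] \<star> T)) \<and>
    (\<forall>j\<in>J. (L j \<star> \<^bold>1 [i]) \<odot> (\<^bold>1 [i] \<star> L j) \<odot> (T \<star> \<^bold>1 [p j]) =
        (\<^bold>1 [p j] \<star> T) \<odot> (L j \<star> \<^bold>1 [i]) \<odot> (\<^bold>1 [i] \<star> L j))"

text \<open>The odd dot.\<close>

definition odot :: 'm where "odot = (1 / w) \<^bold>* (C \<odot> X)"

text \<open>The correction terms are values of \<open>ev\<close>, so no expansion into monomials has to be chosen.\<close>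

definition even_crossing :: "'m \<Rightarrow> bool" where
  "even_crossing T \<longleftrightarrow> crossing 0 T \<and>
    T \<odot> ev [] (pcc First) = ev [] (pcc Second) \<odot> T \<and>
    T \<odot> ev [] (pcx First) = ev [] (pcx Second) \<odot> T \<^bold>+ ev [] (- 1 - pcc First * pcc Second) \<and>
    (\<forall>j\<in>J. over_pin j T = under_pin j T \<^bold>+ ev [p j] (- clifford_demazure (polcl_at1 (q j))))"

definition odd_crossing :: "'m \<Rightarrow> bool" where
  "odd_crossing T \<longleftrightarrow> crossing 1 T \<and>
    T \<odot> ev [] (pcc First) = (-1) \<^bold>* (ev [] (pcc First) \<odot> T) \<and>
    T \<odot> ev [] (pcc Second) = (-1) \<^bold>* (ev [] (pcc Second) \<odot> T) \<and>
    T \<odot> (odot \<star> \<^bold>1 [i]) \<^bold>+ (\<^bold>1 [i] \<star> odot) \<odot> T = \<^bold>1 [i, i] \<and>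
    (\<forall>j\<in>J. over_pin j T = under_pin j T \<^bold>+
      ev [p j] (csc (1 / w) (cdiff * clifford_demazure (polcl_at1 (q j)))))"

text \<open>Tokens and dots on the two strands of the crossing come out on the two outer strands.\<close>

lemma pin_twist:
  assumes j [simp]: "j \<in> J" and T: "T \<in> Hom M [i, i] [i, i]"
  shows "over_pin j (ev [] a \<odot> T) = ev [p j] a \<odot> over_pin j T"
    and "under_pin j (ev [] a \<odot> T) = ev [p j] a \<odot> under_pin j T"
proof -
  note t [simp] = homD[OF T]
  have "over_pin j (ev [] a \<odot> T) = ((R j \<star> \<^bold>1 [i]) \<odot> (\<^bold>1 [p j] \<star> ev [] a)) \<odot> (\<^bold>1 [p j] \<star> T) \<odot> (L j \<star> \<^bold>1 [i])"
    unfolding over_pin_def by (simp add: calc flip: comp_whisker_left)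
  then show "over_pin j (ev [] a \<odot> T) = ev [p j] a \<odot> over_pin j T"
    unfolding ev_pass_pin[OF j] over_pin_def by (simp add: calc)
  have "under_pin j (ev [] a \<odot> T) = ((\<^bold>1 [i] \<star> L j) \<odot> (ev [] a \<star> \<^bold>1 [p j])) \<odot> (T \<star> \<^bold>1 [p j]) \<odot> (\<^bold>1 [i] \<star> R j)"
    unfolding under_pin_def by (simp add: calc flip: comp_whisker_right)
  then show "under_pin j (ev [] a \<odot> T) = ev [p j] a \<odot> under_pin j T"
    unfolding ev_pass_pin[OF j] under_pin_def by (simp add: calc)
qed

lemma pin_typing [simp]:
  assumes "j \<in> J" "T \<in> Hom M [i, i] [i, i]"
  shows "arr (over_pin j T)" "dm (over_pin j T) = [i, p j, i]" "cd (over_pin j T) = [i, p j, i]"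
    "arr (under_pin j T)" "dm (under_pin j T) = [i, p j, i]" "cd (under_pin j T) = [i, p j, i]"
  using assms homD[OF assms(2)] by (simp_all add: over_pin_def under_pin_def)

end

section \<open>Even and odd crossings\<close>

lemma (in word_supercategory) add_cancel_right:
  assumes "f \<in> Hom M a b" "g \<in> Hom M a b"
  shows "(f \<^bold>+ g) \<^bold>+ (-1) \<^bold>* f = g"
  using add_comm[OF add_hom[OF assms] scal_hom[OF assms(1)]] uminus_add_cancel[OF assms] by simp

context affine_frame
begin

lemma ev_minus: "u \<in> Obj M \<Longrightarrow> ev u (a - b) = ev u a \<^bold>+ (-1) \<^bold>* ev u b"
  using ev_hom(3)[of u a "- b"] ev_hom(5)[of u "-1" b] by (simp add: csc_minus_one)

lemma ev_mult: "u \<in> Obj M \<Longrightarrow> arr x \<Longrightarrow> cd x = i # u @ [i] \<Longrightarrow> ev u a \<odot> ev u b \<odot> x = ev u (a * b) \<odot> x"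
  by (simp add: ev_hom calc)

lemma ev_cdiff_part: "ev [] (csc z cdiff) \<in> Part M 1 [i, i] [i, i]"
proof -
  have "C \<star> \<^bold>1 [i] \<in> Part M 1 [i, i] [i, i]" "\<^bold>1 [i] \<star> C \<in> Part M 1 [i, i] [i, i]"
    using tens_part[OF C_part id_part[OF i_obj]] tens_part[OF id_part[OF i_obj] C_part]
    by (simp_all add: tens_words)
  then show ?thesis by (simp add: ev_hom ev_minus add_part scal_part)
qed

lemma pin_slide:
  assumes j [simp]: "j \<in> J"
  shows "(ev [] a \<star> \<^bold>1 [p j]) \<odot> (\<^bold>1 [i] \<star> R j) \<odot> (R j \<star> \<^bold>1 [i]) =
      (\<^bold>1 [i] \<star> R j) \<odot> (R j \<star> \<^bold>1 [i]) \<odot> (\<^bold>1 [p j] \<star> ev [] a)"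
    and "(L j \<star> \<^bold>1 [i]) \<odot> (\<^bold>1 [i] \<star> L j) \<odot> (ev [] a \<star> \<^bold>1 [p j]) =
      (\<^bold>1 [p j] \<star> ev [] a) \<odot> (L j \<star> \<^bold>1 [i]) \<odot> (\<^bold>1 [i] \<star> L j)"
proof -
  have "(ev [] a \<star> \<^bold>1 [p j]) \<odot> (\<^bold>1 [i] \<star> R j) \<odot> (R j \<star> \<^bold>1 [i]) =
      ((ev [] a \<star> \<^bold>1 [p j]) \<odot> (\<^bold>1 [i] \<star> R j)) \<odot> (R j \<star> \<^bold>1 [i])" by (simp add: calc)
  also have "\<dots> = (\<^bold>1 [i] \<star> R j) \<odot> (ev [p j] a \<odot> (R j \<star> \<^bold>1 [i]))"
    unfolding ev_pass_pin(3)[OF j, symmetric] by (simp add: calc)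
  also have "\<dots> = (\<^bold>1 [i] \<star> R j) \<odot> (R j \<star> \<^bold>1 [i]) \<odot> (\<^bold>1 [p j] \<star> ev [] a)"
    unfolding ev_pass_pin(1)[OF j, symmetric] ..
  finally show "(ev [] a \<star> \<^bold>1 [p j]) \<odot> (\<^bold>1 [i] \<star> R j) \<odot> (R j \<star> \<^bold>1 [i]) =
      (\<^bold>1 [i] \<star> R j) \<odot> (R j \<star> \<^bold>1 [i]) \<odot> (\<^bold>1 [p j] \<star> ev [] a)" .
  have "(L j \<star> \<^bold>1 [i]) \<odot> (\<^bold>1 [i] \<star> L j) \<odot> (ev [] a \<star> \<^bold>1 [p j]) =
      ((L j \<star> \<^bold>1 [i]) \<odot> ev [p j] a) \<odot> (\<^bold>1 [i] \<star> L j)"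
    unfolding ev_pass_pin(2)[OF j] by (simp add: calc)
  also have "\<dots> = (\<^bold>1 [p j] \<star> ev [] a) \<odot> (L j \<star> \<^bold>1 [i]) \<odot> (\<^bold>1 [i] \<star> L j)"
    unfolding ev_pass_pin(4)[OF j] by (simp add: calc)
  finally show "(L j \<star> \<^bold>1 [i]) \<odot> (\<^bold>1 [i] \<star> L j) \<odot> (ev [] a \<star> \<^bold>1 [p j]) =
      (\<^bold>1 [p j] \<star> ev [] a) \<odot> (L j \<star> \<^bold>1 [i]) \<odot> (\<^bold>1 [i] \<star> L j)" .
qed

text \<open>Write \<open>d\<close> for \<open>c\<^sub>1 - c\<^sub>2\<close>. From \<open>d\<^sup>2 = 2\<close> and \<open>T d = - d T\<close> follows \<open>(z d T)\<^sup>2 = -2 z\<^sup>2\<close>, which is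
  \<open>1\<close> for \<open>z = 1 / w\<close> and \<open>z = -1 / w\<close>.\<close>

lemma crossing_twist:
  assumes T: "crossing r T" and anti: "T \<odot> ev [] cdiff = (-1) \<^bold>* (ev [] cdiff \<odot> T)"
    and z: "z * z = - 1 / 2"
    and braid: "((ev [] cdiff \<star> \<^bold>1 [i]) \<odot> (T \<star> \<^bold>1 [i])) \<odot> ((\<^bold>1 [i] \<star> ev [] cdiff) \<odot> (\<^bold>1 [i] \<star> T)) \<odot>
        ((ev [] cdiff \<star> \<^bold>1 [i]) \<odot> (T \<star> \<^bold>1 [i])) =
      ((\<^bold>1 [i] \<star> ev [] cdiff) \<odot> (\<^bold>1 [i] \<star> T)) \<odot> ((ev [] cdiff \<star> \<^bold>1 [i]) \<odot> (T \<star> \<^bold>1 [i])) \<odot>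
        ((\<^bold>1 [i] \<star> ev [] cdiff) \<odot> (\<^bold>1 [i] \<star> T))"
  shows "crossing (r + 1) (ev [] (csc z cdiff) \<odot> T)"
proof -
  let ?D = "ev [] cdiff" and ?T = "ev [] (csc z cdiff) \<odot> T"
  have Tp: "T \<in> Part M r [i, i] [i, i]" and TT: "T \<odot> T = \<^bold>1 [i, i]" using T by (auto simp: crossing_def)
  note t [simp] = homD[OF part_hom[OF Tp]]
  have part: "?T \<in> Part M (r + 1) [i, i] [i, i]"
    using comp_part[OF ev_cdiff_part Tp] by (simp only: add.commute)
  have "T \<odot> (?D \<odot> T) = (T \<odot> ?D) \<odot> T" by (simp add: calc)
  also have "\<dots> = (-1) \<^bold>* ?D" unfolding anti by (simp add: calc TT)
  finally have TDT: "T \<odot> (?D \<odot> T) = (-1) \<^bold>* ?D" .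
  have "?D \<odot> ?D = 2 \<^bold>* \<^bold>1 [i, i]"
    using ev_hom(4)[OF nil_obj, of cdiff cdiff] by (simp add: cdiff_square ev_hom)
  then have square: "?T \<odot> ?T = \<^bold>1 [i, i]"
  proof -
    have "z * (z * 2) = -1" using z by (simp flip: mult.assoc)
    with \<open>?D \<odot> ?D = 2 \<^bold>* \<^bold>1 [i, i]\<close> show ?thesis by (simp add: ev_hom calc TDT)
  qed
  have w1: "?T \<star> \<^bold>1 [i] = z \<^bold>* ((?D \<star> \<^bold>1 [i]) \<odot> (T \<star> \<^bold>1 [i]))"
    and w2: "\<^bold>1 [i] \<star> ?T = z \<^bold>* ((\<^bold>1 [i] \<star> ?D) \<odot> (\<^bold>1 [i] \<star> T))"
    by (simp_all add: ev_hom calc comp_whisker_left comp_whisker_right)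
  have tens: "arr (?D \<star> \<^bold>1 [i])" "dm (?D \<star> \<^bold>1 [i]) = [i, i, i]" "cd (?D \<star> \<^bold>1 [i]) = [i, i, i]"
    "arr (\<^bold>1 [i] \<star> ?D)" "dm (\<^bold>1 [i] \<star> ?D) = [i, i, i]" "cd (\<^bold>1 [i] \<star> ?D) = [i, i, i]"
    "arr (T \<star> \<^bold>1 [i])" "dm (T \<star> \<^bold>1 [i]) = [i, i, i]" "cd (T \<star> \<^bold>1 [i]) = [i, i, i]"
    "arr (\<^bold>1 [i] \<star> T)" "dm (\<^bold>1 [i] \<star> T) = [i, i, i]" "cd (\<^bold>1 [i] \<star> T) = [i, i, i]"
    by simp_all
  have br: "(?T \<star> \<^bold>1 [i]) \<odot> (\<^bold>1 [i] \<star> ?T) \<odot> (?T \<star> \<^bold>1 [i]) = (\<^bold>1 [i] \<star> ?T) \<odot> (?T \<star> \<^bold>1 [i]) \<odot> (\<^bold>1 [i] \<star> ?T)"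
    unfolding w1 w2
    using arg_cong[OF braid, of "\<lambda>f. (z * z * z) \<^bold>* f"]
    by (simp del: typing(13-15) add: tens calc)
  have right: "(?T \<star> \<^bold>1 [p j]) \<odot> (\<^bold>1 [i] \<star> R j) \<odot> (R j \<star> \<^bold>1 [i]) =
      (\<^bold>1 [i] \<star> R j) \<odot> (R j \<star> \<^bold>1 [i]) \<odot> (\<^bold>1 [p j] \<star> ?T)" if j [simp]: "j \<in> J" for j
  proof -
    let ?RR = "(\<^bold>1 [i] \<star> R j) \<odot> (R j \<star> \<^bold>1 [i])" and ?d = "ev [] (csc z cdiff)"
    have RT: "(T \<star> \<^bold>1 [p j]) \<odot> ?RR = ?RR \<odot> (\<^bold>1 [p j] \<star> T)"
      using T j by (simp add: crossing_def calc)
    have "(?T \<star> \<^bold>1 [p j]) \<odot> ?RR = (?d \<star> \<^bold>1 [p j]) \<odot> ((T \<star> \<^bold>1 [p j]) \<odot> ?RR)"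
      by (simp add: calc flip: comp_whisker_right)
    also have "\<dots> = ((?d \<star> \<^bold>1 [p j]) \<odot> ?RR) \<odot> (\<^bold>1 [p j] \<star> T)"
      unfolding RT by (simp add: calc)
    also have "\<dots> = ?RR \<odot> ((\<^bold>1 [p j] \<star> ?d) \<odot> (\<^bold>1 [p j] \<star> T))"
      unfolding pin_slide(1)[OF j] by (simp add: calc)
    finally show ?thesis by (simp add: calc comp_whisker_left)
  qed
  have left: "(L j \<star> \<^bold>1 [i]) \<odot> (\<^bold>1 [i] \<star> L j) \<odot> (?T \<star> \<^bold>1 [p j]) =
      (\<^bold>1 [p j] \<star> ?T) \<odot> (L j \<star> \<^bold>1 [i]) \<odot> (\<^bold>1 [i] \<star> L j)" if j [simp]: "j \<in> J" for j
  proof -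
    let ?LL = "(L j \<star> \<^bold>1 [i]) \<odot> (\<^bold>1 [i] \<star> L j)" and ?d = "ev [] (csc z cdiff)"
    have LT: "?LL \<odot> (T \<star> \<^bold>1 [p j]) = (\<^bold>1 [p j] \<star> T) \<odot> ?LL"
      using T j by (simp add: crossing_def calc)
    have Ld: "?LL \<odot> (?d \<star> \<^bold>1 [p j]) = (\<^bold>1 [p j] \<star> ?d) \<odot> ?LL"
      using pin_slide(2)[OF j, of "csc z cdiff"] by (simp add: calc)
    have "?LL \<odot> (?T \<star> \<^bold>1 [p j]) = (?LL \<odot> (?d \<star> \<^bold>1 [p j])) \<odot> (T \<star> \<^bold>1 [p j])"
      by (simp add: calc flip: comp_whisker_right)
    also have "\<dots> = (\<^bold>1 [p j] \<star> ?d) \<odot> (?LL \<odot> (T \<star> \<^bold>1 [p j]))"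
      unfolding Ld by (simp add: calc)
    also have "\<dots> = ((\<^bold>1 [p j] \<star> ?d) \<odot> (\<^bold>1 [p j] \<star> T)) \<odot> ?LL"
      unfolding LT by (simp add: calc)
    finally show ?thesis by (simp add: calc comp_whisker_left)
  qed
  show ?thesis unfolding crossing_def using part square br right left by blast
qed

lemma cdiff_strands:
  "ev [] cdiff \<star> \<^bold>1 [i] = C \<star> \<^bold>1 [i, i] \<^bold>+ (-1) \<^bold>* (\<^bold>1 [i] \<star> C \<star> \<^bold>1 [i])"
  "\<^bold>1 [i] \<star> ev [] cdiff = \<^bold>1 [i] \<star> C \<star> \<^bold>1 [i] \<^bold>+ (-1) \<^bold>* (\<^bold>1 [i, i] \<star> C)"
  "ev [] cdiff \<star> \<^bold>1 [i] \<^bold>+ \<^bold>1 [i] \<star> ev [] cdiff = ev [i] cdiff"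
proof -
  show *: "ev [] cdiff \<star> \<^bold>1 [i] = C \<star> \<^bold>1 [i, i] \<^bold>+ (-1) \<^bold>* (\<^bold>1 [i] \<star> C \<star> \<^bold>1 [i])"
    "\<^bold>1 [i] \<star> ev [] cdiff = \<^bold>1 [i] \<star> C \<star> \<^bold>1 [i] \<^bold>+ (-1) \<^bold>* (\<^bold>1 [i, i] \<star> C)"
    by (simp_all add: ev_minus calc)
  show "ev [] cdiff \<star> \<^bold>1 [i] \<^bold>+ \<^bold>1 [i] \<star> ev [] cdiff = ev [i] cdiff"
    unfolding * by (subst add_uminus_cancel[of _ "[i, i, i]" "[i, i, i]"]) (simp_all add: hom_iff ev_minus)
qed

lemma cdiff_strands_square:
  "(ev [] cdiff \<star> \<^bold>1 [i]) \<odot> (ev [] cdiff \<star> \<^bold>1 [i]) = 2 \<^bold>* \<^bold>1 [i, i, i]"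
  "(\<^bold>1 [i] \<star> ev [] cdiff) \<odot> (\<^bold>1 [i] \<star> ev [] cdiff) = 2 \<^bold>* \<^bold>1 [i, i, i]"
  "ev [i] cdiff \<odot> ev [i] cdiff = 2 \<^bold>* \<^bold>1 [i, i, i]"
proof -
  have D: "ev u cdiff \<odot> ev u cdiff = 2 \<^bold>* \<^bold>1 (i # u @ [i])" if "u \<in> Obj M" for u
    using ev_hom(4)[OF that, of cdiff cdiff] that by (simp add: cdiff_square ev_hom)
  show "ev [i] cdiff \<odot> ev [i] cdiff = 2 \<^bold>* \<^bold>1 [i, i, i]" using D[of "[i]"] by simp
  show "(ev [] cdiff \<star> \<^bold>1 [i]) \<odot> (ev [] cdiff \<star> \<^bold>1 [i]) = 2 \<^bold>* \<^bold>1 [i, i, i]"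
    "(\<^bold>1 [i] \<star> ev [] cdiff) \<odot> (\<^bold>1 [i] \<star> ev [] cdiff) = 2 \<^bold>* \<^bold>1 [i, i, i]"
    using D[of "[]"] by (simp_all add: comp_whisker_left comp_whisker_right calc)
qed

lemma crossing_tokens:
  assumes Tp: "T \<in> Part M r [i, i] [i, i]"
    and c1: "T \<odot> (C \<star> \<^bold>1 [i]) = z \<^bold>* (f \<odot> T)" and c2: "T \<odot> (\<^bold>1 [i] \<star> C) = z \<^bold>* (g \<odot> T)"
    and f: "f \<in> Hom M [i, i] [i, i]" and g: "g \<in> Hom M [i, i] [i, i]"
  shows "(T \<star> \<^bold>1 [i]) \<odot> (C \<star> \<^bold>1 [i, i]) = z \<^bold>* ((f \<star> \<^bold>1 [i]) \<odot> (T \<star> \<^bold>1 [i]))"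
    "(T \<star> \<^bold>1 [i]) \<odot> (\<^bold>1 [i] \<star> C \<star> \<^bold>1 [i]) = z \<^bold>* ((g \<star> \<^bold>1 [i]) \<odot> (T \<star> \<^bold>1 [i]))"
    "(T \<star> \<^bold>1 [i]) \<odot> (\<^bold>1 [i, i] \<star> C) = sign r \<^bold>* ((\<^bold>1 [i, i] \<star> C) \<odot> (T \<star> \<^bold>1 [i]))"
    "(\<^bold>1 [i] \<star> T) \<odot> (C \<star> \<^bold>1 [i, i]) = sign r \<^bold>* ((C \<star> \<^bold>1 [i, i]) \<odot> (\<^bold>1 [i] \<star> T))"
    "(\<^bold>1 [i] \<star> T) \<odot> (\<^bold>1 [i] \<star> C \<star> \<^bold>1 [i]) = z \<^bold>* ((\<^bold>1 [i] \<star> f) \<odot> (\<^bold>1 [i] \<star> T))"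
    "(\<^bold>1 [i] \<star> T) \<odot> (\<^bold>1 [i, i] \<star> C) = z \<^bold>* ((\<^bold>1 [i] \<star> g) \<odot> (\<^bold>1 [i] \<star> T))"
proof -
  note t [simp] = homD[OF part_hom[OF Tp]] homD[OF f] homD[OF g]
  have "(T \<star> \<^bold>1 [i]) \<odot> ((C \<star> \<^bold>1 [i]) \<star> \<^bold>1 [i]) = z \<^bold>* ((f \<star> \<^bold>1 [i]) \<odot> (T \<star> \<^bold>1 [i]))"
    "(T \<star> \<^bold>1 [i]) \<odot> ((\<^bold>1 [i] \<star> C) \<star> \<^bold>1 [i]) = z \<^bold>* ((g \<star> \<^bold>1 [i]) \<odot> (T \<star> \<^bold>1 [i]))"
    "(\<^bold>1 [i] \<star> T) \<odot> (\<^bold>1 [i] \<star> (C \<star> \<^bold>1 [i])) = z \<^bold>* ((\<^bold>1 [i] \<star> f) \<odot> (\<^bold>1 [i] \<star> T))"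
    "(\<^bold>1 [i] \<star> T) \<odot> (\<^bold>1 [i] \<star> (\<^bold>1 [i] \<star> C)) = z \<^bold>* ((\<^bold>1 [i] \<star> g) \<odot> (\<^bold>1 [i] \<star> T))"
    by (simp_all only: comp_whisker_right comp_whisker_left c1 c2 t typing CX_typing i_obj append.simps calc(14,15))
  then show "(T \<star> \<^bold>1 [i]) \<odot> (C \<star> \<^bold>1 [i, i]) = z \<^bold>* ((f \<star> \<^bold>1 [i]) \<odot> (T \<star> \<^bold>1 [i]))"
    "(T \<star> \<^bold>1 [i]) \<odot> (\<^bold>1 [i] \<star> C \<star> \<^bold>1 [i]) = z \<^bold>* ((g \<star> \<^bold>1 [i]) \<odot> (T \<star> \<^bold>1 [i]))"
    "(\<^bold>1 [i] \<star> T) \<odot> (\<^bold>1 [i] \<star> C \<star> \<^bold>1 [i]) = z \<^bold>* ((\<^bold>1 [i] \<star> f) \<odot> (\<^bold>1 [i] \<star> T))"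
    "(\<^bold>1 [i] \<star> T) \<odot> (\<^bold>1 [i, i] \<star> C) = z \<^bold>* ((\<^bold>1 [i] \<star> g) \<odot> (\<^bold>1 [i] \<star> T))"
    by (simp_all add: calc)
  show "(T \<star> \<^bold>1 [i]) \<odot> (\<^bold>1 [i, i] \<star> C) = sign r \<^bold>* ((\<^bold>1 [i, i] \<star> C) \<odot> (T \<star> \<^bold>1 [i]))"
    unfolding exchange[OF Tp C_part] by (simp add: calc sign_def)
  show "(\<^bold>1 [i] \<star> T) \<odot> (C \<star> \<^bold>1 [i, i]) = sign r \<^bold>* ((C \<star> \<^bold>1 [i, i]) \<odot> (\<^bold>1 [i] \<star> T))"
    unfolding exchange[OF C_part Tp] by simp
qed

lemma odot_ev:
  assumes [simp]: "u \<in> Obj M"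
  shows "odot \<star> \<^bold>1 (u @ [i]) = ev u (csc (1 / w) (pcc First * pcx First))"
    "\<^bold>1 (i # u) \<star> odot = ev u (csc (1 / w) (pcc Second * pcx Second))"
  by (simp_all add: odot_def ev_hom comp_whisker_left comp_whisker_right calc(14,15))

lemma twist_token:
  assumes T: "T \<in> Hom M [i, i] [i, i]" and c: "T \<odot> ev [] c = z \<^bold>* (ev [] c' \<odot> T)"
    and c': "cdiff * c' = csc z' (c'' * cdiff)"
  shows "(ev [] (csc k cdiff) \<odot> T) \<odot> ev [] c = (z * z') \<^bold>* (ev [] c'' \<odot> ev [] (csc k cdiff) \<odot> T)"
proof -
  note t [simp] = homD[OF T]
  have "csc k cdiff * c' = csc z' (c'' * csc k cdiff)" by (simp add: c' mult.commute)
  then have "ev [] (csc k cdiff) \<odot> ev [] c' \<odot> T = z' \<^bold>* (ev [] (c'' * csc k cdiff) \<odot> T)"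
    by (simp only: ev_mult t nil_obj append.simps) (simp only: ev_hom nil_obj calc t ev_typing append.simps typing)
  also have "\<dots> = z' \<^bold>* (ev [] c'' \<odot> ev [] (csc k cdiff) \<odot> T)"
    by (simp only: ev_mult t nil_obj append.simps)
  finally show ?thesis
    by (simp only: calc c t ev_typing typing nil_obj append.simps)
qed

lemma w_reciprocal: "w \<noteq> 0" "1 / w * (1 / w) = - 1 / 2" "(- (1 / w)) * (- (1 / w)) = - 1 / 2"
  using w by (auto simp: power2_eq_square)

text \<open>Moving \<open>T\<close> to the right turns the relations with tokens and dots into identities in the
  two-variable algebra. The relation with pins is multiplied by \<open>-(c\<^sub>1 - c\<^sub>2) / w\<close>, and this is where
  the factor in front of its correction term comes from.\<close>

theorem even_to_odd:
  assumes T: "even_crossing T"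
  shows "odd_crossing (ev [] (csc (- (1 / w)) cdiff) \<odot> T)"
proof -
  let ?k = "- (1 / w)"
  let ?d = "ev [] (csc ?k cdiff)" and ?D = "ev [] cdiff"
  have Tc: "crossing 0 T" and c1: "T \<odot> ev [] (pcc First) = ev [] (pcc Second) \<odot> T"
    and x1: "T \<odot> ev [] (pcx First) = ev [] (pcx Second) \<odot> T \<^bold>+ ev [] (- 1 - pcc First * pcc Second)"
    and pin: "\<And>j. j \<in> J \<Longrightarrow> over_pin j T = under_pin j T \<^bold>+ ev [p j] (- clifford_demazure (polcl_at1 (q j)))"
    using T by (auto simp: even_crossing_def)
  have Tp: "T \<in> Part M 0 [i, i] [i, i]" and TT: "T \<odot> T = \<^bold>1 [i, i]"
    and braid: "(T \<star> \<^bold>1 [i]) \<odot> (\<^bold>1 [i] \<star> T) \<odot> (T \<star> \<^bold>1 [i]) = (\<^bold>1 [i] \<star> T) \<odot> (T \<star> \<^bold>1 [i]) \<odot> (\<^bold>1 [i] \<star> T)"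
    using Tc by (auto simp: crossing_def)
  note Th = part_hom[OF Tp]
  note t [simp] = homD[OF Th]
  have "T \<odot> ev [] (pcc Second) = T \<odot> (ev [] (pcc Second) \<odot> T) \<odot> T"
    by (simp del: ev_gen add: calc TT)
  also have "\<dots> = (T \<odot> T) \<odot> ev [] (pcc First) \<odot> T"
    unfolding c1[symmetric] by (simp del: ev_gen add: calc)
  also have "\<dots> = ev [] (pcc First) \<odot> T" by (simp del: ev_gen add: TT calc)
  finally have c2: "T \<odot> ev [] (pcc Second) = ev [] (pcc First) \<odot> T" .
  have anti: "T \<odot> ?D = (-1) \<^bold>* (?D \<odot> T)"
    using add_comm[of "ev [] (pcc Second) \<odot> T" "[i, i]" "[i, i]" "(-1) \<^bold>* (ev [] (pcc First) \<odot> T)"]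
    by (simp del: ev_gen add: ev_minus calc c1 c2 hom_iff)
  have c1': "T \<odot> (C \<star> \<^bold>1 [i]) = 1 \<^bold>* ((\<^bold>1 [i] \<star> C) \<odot> T)" and c2': "T \<odot> (\<^bold>1 [i] \<star> C) = 1 \<^bold>* ((C \<star> \<^bold>1 [i]) \<odot> T)"
    using c1 c2 by (simp_all add: calc)
  note tok = crossing_tokens[OF Tp c1' c2', simplified hom_iff, simplified, unfolded sign_def, simplified]
  have "(T \<star> \<^bold>1 [i]) \<odot> (\<^bold>1 [i] \<star> ?D) = ev [i] cdiff \<odot> (T \<star> \<^bold>1 [i])"
    "(\<^bold>1 [i] \<star> T) \<odot> (?D \<star> \<^bold>1 [i]) = ev [i] cdiff \<odot> (\<^bold>1 [i] \<star> T)"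
    unfolding cdiff_strands(1,2) by (simp_all add: ev_minus calc tok)
  then have tw: "(T \<star> \<^bold>1 [i]) \<odot> (\<^bold>1 [i] \<star> ?D) = (?D \<star> \<^bold>1 [i] \<^bold>+ \<^bold>1 [i] \<star> ?D) \<odot> (T \<star> \<^bold>1 [i])"
    "(\<^bold>1 [i] \<star> T) \<odot> (?D \<star> \<^bold>1 [i]) = (?D \<star> \<^bold>1 [i] \<^bold>+ \<^bold>1 [i] \<star> ?D) \<odot> (\<^bold>1 [i] \<star> T)"
    unfolding cdiff_strands(3) .
  have sq: "(T \<star> \<^bold>1 [i]) \<odot> (T \<star> \<^bold>1 [i]) = \<^bold>1 [i, i, i]" "(\<^bold>1 [i] \<star> T) \<odot> (\<^bold>1 [i] \<star> T) = \<^bold>1 [i, i, i]"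
    by (simp_all add: comp_whisker_left comp_whisker_right TT calc)
  have "crossing (0 + 1) (?d \<odot> T)"
    by (rule crossing_twist[OF Tc anti w_reciprocal(3)])
      (rule commuting_braid[OF _ _ _ _ cdiff_strands_square(1,2) sq tw braid], simp_all add: hom_iff)
  then have cr: "crossing 1 (?d \<odot> T)" by simp
  have "cdiff * pcc Second = csc (-1) (pcc First * cdiff)" "cdiff * pcc First = csc (-1) (pcc Second * cdiff)"
    by (simp_all add: algebra_simps pcx_move csc_minus_one)
  then have tokens: "(?d \<odot> T) \<odot> ev [] (pcc First) = (-1) \<^bold>* (ev [] (pcc First) \<odot> ?d \<odot> T)"
    "(?d \<odot> T) \<odot> ev [] (pcc Second) = (-1) \<^bold>* (ev [] (pcc Second) \<odot> ?d \<odot> T)"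
    using twist_token[OF Th, of "pcc First" 1 "pcc Second" "-1" "pcc First" ?k]
      twist_token[OF Th, of "pcc Second" 1 "pcc First" "-1" "pcc Second" ?k] c1 c2
    by (simp_all only: calc(18) mult_1_left t ev_typing typing nil_obj append.simps)
  let ?A = "csc ?k cdiff * (pcc Second * csc (1 / w) (pcx Second))"
  let ?B = "csc ?k cdiff * (pcc Second * csc (1 / w) (- 1 - pcc First * pcc Second))"
  have l: "ev [] (csc (1 / w) (pcc First * pcx First)) = (1 / w) \<^bold>* (ev [] (pcc First) \<odot> ev [] (pcx First))"
    by (simp only: ev_hom nil_obj)
  have "(?d \<odot> T) \<odot> (odot \<star> \<^bold>1 [i]) = (1 / w) \<^bold>* (?d \<odot> (T \<odot> ev [] (pcc First)) \<odot> ev [] (pcx First))"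
    using odot_ev(1)[of "[]"] by (simp del: ev_gen add: l calc)
  also have "\<dots> = (1 / w) \<^bold>* (?d \<odot> ev [] (pcc Second) \<odot> (T \<odot> ev [] (pcx First)))"
    unfolding c1 by (simp del: ev_gen add: calc)
  also have "\<dots> = ev [] ?A \<odot> T \<^bold>+ ev [] ?B"
    unfolding x1 by (simp del: ev_gen csc_simps csc_uminus_left add: calc ev_hom(4,5) mult_ac)
  finally have 1: "(?d \<odot> T) \<odot> (odot \<star> \<^bold>1 [i]) = ev [] ?A \<odot> T \<^bold>+ ev [] ?B" .
  have A: "csc (1 / w) (pcc Second * pcx Second) * csc ?k cdiff = csc (-1) ?A"
    by (simp add: algebra_simps pcx_move csc_minus_one csc_diff)
  have B: "?B = 1"
  proof -
    have "cdiff * (pcc Second * (- 1 - pcc First * pcc Second)) = csc 2 1"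
      by (simp add: algebra_simps pcx_move csc_2)
    then have "?B = csc (1 / w * (?k * 2)) 1" by (simp only: csc_simps)
    also have "1 / w * (?k * 2) = 1" using w w_reciprocal(1) by (simp add: field_simps power2_eq_square)
    finally show ?thesis by simp
  qed
  have "(\<^bold>1 [i] \<star> odot) \<odot> (?d \<odot> T) = ev [] (csc (1 / w) (pcc Second * pcx Second)) \<odot> ?d \<odot> T"
    using odot_ev(2)[of "[]"] by simp
  also have "\<dots> = ev [] (csc (-1) ?A) \<odot> T"
    by (simp only: ev_mult t nil_obj append.simps A)
  also have "\<dots> = (-1) \<^bold>* (ev [] ?A \<odot> T)"
    by (simp only: ev_hom(5)[OF nil_obj, of "-1"] calc(6) t ev_typing nil_obj append.simps)
  finally have 2: "(\<^bold>1 [i] \<star> odot) \<odot> (?d \<odot> T) = (-1) \<^bold>* (ev [] ?A \<odot> T)" .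
  have dot: "(?d \<odot> T) \<odot> (odot \<star> \<^bold>1 [i]) \<^bold>+ (\<^bold>1 [i] \<star> odot) \<odot> (?d \<odot> T) = \<^bold>1 [i, i]"
  proof -
    have "ev [] ?B = \<^bold>1 [i, i]" unfolding B by (simp add: ev_hom)
    moreover have "ev [] ?A \<odot> T \<in> Hom M [i, i] [i, i]" "\<^bold>1 [i, i] \<in> Hom M [i, i] [i, i]"
      by (simp_all add: hom_iff)
    ultimately show ?thesis unfolding 1 2 by (simp only: add_cancel_right)
  qed
  have pins: "over_pin j (?d \<odot> T) = under_pin j (?d \<odot> T) \<^bold>+
      ev [p j] (csc (1 / w) (cdiff * clifford_demazure (polcl_at1 (q j))))" if j [simp]: "j \<in> J" for j
    using Th pin_typing(4-6)[OF j Th] by (simp add: pin_twist pin calc flip: ev_hom(4))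
  show ?thesis
    unfolding odd_crossing_def using cr tokens dot pins by blast
qed

text \<open>The inverse calculation. The correction term is multiplied by \<open>(c\<^sub>1 - c\<^sub>2) / w\<close> a second time and
  changes its sign, because \<open>(c\<^sub>1 - c\<^sub>2)\<^sup>2 / w\<^sup>2 = -1\<close>.\<close>

theorem odd_to_even:
  assumes T: "odd_crossing T"
  shows "even_crossing (ev [] (csc (1 / w) cdiff) \<odot> T)"
proof -
  let ?k = "1 / w"
  let ?d = "ev [] (csc ?k cdiff)" and ?D = "ev [] cdiff"
  have Tc: "crossing 1 T" and c1: "T \<odot> ev [] (pcc First) = (-1) \<^bold>* (ev [] (pcc First) \<odot> T)"
    and c2: "T \<odot> ev [] (pcc Second) = (-1) \<^bold>* (ev [] (pcc Second) \<odot> T)"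
    and x: "T \<odot> (odot \<star> \<^bold>1 [i]) \<^bold>+ (\<^bold>1 [i] \<star> odot) \<odot> T = \<^bold>1 [i, i]"
    and pin: "\<And>j. j \<in> J \<Longrightarrow> over_pin j T = under_pin j T \<^bold>+
      ev [p j] (csc (1 / w) (cdiff * clifford_demazure (polcl_at1 (q j))))"
    using T by (auto simp: odd_crossing_def)
  have Tp: "T \<in> Part M 1 [i, i] [i, i]"
    and braid: "(T \<star> \<^bold>1 [i]) \<odot> (\<^bold>1 [i] \<star> T) \<odot> (T \<star> \<^bold>1 [i]) = (\<^bold>1 [i] \<star> T) \<odot> (T \<star> \<^bold>1 [i]) \<odot> (\<^bold>1 [i] \<star> T)"
    using Tc by (auto simp: crossing_def)
  note Th = part_hom[OF Tp]
  note t [simp] = homD[OF Th]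
  have anti: "T \<odot> ?D = (-1) \<^bold>* (?D \<odot> T)"
    by (simp del: ev_gen add: ev_minus calc c1 c2)
  have c1': "T \<odot> (C \<star> \<^bold>1 [i]) = (-1) \<^bold>* ((C \<star> \<^bold>1 [i]) \<odot> T)"
    and c2': "T \<odot> (\<^bold>1 [i] \<star> C) = (-1) \<^bold>* ((\<^bold>1 [i] \<star> C) \<odot> T)"
    using c1 c2 by simp_all
  note tok = crossing_tokens[OF Tp c1' c2', simplified hom_iff, simplified, unfolded sign_def, simplified]
  have an: "(T \<star> \<^bold>1 [i]) \<odot> (?D \<star> \<^bold>1 [i]) = (-1) \<^bold>* ((?D \<star> \<^bold>1 [i]) \<odot> (T \<star> \<^bold>1 [i]))"
    "(T \<star> \<^bold>1 [i]) \<odot> (\<^bold>1 [i] \<star> ?D) = (-1) \<^bold>* ((\<^bold>1 [i] \<star> ?D) \<odot> (T \<star> \<^bold>1 [i]))"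
    "(\<^bold>1 [i] \<star> T) \<odot> (?D \<star> \<^bold>1 [i]) = (-1) \<^bold>* ((?D \<star> \<^bold>1 [i]) \<odot> (\<^bold>1 [i] \<star> T))"
    "(\<^bold>1 [i] \<star> T) \<odot> (\<^bold>1 [i] \<star> ?D) = (-1) \<^bold>* ((\<^bold>1 [i] \<star> ?D) \<odot> (\<^bold>1 [i] \<star> T))"
    unfolding cdiff_strands(1,2) by (simp_all add: calc tok)
  have "crossing (1 + 1) (?d \<odot> T)"
    by (rule crossing_twist[OF Tc anti w_reciprocal(2)])
      (rule anticommuting_braid[OF _ _ _ _ cdiff_strands_square(1,2) _ an braid],
       simp_all add: hom_iff cdiff_strands_square(3) cdiff_strands(3))
  then have cr: "crossing 0 (?d \<odot> T)" by simp
  have "cdiff * pcc First = csc (-1) (pcc Second * cdiff)"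
    by (simp add: algebra_simps pcx_move csc_minus_one)
  from twist_token[OF Th c1 this, of ?k]
  have token: "(?d \<odot> T) \<odot> ev [] (pcc First) = ev [] (pcc Second) \<odot> ?d \<odot> T"
    by (simp del: ev_gen add: calc(18))
  let ?x = "csc (1 / w) (pcc First * pcx First)" and ?y = "csc (1 / w) (pcc Second * pcx Second)"
  have x': "T \<odot> ev [] ?x = \<^bold>1 [i, i] \<^bold>+ (-1) \<^bold>* (ev [] ?y \<odot> T)"
    using x odot_ev[of "[]"] by (intro add_eq_iff[of _ "[i, i]" "[i, i]"]) (simp_all add: hom_iff)
  \<comment> \<open>The relation concerns the odd dot; the even dot is recovered from it and a token.\<close>
  have xx: "pcx First = pcc First * csc w ?x"
    using w_reciprocal(1) by (simp add: pcx_move)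
  have "(?d \<odot> T) \<odot> ev [] (pcx First) = (?d \<odot> T) \<odot> ev [] (pcc First * csc w ?x)"
    using xx by (rule arg_cong)
  also have "\<dots> = ?d \<odot> (T \<odot> ev [] (pcc First)) \<odot> w \<^bold>* ev [] ?x"
    by (simp del: ev_gen csc_simps add: ev_hom(4) ev_hom(5)[of _ w] calc)
  also have "\<dots> = (- w) \<^bold>* (?d \<odot> ev [] (pcc First) \<odot> (T \<odot> ev [] ?x))"
    unfolding c1 by (simp del: ev_gen csc_simps add: calc)
  also have "\<dots> = (- w) \<^bold>* (ev [] (csc ?k cdiff * pcc First)) \<^bold>+ w \<^bold>* (ev [] (csc ?k cdiff * (pcc First * ?y)) \<odot> T)"
    unfolding x' by (simp del: ev_gen csc_simps add: calc ev_hom(4))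
  also have "\<dots> = ev [] (csc (- w) (csc ?k cdiff * pcc First)) \<^bold>+ ev [] (csc w (csc ?k cdiff * (pcc First * ?y))) \<odot> T"
    by (simp del: ev_gen csc_simps csc_uminus_left add: ev_hom(5)[of _ w] ev_hom(5)[of _ "- w"] calc)
  also have "csc (- w) (csc ?k cdiff * pcc First) = - 1 - pcc First * pcc Second"
    using w_reciprocal(1) by (simp add: algebra_simps pcx_move)
  also have "csc w (csc ?k cdiff * (pcc First * ?y)) = pcx Second * csc ?k cdiff"
    using w_reciprocal(1) by (simp add: algebra_simps pcx_move csc_diff)
  finally have "(?d \<odot> T) \<odot> ev [] (pcx First) =
      ev [] (- 1 - pcc First * pcc Second) \<^bold>+ ev [] (pcx Second * csc ?k cdiff) \<odot> T" .
  then have dot: "(?d \<odot> T) \<odot> ev [] (pcx First) =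
      ev [] (pcx Second) \<odot> (?d \<odot> T) \<^bold>+ ev [] (- 1 - pcc First * pcc Second)"
    by (simp del: ev_gen add: ev_mult add_comm[of "ev [] (- 1 - pcc First * pcc Second)" "[i, i]" "[i, i]"] hom_iff)
  have half: "csc ?k cdiff * csc (1 / w) (cdiff * f) = - f" for f
  proof -
    have "csc ?k cdiff * csc (1 / w) (cdiff * f) = csc (1 / w * (1 / w)) (cdiff * cdiff * f)"
      by (simp add: mult.assoc)
    also have "\<dots> = csc (- 1 / 2 * 2) f" unfolding cdiff_square w_reciprocal(2) by simp
    finally show ?thesis by (simp add: csc_minus_one)
  qed
  have pins: "over_pin j (?d \<odot> T) = under_pin j (?d \<odot> T) \<^bold>+ ev [p j] (- clifford_demazure (polcl_at1 (q j)))"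
    if j [simp]: "j \<in> J" for j
    using Th pin_typing(4-6)[OF j Th] by (simp add: pin_twist pin calc half del: csc_simps flip: ev_hom(4))
  show ?thesis
    unfolding even_crossing_def using cr token dot pins by blast
qed

end

section \<open>The two presentations\<close>

context typed_presentation
begin

text \<open>Homogeneous relations are respected by the involution.\<close>

lemma msgn_relation:
  assumes st: "meq P s t" and "mgraded P s" "mgraded P t" "mpar P s = mpar P t"
  shows "meq P (msgn P s) (msgn P t)"
proof -
  have s: "mhomog P (mpar P s) (mdom P s) (mcod P s) s" and t: "mhomog P (mpar P s) (mdom P s) (mcod P s) t"
    using meq_typed[OF st] assms by (auto intro!: mhomogI)
  have "meq P (msgn P s) (MScal (sign (mpar P s)) s)" using s by (rule msgn_homogeneous)
  also have "meq P \<dots> (MScal (sign (mpar P s)) t)" using mhomog_mhom[OF s] st by (rule scal_cong)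
  also have "meq P \<dots> (msgn P t)" using msgn_homogeneous[OF t] by (rule meq_sym)
  finally show ?thesis .
qed

lemma msum_typed:
  assumes "a \<in> lists (letters P)" "b \<in> lists (letters P)" "\<And>t. t \<in> set ts \<Longrightarrow> mhom P a b t"
  shows "mhom P a b (msum a b ts)"
  using assms(3) by (induction ts) (simp_all add: mhom.intros(3,4) assms(1,2) del: in_lists_conv_set)

lemma msgn_msum:
  assumes ab: "a \<in> lists (letters P)" "b \<in> lists (letters P)"
    and m: "\<And>i. i \<in> set is \<Longrightarrow> mhomog P (p i) a b (m i)"
  shows "meq P (msgn P (msum a b (map (\<lambda>i. MScal (\<mu> i) (m i)) is)))
    (msum a b (map (\<lambda>i. MScal (sign (p i) * \<mu> i) (m i)) is))"
  using m
proof (induction "is")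
  case Nil
  then show ?case using ab by (auto intro: meq_refl mhom.intros)
next
  case (Cons i "is")
  have h: "mhomog P (p i) a b (m i)" using Cons(2) by simp
  note t = mhomog_mhom[OF h] msgn_mhom[OF mhomog_mhom[OF h]]
  have "meq P (MScal (\<mu> i) (msgn P (m i))) (MScal (\<mu> i) (MScal (sign (p i)) (m i)))"
    using t(2) msgn_homogeneous[OF h] by (rule scal_cong)
  also have "meq P \<dots> (MScal (sign (p i) * \<mu> i) (m i))"
    using meq_scal_scal[OF t(1), of "\<mu> i" "sign (p i)"] by (simp add: mult.commute)
  finally have 1: "meq P (MScal (\<mu> i) (msgn P (m i))) (MScal (sign (p i) * \<mu> i) (m i))" .
  have "mhom P a b (msum a b (map (\<lambda>i. MScal (\<mu> i) (m i)) is))"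
    using Cons(2) by (intro msum_typed ab) (auto intro!: mhom.intros(5) dest: mhomog_mhom)
  from add_cong[OF mhom.intros(5)[OF t(2)] msgn_mhom[OF this] 1 Cons(1)[OF Cons(2)]]
  show ?case by simp
qed

lemma scal_msum:
  assumes ab: "a \<in> lists (letters P)" "b \<in> lists (letters P)"
    and m: "\<And>i. i \<in> set is \<Longrightarrow> mhom P a b (m i)"
  shows "meq P (MScal z (msum a b (map (\<lambda>i. MScal (\<mu> i) (m i)) is)))
    (msum a b (map (\<lambda>i. MScal (z * \<mu> i) (m i)) is))"
  using m
proof (induction "is")
  case Nil
  then show ?case using scal_MZero[OF ab] by simp
next
  case (Cons i "is")
  let ?s = "msum a b (map (\<lambda>i. MScal (\<mu> i) (m i)) is)"
  have t: "mhom P a b (m i)" using Cons(2) by simp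
  note t' = mhom.intros(5)[OF t, of "\<mu> i"]
  have s: "mhom P a b ?s"
    using Cons(2) by (intro msum_typed ab) (auto intro!: mhom.intros(5))
  have "meq P (MScal z (MScal (\<mu> i) (m i) \<oplus> ?s)) (MScal z (MScal (\<mu> i) (m i)) \<oplus> MScal z ?s)"
    using t' s by (rule meq_scal_add)
  also have "meq P \<dots> (MScal (z * \<mu> i) (m i) \<oplus> msum a b (map (\<lambda>i. MScal (z * \<mu> i) (m i)) is))"
    using mhom.intros(5)[OF t'] mhom.intros(5)[OF s] meq_scal_scal[OF t] Cons(1)[OF Cons(2)] by (rule add_cong) simp_all
  finally show ?case by simp
qed

end

lemma sign_of_nat: "sign (of_nat k) = (-1) ^ k"
proof (induction k)
  case (Suc k)
  have "sign (1 + p) = - sign p" for p by (cases p) (simp_all add: sign_def)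
  then show ?case using Suc by simp
qed (simp add: sign_def)

lemma mpow_typed:
  assumes "mwf P t" "mdom P t = a" "mcod P t = a" "a \<in> lists (letters P)"
  shows "mwf P (mpow a t k)" "mdom P (mpow a t k) = a" "mcod P (mpow a t k) = a"
    "mgraded P t \<Longrightarrow> mgraded P (mpow a t k)" "mpar P (mpow a t k) = of_nat k * mpar P t"
proof -
  show *: "mdom P (mpow a t k) = a" "mcod P (mpow a t k) = a" for k
    by (induction k) (simp_all add: assms)
  show "mwf P (mpow a t k)" by (induction k) (use assms * in simp_all)
  show "mgraded P t \<Longrightarrow> mgraded P (mpow a t k)" by (induction k) simp_all
  show "mpar P (mpow a t k) = of_nat k * mpar P t"
    by (induction k) (simp_all only: mpow.simps mpar.simps of_nat_0 mult_zero_left of_nat_Suc distrib_right mult_1_left)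
qed

lemma opin_product:
  "opin Q n \<mu> = msum [Strand, Pin Q, Strand] [Strand, Pin Q, Strand]
    (map (\<lambda>i. MScal (\<mu> (fst i) (snd i)) (powX (fst i) \<otimes> idQ Q \<otimes> powX (snd i)))
      (List.product [0..<Suc n] [0..<Suc n]))"
  unfolding opin_def product_concat_map map_concat map_map comp_def fst_conv snd_conv ..

lemma pin_product:
  "pin Q n \<mu> = msum [Strand, Pin Q, Strand] [Strand, Pin Q, Strand]
    (map (\<lambda>i. MScal (\<mu> (fst i) (fst (snd i)) (fst (snd (snd i))) (snd (snd (snd i))))
        ((powC (fst i) \<cdot> powX (fst (snd (snd i)))) \<otimes> idQ Q \<otimes> (powC (fst (snd i)) \<cdot> powX (snd (snd (snd i))))))
      (List.product [0, 1] (List.product [0, 1] (List.product [0..<Suc n] [0..<Suc n]))))"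
  unfolding pin_def product_concat_map map_concat map_map comp_def fst_conv snd_conv ..

locale pin_presentation =
  fixes P :: "('q letter, 'q dgen) mpres" and E :: "'q set"
  assumes pres [simp]: "letters P = insert Strand (Pin ` E)"
    "gens P = {Cross, Dot, Token} \<union> RightPin ` E \<union> LeftPin ` E" "src P = dsrc" "tgt P = dtgt"
begin

lemma pow_typed [simp]:
  "mwf P (powX k)" "mdom P (powX k) = [Strand]" "mcod P (powX k) = [Strand]" "mgraded P (powX k)"
  "mwf P (powC k)" "mdom P (powC k) = [Strand]" "mcod P (powC k) = [Strand]" "mgraded P (powC k)"
  "mpar P (powX k) = of_nat k * par P Dot" "mpar P (powC k) = of_nat k * par P Token"
  using mpow_typed[of P gX "[Strand]" k] mpow_typed[of P gC "[Strand]" k] by simp_all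

lemma gens_words: "g \<in> gens P \<Longrightarrow> src P g \<in> lists (letters P) \<and> tgt P g \<in> lists (letters P)"
  by auto

lemma msum_wf:
  "a \<in> lists (letters P) \<Longrightarrow> b \<in> lists (letters P) \<Longrightarrow> \<forall>t\<in>set ts. mwf P t \<and> mdom P t = a \<and> mcod P t = b \<Longrightarrow>
    mwf P (msum a b ts) \<and> mdom P (msum a b ts) = a \<and> mcod P (msum a b ts) = b"
  by (induction ts) auto

lemma sums_typed [simp]:
  "mwf P (poly_dot n \<mu>)" "mdom P (poly_dot n \<mu>) = [Strand]" "mcod P (poly_dot n \<mu>) = [Strand]"
  "Q \<in> E \<Longrightarrow> mwf P (opin Q n \<nu>)" "Q \<in> E \<Longrightarrow> mdom P (opin Q n \<nu>) = [Strand, Pin Q, Strand]"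
  "Q \<in> E \<Longrightarrow> mcod P (opin Q n \<nu>) = [Strand, Pin Q, Strand]"
  "Q \<in> E \<Longrightarrow> mwf P (pin Q n \<kappa>)" "Q \<in> E \<Longrightarrow> mdom P (pin Q n \<kappa>) = [Strand, Pin Q, Strand]"
  "Q \<in> E \<Longrightarrow> mcod P (pin Q n \<kappa>) = [Strand, Pin Q, Strand]"
  using msum_wf[of "[Strand]" "[Strand]" "[MScal (\<mu> k) (powX k). k \<leftarrow> [0..<Suc n]]"]
    msum_wf[of "[Strand, Pin Q, Strand]" "[Strand, Pin Q, Strand]"]
  by (auto simp: poly_dot_def opin_product pin_product simp del: upt_Suc product.simps)

end

lemma common_rel_typed:
  fixes P :: "('g::presentation salg letter, 'g salg dgen) mpres"
  assumes "pin_presentation P EE" "common_rel x s t"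
  shows "mwf P s \<and> mwf P t \<and> mdom P s = mdom P t \<and> mcod P s = mcod P t"
proof -
  interpret pin_presentation P EE by fact
  show ?thesis using assms(2) by (cases rule: common_rel.cases) auto
qed

lemma common_rel_graded:
  fixes P :: "('g::presentation salg letter, 'g salg dgen) mpres"
  assumes "pin_presentation P EE" "\<And>Q. par P (RightPin Q) = 0" "\<And>Q. par P (LeftPin Q) = 0"
    and "common_rel x s t"
    and not: "\<And>Q n \<mu>. t \<noteq> poly_dot n \<mu> \<otimes> idQ Q" "\<And>Q n \<mu>. t \<noteq> idQ Q \<otimes> poly_dot n \<mu>"
  shows "mgraded P s \<and> mgraded P t \<and> mpar P s = mpar P t"
proof -
  interpret pin_presentation P EE by fact
  show ?thesis using assms(4)
    by (cases rule: common_rel.cases) (use not in \<open>auto simp: assms(2,3)\<close>)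
qed

lemma TAS_pins: "pin_presentation TAS_pres EE" and TAH_pins: "pin_presentation TAH_pres EE"
  by unfold_locales (simp_all add: TAS_pres_def TAH_pres_def)

lemma TAS_typed: "typed_presentation TAS_pres"
proof -
  interpret pin_presentation TAS_pres EE by (rule TAS_pins)
  show ?thesis
  proof
    show "g \<in> gens TAS_pres \<Longrightarrow> src TAS_pres g \<in> lists (letters TAS_pres) \<and> tgt TAS_pres g \<in> lists (letters TAS_pres)" for g
      by (rule gens_words)
    fix s t assume "rel TAS_pres s t"
    then have "TAS_rel s t" by (simp add: TAS_pres_def)
    then show "mwf TAS_pres s \<and> mwf TAS_pres t \<and> mdom TAS_pres s = mdom TAS_pres t \<and> mcod TAS_pres s = mcod TAS_pres t"
      by (cases rule: TAS_rel.cases) (auto dest: common_rel_typed[OF TAS_pins])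
  qed
qed

lemma TAH_typed: "typed_presentation TAH_pres"
proof -
  interpret pin_presentation TAH_pres EE by (rule TAH_pins)
  show ?thesis
  proof
    show "g \<in> gens TAH_pres \<Longrightarrow> src TAH_pres g \<in> lists (letters TAH_pres) \<and> tgt TAH_pres g \<in> lists (letters TAH_pres)" for g
      by (rule gens_words)
    fix s t assume "rel TAH_pres s t"
    then have "TAH_rel s t" by (simp add: TAH_pres_def)
    then show "mwf TAH_pres s \<and> mwf TAH_pres t \<and> mdom TAH_pres s = mdom TAH_pres t \<and> mcod TAH_pres s = mcod TAH_pres t"
      by (cases rule: TAH_rel.cases) (auto dest: common_rel_typed[OF TAH_pins])
  qed
qed

lemma alg_hom_sum: "alg_hom F \<Longrightarrow> F (\<Sum>i\<in>A. f i) = (\<Sum>i\<in>A. F (f i))"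
  by (induction A rule: infinite_finite_induct) (simp_all add: alg_homD)

lemma csc_sum: "csc z (\<Sum>i\<in>A. f i) = (\<Sum>i\<in>A. csc z (f i))"
  by (induction A rule: infinite_finite_induct) simp_all

lemma csc_power: "csc z a ^ n = csc (z ^ n) (a ^ n)"
  by (induction n) (simp_all add: mult.commute)

lemma parity_opol: "alg_hom (parity_aut :: 'i opol \<Rightarrow> _)" "parity_aut (ox i) = csc (-1) (ox i)"
proof -
  show "alg_hom (parity_aut :: 'i opol \<Rightarrow> _)"
    unfolding parity_aut_def by (rule alg_hom_alg_ext[OF parity_rel_opol])
  show "parity_aut (ox i) = csc (-1) (ox i)"
    using alg_ext(2)[OF parity_rel_opol, of "Ox i"]
    unfolding parity_aut_def[symmetric] by (simp add: gen_parity_opol_gen_def sign_def)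
qed

lemma parity_polcl: "alg_hom (parity_aut :: 'i polcl \<Rightarrow> _)" "parity_aut (pcc i) = csc (-1) (pcc i)"
  "parity_aut (pcx i) = pcx i"
proof -
  show "alg_hom (parity_aut :: 'i polcl \<Rightarrow> _)"
    unfolding parity_aut_def by (rule alg_hom_alg_ext[OF parity_rel_polcl])
  show "parity_aut (pcc i) = csc (-1) (pcc i)" "parity_aut (pcx i) = pcx i"
    using alg_ext(2)[OF parity_rel_polcl, of "PCc i"] alg_ext(2)[OF parity_rel_polcl, of "PCx i"]
    unfolding parity_aut_def[symmetric] by (simp_all add: gen_parity_polcl_gen_def sign_def)
qed

lemma parity_twice: "csc (sign p) (csc (sign p) a) = a"
  by (cases p) (simp_all add: sign_def)

text \<open>The parity automorphism changes a homogeneous element by a sign only, and each monomial too.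
  This turns an expansion into another expansion of the same element.\<close>

lemma opol1_signed_expansion:
  assumes "homogeneous p (\<Sum>k\<le>n. csc (\<mu> k) (xo ^ k))"
  shows "(\<Sum>k\<le>n. csc (\<mu> k) (xo ^ k)) = (\<Sum>k\<le>n. csc (sign p * (sign (of_nat k) * \<mu> k)) (xo ^ k))" (is "?Q = _")
proof -
  have "parity_aut ?Q = csc (sign p) ?Q"
    by (rule parity_aut_homogeneous, erule parity_rel_opol, rule assms)
  then have "?Q = csc (sign p) (parity_aut ?Q)" by (simp only: parity_twice)
  also have "parity_aut ?Q = (\<Sum>k\<le>n. csc (sign (of_nat k) * \<mu> k) (xo ^ k))"
    by (simp add: alg_hom_sum[OF parity_opol(1)] alg_homD[OF parity_opol(1)] parity_opol(2) csc_power sign_of_nat mult.commute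
        del: csc_uminus_left)
  finally show ?thesis by (simp add: csc_sum)
qed

lemma opol2_signed_expansion:
  assumes "homogeneous p (\<Sum>r\<le>n. \<Sum>s\<le>n. csc (\<mu> r s) (ox First ^ r * ox Second ^ s))"
  shows "(\<Sum>r\<le>n. \<Sum>s\<le>n. csc (\<mu> r s) (ox First ^ r * ox Second ^ s)) =
    (\<Sum>r\<le>n. \<Sum>s\<le>n. csc (sign p * (sign (of_nat (r + s)) * \<mu> r s)) (ox First ^ r * ox Second ^ s))" (is "?Q = _")
proof -
  have "parity_aut ?Q = csc (sign p) ?Q"
    by (rule parity_aut_homogeneous, erule parity_rel_opol, rule assms)
  then have "?Q = csc (sign p) (parity_aut ?Q)" by (simp only: parity_twice)
  also have "parity_aut ?Q = (\<Sum>r\<le>n. \<Sum>s\<le>n. csc (sign (of_nat (r + s)) * \<mu> r s) (ox First ^ r * ox Second ^ s))"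
    unfolding sign_of_nat
    by (simp add: alg_hom_sum[OF parity_opol(1)] alg_homD[OF parity_opol(1)] parity_opol(2) csc_power power_add mult_ac
        del: csc_uminus_left)
  finally show ?thesis by (simp add: csc_sum)
qed

lemma polcl2_signed_expansion:
  assumes "homogeneous 0 (\<Sum>a\<le>1. \<Sum>b\<le>1. \<Sum>r\<le>n. \<Sum>s\<le>n.
      csc (\<mu> a b r s) (pcc First ^ a * pcc Second ^ b * pcx First ^ r * pcx Second ^ s))"
  shows "(\<Sum>a\<le>1. \<Sum>b\<le>1. \<Sum>r\<le>n. \<Sum>s\<le>n.
      csc (\<mu> a b r s) (pcc First ^ a * pcc Second ^ b * pcx First ^ r * pcx Second ^ s)) =
    (\<Sum>a\<le>1. \<Sum>b\<le>1. \<Sum>r\<le>n. \<Sum>s\<le>n. csc (sign (of_nat (a + b)) * \<mu> a b r s)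
      (pcc First ^ a * pcc Second ^ b * pcx First ^ r * pcx Second ^ s))" (is "?Q = _")
proof -
  have "parity_aut ?Q = csc (sign 0) ?Q"
    by (rule parity_aut_homogeneous, erule parity_rel_polcl, rule assms)
  then have "?Q = parity_aut ?Q" by (simp only: sign_def simp_thms if_True csc_simps)
  also have "\<dots> = (\<Sum>a\<le>1. \<Sum>b\<le>1. \<Sum>r\<le>n. \<Sum>s\<le>n. csc (sign (of_nat (a + b)) * \<mu> a b r s)
      (pcc First ^ a * pcc Second ^ b * pcx First ^ r * pcx Second ^ s))"
    unfolding sign_of_nat
    by (simp only: alg_hom_sum[OF parity_polcl(1)] alg_homD[OF parity_polcl(1)] parity_polcl(2,3) csc_power power_add
        csc_simps mult.assoc mult.commute mult.left_commute)
  finally show ?thesis .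
qed

text \<open>The relations that involve \<open>Q(X)\<close> and pinned polynomials have terms that are not homogeneous. The
  involution sends such a relation to the one for the expansion with changed signs.\<close>

theorem TAS_graded: "graded_presentation TAS_pres"
proof -
  interpret typed_presentation TAS_pres by (rule TAS_typed)
  interpret pin_presentation TAS_pres EE by (rule TAS_pins)
  have par [simp]: "par TAS_pres Cross = 1" "par TAS_pres Dot = 1" "par TAS_pres Token = 1"
    "par TAS_pres (RightPin Q) = 0" "par TAS_pres (LeftPin Q) = 0" for Q
    by (simp_all add: TAS_pres_def)
  have rel: "rel TAS_pres = TAS_rel" by (simp add: TAS_pres_def)
  let ?P = TAS_pres
  note EE_hom = CollectD[of _ "\<lambda>a. homogeneous 0 a \<and> supercentral 0 a \<and> regular a", folded EE_def]
  show ?thesis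
  proof
    fix s t assume "rel ?P s t"
    then have r: "TAS_rel s t" and st: "meq ?P s t" by (simp_all add: rel meq_rel)
    have dots: "meq ?P (msgn ?P (poly_dot n \<mu>)) (poly_dot n (\<lambda>k. sign (of_nat k) * \<mu> k))" for n \<mu>
      unfolding poly_dot_def
      by (rule msgn_msum) (auto intro!: mhomogI simp del: upt_Suc)
    have pindots: "meq ?P (msgn ?P (opin Q n \<mu>)) (opin Q n (\<lambda>r s. sign (of_nat (r + s)) * \<mu> r s))"
      if "Q \<in> EE" for Q n \<mu>
      unfolding opin_product
      by (rule msgn_msum) (use that in \<open>auto intro!: mhomogI simp del: upt_Suc product.simps\<close>)
    show "meq ?P (msgn ?P s) (msgn ?P t)"
      using r
    proof (cases rule: TAS_rel.cases)
      case 1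
      have RL: "meq ?P (msgn ?P (gR Q \<cdot> gL Q)) (gR Q \<cdot> gL Q)" "meq ?P (msgn ?P (gL Q \<cdot> gR Q)) (gL Q \<cdot> gR Q)"
        if "Q \<in> EE" for Q
      proof -
        have h: "mhomog ?P 0 [Strand, Pin Q] [Strand, Pin Q] (gR Q \<cdot> gL Q)"
          "mhomog ?P 0 [Pin Q, Strand] [Pin Q, Strand] (gL Q \<cdot> gR Q)"
          using that by (auto intro!: mhomogI)
        show "meq ?P (msgn ?P (gR Q \<cdot> gL Q)) (gR Q \<cdot> gL Q)" "meq ?P (msgn ?P (gL Q \<cdot> gR Q)) (gL Q \<cdot> gR Q)"
          using meq_trans[OF msgn_homogeneous[OF h(1)], unfolded sign_def simp_thms if_True, OF meq_scal_one[OF mhomog_mhom[OF h(1)]]]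
            meq_trans[OF msgn_homogeneous[OF h(2)], unfolded sign_def simp_thms if_True, OF meq_scal_one[OF mhomog_mhom[OF h(2)]]] .
      qed
      show ?thesis
      proof (cases "\<exists>Q n \<mu>. t = poly_dot n \<mu> \<otimes> idQ Q \<or> t = idQ Q \<otimes> poly_dot n \<mu>")
        case False
        then show ?thesis using common_rel_graded[OF TAS_pins par(4,5) 1] st by (intro msgn_relation) auto
      next
        case True
        have ex: "Q = (\<Sum>k\<le>n. csc (sign (of_nat k) * \<mu> k) (xo ^ k))"
          if "Q \<in> EE" "Q = (\<Sum>k\<le>n. csc (\<mu> k) (xo ^ k))" for Q n \<mu>
          using opol1_signed_expansion[of 0 \<mu> n] EE_hom[OF that(1)] that(2) by (simp add: sign_def)
        show ?thesis
          using 1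
        proof (cases rule: common_rel.cases)
          case (5 Q \<mu> n)
          have "meq ?P (gR Q \<cdot> gL Q) (poly_dot n (\<lambda>k. sign (of_nat k) * \<mu> k) \<otimes> idQ Q)"
            by (rule meq_rel, unfold rel, rule TAS_rel.intros(1), rule common_rel.intros(5)[OF 5(3) ex[OF 5(3,4)]])
          also have "meq ?P \<dots> (msgn ?P (poly_dot n \<mu>) \<otimes> idQ Q)"
            by (rule meq_sym, rule tens_cong[OF _ _ dots meq_refl[of _ "[Pin Q]" "[Pin Q]"]], rule msgn_mhom)
              (use 5(3) in \<open>auto simp: mhom_iff\<close>)
          finally show ?thesis using meq_trans[OF RL(1)[OF 5(3)]] 5(1,2) by simp
        next
          case (6 Q \<mu> n)
          have "meq ?P (gL Q \<cdot> gR Q) (idQ Q \<otimes> poly_dot n (\<lambda>k. sign (of_nat k) * \<mu> k))"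
            by (rule meq_rel, unfold rel, rule TAS_rel.intros(1), rule common_rel.intros(6)[OF 6(3) ex[OF 6(3,4)]])
          also have "meq ?P \<dots> (idQ Q \<otimes> msgn ?P (poly_dot n \<mu>))"
            by (rule meq_sym, rule tens_cong[OF _ _ meq_refl[of _ "[Pin Q]" "[Pin Q]"] dots], rule_tac [2] msgn_mhom)
              (use 6(3) in \<open>auto simp: mhom_iff\<close>)
          finally show ?thesis using meq_trans[OF RL(2)[OF 6(3)]] 6(1,2) by simp
        qed (use True in auto)
      qed
    next
      case (5 Q \<mu> n)
      let ?\<nu> = "\<lambda>r s. sign 1 * (sign (of_nat (r + s)) * \<mu> r s)"
      let ?V = "(idI \<otimes> gL Q) \<cdot> (gT \<otimes> idQ Q) \<cdot> (idI \<otimes> gR Q)" and ?o = "[Strand, Pin Q, Strand]"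
      have hom: "homogeneous 1 (odd_demazure (opol_at1 Q))"
        using odd_demazure_homogeneous[OF opol_at1_homogeneous, of 0 Q] EE_hom[OF 5(3)] by simp
      have U: "mhomog ?P 1 ?o ?o s" and V: "mhomog ?P 1 ?o ?o ?V"
        unfolding 5(1) using 5(3) by (auto intro!: mhomogI)
      note t = mhomog_mhom[OF U] mhomog_mhom[OF V]
      have o: "mhom ?P ?o ?o (opin Q n \<kappa>)" for \<kappa> using 5(3) by (simp add: mhom_iff)
      have "TAS_rel s (?V \<oplus> opin Q n ?\<nu>)"
        unfolding 5(1) using 5(3)
        by (rule TAS_rel.intros(5)) (use 5(4) opol2_signed_expansion[of 1 \<mu> n] hom in simp)
      then have sV: "meq ?P s (?V \<oplus> opin Q n ?\<nu>)" by (simp add: meq_rel rel)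
      have neg: "meq ?P (MScal (sign 1) (opin Q n ?\<nu>)) (opin Q n (\<lambda>r s. sign (of_nat (r + s)) * \<mu> r s))"
      proof -
        have "(\<lambda>i. MScal (sign 1 * ?\<nu> (fst i) (snd i)) (powX (fst i) \<otimes> idQ Q \<otimes> powX (snd i))) =
            (\<lambda>i. MScal (sign (of_nat (fst i + snd i)) * \<mu> (fst i) (snd i)) (powX (fst i) \<otimes> idQ Q \<otimes> powX (snd i)))"
          by (simp add: sign_def)
        then show ?thesis
          using scal_msum[of ?o ?o "List.product [0..<Suc n] [0..<Suc n]"
              "\<lambda>i. powX (fst i) \<otimes> idQ Q \<otimes> powX (snd i)" "sign 1" "\<lambda>i. ?\<nu> (fst i) (snd i)"] 5(3)
          unfolding opin_product by (simp only:) (simp add: mhom_iff)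
      qed
      have "meq ?P (msgn ?P s) (MScal (sign 1) s)" using U by (rule msgn_homogeneous)
      also have "meq ?P \<dots> (MScal (sign 1) (?V \<oplus> opin Q n ?\<nu>))" using t(1) sV by (rule scal_cong)
      also have "meq ?P \<dots> (MScal (sign 1) ?V \<oplus> MScal (sign 1) (opin Q n ?\<nu>))"
        using t(2) o by (rule meq_scal_add)
      also have "meq ?P \<dots> (msgn ?P ?V \<oplus> msgn ?P (opin Q n \<mu>))"
        using mhom.intros(5)[OF t(2)] mhom.intros(5)[OF o] meq_sym[OF msgn_homogeneous[OF V]]
          meq_trans[OF neg meq_sym[OF pindots[OF 5(3)]]] by (rule add_cong)
      finally show ?thesis unfolding 5(2) by simp
    qed (rule msgn_relation[OF st]; simp)+
  qed
qed

theorem TAH_graded: "graded_presentation TAH_pres"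
proof -
  interpret typed_presentation TAH_pres by (rule TAH_typed)
  interpret pin_presentation TAH_pres EE by (rule TAH_pins)
  have par [simp]: "par TAH_pres Cross = 0" "par TAH_pres Dot = 0" "par TAH_pres Token = 1"
    "par TAH_pres (RightPin Q) = 0" "par TAH_pres (LeftPin Q) = 0" for Q
    by (simp_all add: TAH_pres_def)
  have rel: "rel TAH_pres = TAH_rel" by (simp add: TAH_pres_def)
  let ?P = TAH_pres
  note EE_hom = CollectD[of _ "\<lambda>a. homogeneous 0 a \<and> supercentral 0 a \<and> regular a", folded EE_def]
  show ?thesis
  proof
    fix s t assume "rel ?P s t"
    then have r: "TAH_rel s t" and st: "meq ?P s t" by (simp_all add: rel meq_rel)
    have "mgraded ?P (msum a b (map (\<lambda>k. MScal (\<mu> k) (powX k)) ks)) \<and> mpar ?P (msum a b (map (\<lambda>k. MScal (\<mu> k) (powX k)) ks)) = 0"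
      for a b \<mu> ks by (induction ks) auto
    then have dots [simp]: "mgraded ?P (poly_dot n \<mu>)" "mpar ?P (poly_dot n \<mu>) = 0" for n \<mu>
      by (simp_all add: poly_dot_def del: upt_Suc)
    have pindots: "meq ?P (msgn ?P (pin Q n \<mu>)) (pin Q n (\<lambda>a b r s. sign (of_nat (a + b)) * \<mu> a b r s))"
      if "Q \<in> EE" for Q n \<mu>
      unfolding pin_product
      by (rule msgn_msum) (use that in \<open>auto intro!: mhomogI simp del: upt_Suc product.simps\<close>)
    show "meq ?P (msgn ?P s) (msgn ?P t)"
      using r
    proof (cases rule: TAH_rel.cases)
      case 1
      then have "mgraded ?P s \<and> mgraded ?P t \<and> mpar ?P s = mpar ?P t"
        by (cases rule: common_rel.cases) auto
      then show ?thesis using st by (intro msgn_relation) auto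
    next
      case (4 Q \<mu> n)
      let ?\<nu> = "\<lambda>a b r s. sign (of_nat (a + b)) * \<mu> a b r s"
      let ?V = "(idI \<otimes> gL Q) \<cdot> (gT \<otimes> idQ Q) \<cdot> (idI \<otimes> gR Q)" and ?o = "[Strand, Pin Q, Strand]"
      have hom: "homogeneous 0 (clifford_demazure (polcl_at1 Q))"
        using clifford_demazure_homogeneous[OF polcl_at1_homogeneous, of 0 Q] EE_hom[OF 4(3)] by simp
      have U: "mhomog ?P 0 ?o ?o s" and V: "mhomog ?P 0 ?o ?o ?V"
        unfolding 4(1) using 4(3) by (auto intro!: mhomogI)
      note t = mhomog_mhom[OF U] mhomog_mhom[OF V]
      have o: "mhom ?P ?o ?o (pin Q n \<kappa>)" for \<kappa> using 4(3) by (simp add: mhom_iff)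
      have sgn0: "meq ?P (msgn ?P f) f" if "mhomog ?P 0 a b f" for a b f
        using meq_trans[OF msgn_homogeneous[OF that], unfolded sign_def simp_thms if_True, OF meq_scal_one[OF mhomog_mhom[OF that]]] .
      have "TAH_rel s (?V \<ominus> pin Q n ?\<nu>)"
        unfolding 4(1) using 4(3)
        by (rule TAH_rel.intros(4)) (use 4(4) polcl2_signed_expansion[of \<mu> n] hom in simp)
      then have sV: "meq ?P s (?V \<ominus> pin Q n ?\<nu>)" by (simp add: meq_rel rel)
      have "meq ?P (msgn ?P s) s" using U by (rule sgn0)
      also have "meq ?P \<dots> (?V \<ominus> pin Q n ?\<nu>)" by (rule sV)
      also have "meq ?P \<dots> (msgn ?P ?V \<ominus> msgn ?P (pin Q n \<mu>))"
        using t(2) mhom.intros(5)[OF o] meq_sym[OF sgn0[OF V]] scal_cong[OF o meq_sym[OF pindots[OF 4(3)]]] by (rule add_cong)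
      finally show ?thesis unfolding 4(2) by simp
    qed (rule msgn_relation[OF st]; simp)+
  qed
qed

section \<open>Values of the defining relations\<close>

lemma (in word_supercategory) slide_comp:
  assumes t [simp]: "arr f" "dm f = a" "cd f = a" "arr g" "dm g = a" "cd g = a" "arr N" "dm N = a @ b" "cd N = b @ a"
    and b [simp]: "b \<in> Obj M"
    and f: "N \<odot> (f \<star> \<^bold>1 b) = (\<^bold>1 b \<star> f) \<odot> N" and g: "N \<odot> (g \<star> \<^bold>1 b) = (\<^bold>1 b \<star> g) \<odot> N"
  shows "N \<odot> ((f \<odot> g) \<star> \<^bold>1 b) = (\<^bold>1 b \<star> (f \<odot> g)) \<odot> N"
proof -
  have "N \<odot> ((f \<odot> g) \<star> \<^bold>1 b) = (N \<odot> (f \<star> \<^bold>1 b)) \<odot> (g \<star> \<^bold>1 b)"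
    by (simp add: calc comp_whisker_right)
  also have "\<dots> = (\<^bold>1 b \<star> f) \<odot> (N \<odot> (g \<star> \<^bold>1 b))" unfolding f by (simp add: calc)
  also have "\<dots> = ((\<^bold>1 b \<star> f) \<odot> (\<^bold>1 b \<star> g)) \<odot> N" unfolding g by (simp add: calc)
  finally show ?thesis by (simp add: comp_whisker_left)
qed

lemma (in word_supercategory) slide_comp':
  assumes t [simp]: "arr f" "dm f = a" "cd f = a" "arr g" "dm g = a" "cd g = a" "arr N" "dm N = b @ a" "cd N = a @ b"
    and b [simp]: "b \<in> Obj M"
    and f: "N \<odot> (\<^bold>1 b \<star> f) = (f \<star> \<^bold>1 b) \<odot> N" and g: "N \<odot> (\<^bold>1 b \<star> g) = (g \<star> \<^bold>1 b) \<odot> N"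
  shows "N \<odot> (\<^bold>1 b \<star> (f \<odot> g)) = ((f \<odot> g) \<star> \<^bold>1 b) \<odot> N"
proof -
  have "N \<odot> (\<^bold>1 b \<star> (f \<odot> g)) = (N \<odot> (\<^bold>1 b \<star> f)) \<odot> (\<^bold>1 b \<star> g)"
    by (simp add: calc comp_whisker_left)
  also have "\<dots> = (f \<star> \<^bold>1 b) \<odot> (N \<odot> (\<^bold>1 b \<star> g))" unfolding f by (simp add: calc)
  also have "\<dots> = ((f \<star> \<^bold>1 b) \<odot> (g \<star> \<^bold>1 b)) \<odot> N" unfolding g by (simp add: calc)
  finally show ?thesis by (simp add: comp_whisker_right)
qed

lemma sum_list_product:
  "sum_list (map f (List.product xs ys)) = sum_list (map (\<lambda>x. sum_list (map (\<lambda>y. f (x, y)) ys)) xs)"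
  by (induction xs) (simp_all add: comp_def)

lemma sum_list_atMost: "sum_list (map f [0..<Suc n]) = (\<Sum>k\<le>n. f k)"
  for f :: "nat \<Rightarrow> 'a::comm_monoid_add"
  by (induction n) (simp_all flip: add.assoc)

lemma sum_list_01: "sum_list (map f [0, 1]) = (\<Sum>k\<le>(1::nat). f k)"
  for f :: "nat \<Rightarrow> 'a::comm_monoid_add"
  by simp

context affine_frame
begin

text \<open>The values of letters and generators of either presentation; \<open>g\<close> translates the names of the
  pins, and \<open>D\<close> is the dot.\<close>

definition letter_word :: "('q \<Rightarrow> 'j) \<Rightarrow> 'q letter \<Rightarrow> 'k list" where
  "letter_word g l = (case l of Strand \<Rightarrow> [i] | Pin Q \<Rightarrow> [p (g Q)])"

definition gen_value :: "'m \<Rightarrow> 'm \<Rightarrow> ('q \<Rightarrow> 'j) \<Rightarrow> 'q dgen \<Rightarrow> 'm" where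
  "gen_value T D g d = (case d of Cross \<Rightarrow> T | Dot \<Rightarrow> D | Token \<Rightarrow> C | RightPin Q \<Rightarrow> R (g Q) | LeftPin Q \<Rightarrow> L (g Q))"

abbreviation "value_of T D g \<equiv> mval M (letter_word g) (gen_value T D g)"

lemma letter_word [simp]: "letter_word g Strand = [i]" "letter_word g (Pin Q) = [p (g Q)]"
  by (simp_all add: letter_word_def)

lemma gen_value [simp]: "gen_value T D g Cross = T" "gen_value T D g Dot = D" "gen_value T D g Token = C"
  "gen_value T D g (RightPin Q) = R (g Q)" "gen_value T D g (LeftPin Q) = L (g Q)"
  by (simp_all add: gen_value_def)

lemma ev1_rep: "algebra_rep ev1 [i]"
  unfolding algebra_rep_def by (simp add: hom_iff)

lemma ev1_gens: "ev1 pc = C" "ev1 px = X"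
  by simp_all

lemma value_msum:
  assumes \<Phi>: "algebra_rep \<Phi> a" and a: "concat (map (letter_word g) a') = a"
    and f: "\<And>k. k \<in> set ks \<Longrightarrow> value_of T D g (f k) = \<Phi> (F k)"
  shows "value_of T D g (msum a' a' (map f ks)) = \<Phi> (sum_list (map F ks))"
  using f
proof (induction ks)
  case Nil
  have "\<Phi> 0 = \<Phi> (csc 0 1)" by simp
  also have "\<dots> = 0 \<^bold>* \<Phi> 1" using \<Phi> unfolding algebra_rep_def by blast
  also have "\<dots> = ZeroM M a a" using \<Phi> scal_0[of "\<Phi> 1" a a] unfolding algebra_rep_def by blast
  finally show ?case by (simp add: a)
next
  case (Cons k ks)
  then show ?case using \<Phi> unfolding algebra_rep_def by simp
qed

lemma value_pow:
  assumes "D = ev1 y"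
  shows "value_of T D g (powX k) = ev1 (y ^ k)"
  by (induction k) (simp_all add: assms)

lemma value_poly_dot:
  assumes D: "D = ev1 y"
  shows "value_of T D g (poly_dot n \<mu>) = ev1 (\<Sum>k\<le>n. csc (\<mu> k) (y ^ k))"
  unfolding poly_dot_def sum_list_atMost[symmetric]
  by (rule value_msum[OF ev1_rep]) (simp_all add: value_pow[OF D])

lemma ev_powers:
  assumes u [simp]: "u \<in> Obj M" and D: "arr D" "dm D = [i]" "cd D = [i]"
    and y: "ev u y1 = D \<star> \<^bold>1 (u @ [i])" "ev u y2 = \<^bold>1 (i # u) \<star> D"
  shows "arr (value_of T D g (powX k))" "dm (value_of T D g (powX k)) = [i]" "cd (value_of T D g (powX k)) = [i]"
    and "ev u (y1 ^ k) = value_of T D g (powX k) \<star> \<^bold>1 (u @ [i])"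
    and "ev u (y2 ^ k) = \<^bold>1 (i # u) \<star> value_of T D g (powX k)"
proof -
  show t: "arr (value_of T D g (powX k))" "dm (value_of T D g (powX k)) = [i]" "cd (value_of T D g (powX k)) = [i]" for k
    by (induction k) (simp_all add: D)
  show "ev u (y1 ^ k) = value_of T D g (powX k) \<star> \<^bold>1 (u @ [i])"
    by (induction k) (simp_all add: ev_hom y comp_whisker_right t D calc)
  show "ev u (y2 ^ k) = \<^bold>1 (i # u) \<star> value_of T D g (powX k)"
    by (induction k) (simp_all add: ev_hom y comp_whisker_left t D calc)
qed

lemma value_powC:
  assumes u [simp]: "u \<in> Obj M"
  shows "arr (value_of T D g (powC k))" "dm (value_of T D g (powC k)) = [i]" "cd (value_of T D g (powC k)) = [i]"
    and "ev u (pcc First ^ k) = value_of T D g (powC k) \<star> \<^bold>1 (u @ [i])"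
    and "ev u (pcc Second ^ k) = \<^bold>1 (i # u) \<star> value_of T D g (powC k)"
proof -
  show t: "arr (value_of T D g (powC k))" "dm (value_of T D g (powC k)) = [i]" "cd (value_of T D g (powC k)) = [i]" for k
    by (induction k) simp_all
  show "ev u (pcc First ^ k) = value_of T D g (powC k) \<star> \<^bold>1 (u @ [i])"
    by (induction k) (simp_all add: ev_hom comp_whisker_right t calc)
  show "ev u (pcc Second ^ k) = \<^bold>1 (i # u) \<star> value_of T D g (powC k)"
    by (induction k) (simp_all add: ev_hom comp_whisker_left t calc)
qed

lemma tens_middle:
  assumes u: "u \<in> Obj M" and f: "arr f" "dm f = [i]" and h: "arr h" "cd h = [i]"
  shows "(f \<star> \<^bold>1 (u @ [i])) \<odot> (\<^bold>1 (i # u) \<star> h) = f \<star> \<^bold>1 u \<star> h"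
proof -
  have e: "\<^bold>1 [i] \<star> (\<^bold>1 u \<star> h) = \<^bold>1 (i # u) \<star> h"
    using calc(19)[OF h(1) i_obj u] by simp
  have h': "arr (\<^bold>1 u \<star> h)" "u @ [i] = cd (\<^bold>1 u \<star> h)" using u h by simp_all
  show ?thesis
    using tens_left_first[OF f(1) h' f(2)[symmetric]] unfolding e .
qed

lemma odot_typing [simp]: "arr odot" "dm odot = [i]" "cd odot = [i]"
  by (simp_all add: odot_def)

lemma value_opin:
  assumes j [simp]: "g Q \<in> J"
  shows "value_of T odot g (opin Q n \<mu>) =
    ev [p (g Q)] (opol_into_polcl w (\<Sum>r\<le>n. \<Sum>s\<le>n. csc (\<mu> r s) (ox First ^ r * ox Second ^ s)))"
proof -
  note hom = opol_into_polcl_hom[of w]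
  have f: "value_of T odot g (powX r \<otimes> idQ Q \<otimes> powX s) =
      ev [p (g Q)] (opol_into_polcl w (ox First ^ r * ox Second ^ s))" for r s
  proof -
    note pw = ev_powers[where u = "[p (g Q)]" and D = odot and T = T and g = g, OF p_obj[OF j] odot_typing odot_ev[OF p_obj[OF j], symmetric]]
    show ?thesis
      using tens_middle[of "[p (g Q)]"]
      by (simp add: alg_homD[OF hom] ev_hom pw calc del: csc_simps)
  qed
  have "value_of T odot g (opin Q n \<mu>) = ev [p (g Q)] (sum_list (map
      (\<lambda>i. csc (\<mu> (fst i) (snd i)) (opol_into_polcl w (ox First ^ fst i * ox Second ^ snd i)))
      (List.product [0..<Suc n] [0..<Suc n])))"
    unfolding opin_product
    by (rule value_msum[OF ev_rep[OF p_obj[OF j]]]) (simp_all add: f ev_hom del: mval.simps(7))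
  also have "sum_list (map (\<lambda>i. csc (\<mu> (fst i) (snd i)) (opol_into_polcl w (ox First ^ fst i * ox Second ^ snd i)))
      (List.product [0..<Suc n] [0..<Suc n])) =
      opol_into_polcl w (\<Sum>r\<le>n. \<Sum>s\<le>n. csc (\<mu> r s) (ox First ^ r * ox Second ^ s))"
    by (simp only: sum_list_product sum_list_atMost fst_conv snd_conv alg_hom_sum[OF hom] alg_homD(4)[OF hom])
  finally show ?thesis .
qed

lemma value_pin:
  assumes j [simp]: "g Q \<in> J"
  shows "value_of T X g (pin Q n \<mu>) = ev [p (g Q)] (\<Sum>a\<le>1. \<Sum>b\<le>1. \<Sum>r\<le>n. \<Sum>s\<le>n.
    csc (\<mu> a b r s) (pcc First ^ a * pcc Second ^ b * pcx First ^ r * pcx Second ^ s))"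
proof -
  have f: "value_of T X g ((powC a \<cdot> powX r) \<otimes> idQ Q \<otimes> (powC b \<cdot> powX s)) =
      ev [p (g Q)] (pcc First ^ a * pcc Second ^ b * pcx First ^ r * pcx Second ^ s)" for a b r s
  proof -
    note pw = ev_powers[where u = "[p (g Q)]" and D = X and T = T and g = g, OF p_obj[OF j] CX_typing(4-6) ev_gen(3,4)[OF p_obj[OF j]]]
      value_powC[where u = "[p (g Q)]" and D = X and T = T and g = g, OF p_obj[OF j]]
    have "pcc Second ^ b * pcx First ^ r = pcx First ^ r * pcc Second ^ b"
      by (intro power_commute power_commute[symmetric] polcl_rels) simp
    then have "pcc First ^ a * pcc Second ^ b * pcx First ^ r * pcx Second ^ s =
        (pcc First ^ a * pcx First ^ r) * (pcc Second ^ b * pcx Second ^ s)"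
      by (metis mult.assoc)
    then show ?thesis
      using tens_middle[of "[p (g Q)]"]
      by (simp add: ev_hom pw comp_whisker_left comp_whisker_right)
  qed
  have "value_of T X g (pin Q n \<mu>) = ev [p (g Q)] (sum_list (map
      (\<lambda>i. csc (\<mu> (fst i) (fst (snd i)) (fst (snd (snd i))) (snd (snd (snd i))))
        (pcc First ^ fst i * pcc Second ^ fst (snd i) * pcx First ^ fst (snd (snd i)) * pcx Second ^ snd (snd (snd i))))
      (List.product [0, 1] (List.product [0, 1] (List.product [0..<Suc n] [0..<Suc n])))))"
    unfolding pin_product
    by (rule value_msum[OF ev_rep[OF p_obj[OF j]]]) (simp_all add: f ev_hom(5) del: mval.simps(7) upt_Suc product.simps)
  then show ?thesis
    by (simp only: sum_list_product sum_list_atMost sum_list_01 fst_conv snd_conv)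
qed

text \<open>The relation \<open>R L = Q(X)\<close> and its mirror image. They are the same for both kinds of dot, since
  \<open>psi\<close> is compatible with \<open>x \<mapsto> C X / w\<close>.\<close>

definition pin_square :: bool where
  "pin_square \<longleftrightarrow> (\<forall>j\<in>J. R j \<odot> L j = ev1 (q j) \<star> \<^bold>1 [p j] \<and> L j \<odot> R j = \<^bold>1 [p j] \<star> ev1 (q j))"

lemma odot_slide:
  assumes j [simp]: "j \<in> J" and D: "D = X \<or> D = odot"
  shows "L j \<odot> (D \<star> \<^bold>1 [p j]) = (\<^bold>1 [p j] \<star> D) \<odot> L j" "R j \<odot> (\<^bold>1 [p j] \<star> D) = (D \<star> \<^bold>1 [p j]) \<odot> R j"
proof -
  have "L j \<odot> ((C \<odot> X) \<star> \<^bold>1 [p j]) = (\<^bold>1 [p j] \<star> (C \<odot> X)) \<odot> L j"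
    by (rule slide_comp[OF CX_typing]) (simp_all add: L_slide[OF j])
  moreover have "R j \<odot> (\<^bold>1 [p j] \<star> (C \<odot> X)) = ((C \<odot> X) \<star> \<^bold>1 [p j]) \<odot> R j"
    by (rule slide_comp'[OF CX_typing]) (simp_all add: R_slide[OF j])
  ultimately show "L j \<odot> (D \<star> \<^bold>1 [p j]) = (\<^bold>1 [p j] \<star> D) \<odot> L j"
    "R j \<odot> (\<^bold>1 [p j] \<star> D) = (D \<star> \<^bold>1 [p j]) \<odot> R j"
    using D L_slide[OF j] R_slide[OF j] by (auto simp: odot_def calc)
qed

lemma C_anticommute:
  assumes "D = X \<or> D = odot"
  shows "C \<odot> D = (-1) \<^bold>* (D \<odot> C)"
proof -
  have "C \<odot> C \<odot> X = (C \<odot> C) \<odot> X" by (simp add: calc)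
  then have 1: "C \<odot> C \<odot> X = X" by (simp add: CC calc)
  have "C \<odot> X \<odot> C = (C \<odot> X) \<odot> C" by (simp add: calc)
  also have "\<dots> = (-1) \<^bold>* X" unfolding CX by (simp add: calc CC)
  finally have 2: "C \<odot> X \<odot> C = (-1) \<^bold>* X" .
  have "C \<odot> odot = (-1) \<^bold>* (odot \<odot> C)" by (simp add: odot_def calc 1 2)
  then show ?thesis using assms CX by auto
qed

lemma value_common_rel:
  fixes g :: "'h::presentation salg \<Rightarrow> 'j"
  assumes T: "crossing r T" and D: "D = X \<or> D = odot" and J: "\<And>Q. Q \<in> EE \<Longrightarrow> g Q \<in> J" and sq: pin_square
    and poly: "\<And>Q n \<mu>. Q \<in> EE \<Longrightarrow> Q = (\<Sum>k\<le>n. csc (\<mu> k) (x ^ k)) \<Longrightarrow>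
      value_of T D g (poly_dot n \<mu>) = ev1 (q (g Q))"
    and rel: "common_rel x s t"
  shows "value_of T D g s = value_of T D g t"
proof -
  have [simp]: "arr D" "dm D = [i]" "cd D = [i]" using D by auto
  show ?thesis
    using rel
  proof (cases rule: common_rel.cases)
    case (5 Q \<mu> n)
    then show ?thesis using sq J[OF 5(3)] poly[OF 5(3,4)] by (simp add: pin_square_def)
  next
    case (6 Q \<mu> n)
    then show ?thesis using sq J[OF 6(3)] poly[OF 6(3,4)] by (simp add: pin_square_def)
  qed (use T J D CC C_anticommute[OF D] odot_slide[of _ D] L_slide R_slide in \<open>simp_all add: crossing_def calc(11)\<close>)
qed

lemma ev_hecke: "ev [] (- 1 - pcc First * pcc Second) = (-1) \<^bold>* \<^bold>1 [i, i] \<^bold>+ (-1) \<^bold>* (C \<star> C)"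
proof -
  have "- 1 - pcc First * pcc Second = csc (-1) 1 + csc (-1) (pcc First * pcc Second)"
    by (simp add: csc_minus_one)
  then show ?thesis
    by (simp only: ev_hom nil_obj ev_gen append.simps) (simp add: tens_left_first)
qed

lemma ev_uminus: "u \<in> Obj M \<Longrightarrow> ev u (- a) = (-1) \<^bold>* ev u a"
  using ev_hom(5)[of u "-1" a] by (simp add: csc_minus_one)

theorem even_crossing_value:
  assumes T: "even_crossing T" and J: "\<And>Q. Q \<in> EE \<Longrightarrow> g Q \<in> J" and q: "\<And>Q. Q \<in> EE \<Longrightarrow> q (g Q) = Q"
    and sq: pin_square and rel: "TAH_rel s t"
  shows "value_of T X g s = value_of T X g t"
proof -
  have Tp: "T \<in> Part M 0 [i, i] [i, i]" and Tc: "crossing 0 T" using T by (auto simp: even_crossing_def crossing_def)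
  note Th = part_hom[OF Tp]
  note [simp] = homD[OF Th]
  show ?thesis
    using rel
  proof (cases rule: TAH_rel.cases)
    case 1
    have "value_of T X g (poly_dot n \<mu>) = ev1 (q (g Q))" if "Q \<in> EE" "Q = (\<Sum>k\<le>n. csc (\<mu> k) (px ^ k))" for Q n \<mu>
      using value_poly_dot[OF ev1_gens(2)[symmetric], where T = T and g = g and n = n and \<mu> = \<mu>] that(2) q[OF that(1)] by simp
    with 1 show ?thesis by (intro value_common_rel[OF Tc disjI1[OF refl] J sq])
  next
    case 2
    then show ?thesis using T by (simp add: even_crossing_def)
  next
    case 3
    have "T \<odot> (X \<star> \<^bold>1 [i]) = (\<^bold>1 [i] \<star> X) \<odot> T \<^bold>+ ((-1) \<^bold>* \<^bold>1 [i, i] \<^bold>+ (-1) \<^bold>* (C \<star> C))"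
      using T by (simp add: even_crossing_def ev_hecke)
    also have "\<dots> = (\<^bold>1 [i] \<star> X) \<odot> T \<^bold>+ (-1) \<^bold>* \<^bold>1 [i, i] \<^bold>+ (-1) \<^bold>* (C \<star> C)"
      by (rule add_assoc[symmetric, of _ "[i, i]" "[i, i]"]) (simp_all add: hom_iff)
    finally show ?thesis using 3 by (simp add: calc(11))
  next
    case (4 Q \<mu> n)
    have "value_of T X g (pin Q n \<mu>) = ev [p (g Q)] (clifford_demazure (polcl_at1 Q))"
      unfolding 4(4) by (rule value_pin) (rule J[OF 4(3)])
    then show ?thesis
      using T J[OF 4(3)] q[OF 4(3)] 4(1,2)
      by (simp add: even_crossing_def over_pin_def under_pin_def ev_uminus)
  qed
qed

theorem odd_crossing_value:
  assumes T: "odd_crossing T" and J: "\<And>Q. Q \<in> EE \<Longrightarrow> g Q \<in> J" and q: "\<And>Q. Q \<in> EE \<Longrightarrow> q (g Q) = psi_E w Q"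
    and sq: pin_square and rel: "TAS_rel s t"
  shows "value_of T odot g s = value_of T odot g t"
proof -
  have Tp: "T \<in> Part M 1 [i, i] [i, i]" and Tc: "crossing 1 T" using T by (auto simp: odd_crossing_def crossing_def)
  note Th = part_hom[OF Tp]
  note [simp] = homD[OF Th]
  have od: "odot = ev1 (psi_E w xo)" by (simp add: odot_def psi_E_eq)
  show ?thesis
    using rel
  proof (cases rule: TAS_rel.cases)
    case 1
    have "value_of T odot g (poly_dot n \<mu>) = ev1 (q (g Q))" if "Q \<in> EE" "Q = (\<Sum>k\<le>n. csc (\<mu> k) (xo ^ k))" for Q n \<mu>
      unfolding value_poly_dot[OF od] q[OF that(1)]
      by (simp only: that(2) alg_hom_sum[OF psi_E_hom] alg_homD(4,6)[OF psi_E_hom])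
    with 1 show ?thesis by (intro value_common_rel[OF Tc disjI2[OF refl] J sq])
  next
    case (5 Q \<mu> n)
    show ?thesis
      using T J[OF 5(3)] q[OF 5(3)] value_opin[where g = g and Q = Q and T = T and n = n and \<mu> = \<mu>, OF J[OF 5(3)]] 5(1,2)
      by (simp add: odd_crossing_def over_pin_def under_pin_def demazure_compare[OF w] opol_into_polcl_at1
          flip: 5(4))
  qed (use T in \<open>simp_all add: odd_crossing_def calc(11)\<close>)
qed

lemma crossingI:
  fixes g :: "'h::presentation salg \<Rightarrow> 'j"
  assumes T: "T \<in> Part M r [i, i] [i, i]" and J: "J = g ` EE"
    and rel: "\<And>s t. common_rel x s t \<Longrightarrow> value_of T D g s = value_of T D g t"
  shows "crossing r T"
proof -
  have EJ: "g Q \<in> J" if "Q \<in> EE" for Q using J that by blast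
  have all: "\<forall>j\<in>J. A j" if "\<And>Q. Q \<in> EE \<Longrightarrow> A (g Q)" for A using J that by blast
  note [simp] = homD[OF part_hom[OF T]]
  note r = common_rel.intros[THEN rel]
  show ?thesis
    unfolding crossing_def
    by (intro conjI all) (use T r(1,2,7,8) EJ in \<open>simp_all add: calc(11)\<close>)
qed

text \<open>Expansions exist, so that the relations of the presentation, which are imposed for each
  expansion, give those in terms of \<open>ev\<close>.\<close>

theorem even_crossingI:
  assumes T: "T \<in> Part M 0 [i, i] [i, i]" and J: "J = g ` EE" and q: "\<And>Q. Q \<in> EE \<Longrightarrow> q (g Q) = Q"
    and rel: "\<And>s t. TAH_rel s t \<Longrightarrow> value_of T X g s = value_of T X g t"
  shows "even_crossing T" "pin_square"
proof -
  have EJ: "g Q \<in> J" if "Q \<in> EE" for Q using J that by blast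
  have all: "\<forall>j\<in>J. A j" if "\<And>Q. Q \<in> EE \<Longrightarrow> A (g Q)" for A using J that by blast
  note [simp] = homD[OF part_hom[OF T]]
  note r = TAH_rel.intros[THEN rel]
  have cr: "crossing 0 T" by (rule crossingI[OF T J r(1)])
  have "R (g Q) \<odot> L (g Q) = ev1 (q (g Q)) \<star> \<^bold>1 [p (g Q)] \<and> L (g Q) \<odot> R (g Q) = \<^bold>1 [p (g Q)] \<star> ev1 (q (g Q))"
    if Q: "Q \<in> EE" for Q
  proof -
    obtain n \<mu> where e: "Q = (\<Sum>k\<le>n. csc (\<mu> k) (px ^ k))" using EE_polcl_expansion[OF Q] by blast
    have v: "value_of T X g (poly_dot n \<mu>) = ev1 (q (g Q))"
      using value_poly_dot[OF ev1_gens(2)[symmetric], where T = T and g = g and n = n and \<mu> = \<mu>] e q[OF Q] by simp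
    show ?thesis
      using r(1)[OF common_rel.intros(5)[OF Q e]] r(1)[OF common_rel.intros(6)[OF Q e]] v by simp
  qed
  then show pin_square unfolding pin_square_def by (rule all)
  have pins: "over_pin (g Q) T = under_pin (g Q) T \<^bold>+ ev [p (g Q)] (- clifford_demazure (polcl_at1 (q (g Q))))"
    if Q: "Q \<in> EE" for Q
  proof -
    obtain n \<mu> where e: "clifford_demazure (polcl_at1 Q) = (\<Sum>a\<le>1. \<Sum>b\<le>1. \<Sum>r\<le>n. \<Sum>s\<le>n.
        csc (\<mu> a b r s) (pcc First ^ a * pcc Second ^ b * pcx First ^ r * pcx Second ^ s))"
      using polcl2_expansion[of "clifford_demazure (polcl_at1 Q)"] by (elim exE)
    have "value_of T X g (pin Q n \<mu>) = ev [p (g Q)] (clifford_demazure (polcl_at1 Q))"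
      unfolding e by (rule value_pin) (rule EJ[OF Q])
    then show ?thesis
      using r(4)[OF Q e] EJ[OF Q] q[OF Q]
      by (simp add: over_pin_def under_pin_def ev_uminus)
  qed
  have "T \<odot> (X \<star> \<^bold>1 [i]) = (\<^bold>1 [i] \<star> X) \<odot> T \<^bold>+ ((-1) \<^bold>* \<^bold>1 [i, i] \<^bold>+ (-1) \<^bold>* (C \<star> C))"
    using r(3) add_assoc[of "(\<^bold>1 [i] \<star> X) \<odot> T" "[i, i]" "[i, i]" "(-1) \<^bold>* \<^bold>1 [i, i]" "(-1) \<^bold>* (C \<star> C)"]
    by (simp add: calc(11) hom_iff)
  then show "even_crossing T"
    unfolding even_crossing_def by (intro conjI all cr pins) (use r(2) in \<open>simp_all add: ev_hecke\<close>)
qed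

theorem odd_crossingI:
  assumes T: "T \<in> Part M 1 [i, i] [i, i]" and J: "J = g ` EE" and q: "\<And>Q. Q \<in> EE \<Longrightarrow> q (g Q) = psi_E w Q"
    and rel: "\<And>s t. TAS_rel s t \<Longrightarrow> value_of T odot g s = value_of T odot g t"
  shows "odd_crossing T" "pin_square"
proof -
  have EJ: "g Q \<in> J" if "Q \<in> EE" for Q using J that by blast
  have all: "\<forall>j\<in>J. A j" if "\<And>Q. Q \<in> EE \<Longrightarrow> A (g Q)" for A using J that by blast
  note [simp] = homD[OF part_hom[OF T]]
  note r = TAS_rel.intros[THEN rel]
  have od: "odot = ev1 (psi_E w xo)" by (simp add: odot_def psi_E_eq)
  have cr: "crossing 1 T" by (rule crossingI[OF T J r(1)])
  have "R (g Q) \<odot> L (g Q) = ev1 (q (g Q)) \<star> \<^bold>1 [p (g Q)] \<and> L (g Q) \<odot> R (g Q) = \<^bold>1 [p (g Q)] \<star> ev1 (q (g Q))"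
    if Q: "Q \<in> EE" for Q
  proof -
    obtain n \<mu> where e: "Q = (\<Sum>k\<le>n. csc (\<mu> k) (xo ^ k))" using opol1_expansion by blast
    have v: "value_of T odot g (poly_dot n \<mu>) = ev1 (q (g Q))"
      unfolding value_poly_dot[OF od] q[OF Q]
      by (simp only: e alg_hom_sum[OF psi_E_hom] alg_homD(4,6)[OF psi_E_hom])
    show ?thesis
      using r(1)[OF common_rel.intros(5)[OF Q e]] r(1)[OF common_rel.intros(6)[OF Q e]] v by simp
  qed
  then show pin_square unfolding pin_square_def by (rule all)
  have pins: "over_pin (g Q) T = under_pin (g Q) T \<^bold>+ ev [p (g Q)] (csc (1 / w) (cdiff * clifford_demazure (polcl_at1 (q (g Q)))))"
    if Q: "Q \<in> EE" for Q
  proof -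
    obtain n \<mu> where e: "odd_demazure (opol_at1 Q) = (\<Sum>r\<le>n. \<Sum>s\<le>n. csc (\<mu> r s) (ox First ^ r * ox Second ^ s))"
      using opol2_expansion[of "odd_demazure (opol_at1 Q)"] by (elim exE)
    show ?thesis
      using r(5)[OF Q e] value_opin[where g = g and Q = Q and T = T and n = n and \<mu> = \<mu>, OF EJ[OF Q]] EJ[OF Q] q[OF Q]
      by (simp add: over_pin_def under_pin_def demazure_compare[OF w] opol_into_polcl_at1 flip: e)
  qed
  show "odd_crossing T"
    unfolding odd_crossing_def by (intro conjI all cr pins) (use r(2-4) in \<open>simp_all add: calc(11)\<close>)
qed

end

section \<open>The isomorphism\<close>

context affine_frame
begin

lemma twist_expand:
  assumes "T \<in> Hom M [i, i] [i, i]"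
  shows "ev [] (csc z cdiff) \<odot> T = z \<^bold>* ((C \<star> \<^bold>1 [i] \<^bold>+ (-1) \<^bold>* (\<^bold>1 [i] \<star> C)) \<odot> T)"
  using homD[OF assms] by (simp add: ev_hom ev_minus calc(6))

lemma twist_twist:
  assumes "T \<in> Hom M [i, i] [i, i]" and z: "z * z' * 2 = 1"
  shows "ev [] (csc z cdiff) \<odot> ev [] (csc z' cdiff) \<odot> T = T"
proof -
  have "csc z cdiff * csc z' cdiff = csc (z * z') (cdiff * cdiff)" by (simp only: csc_simps mult.commute)
  also have "\<dots> = 1" unfolding cdiff_square using z by (simp only: csc_simps)
  finally show ?thesis
    using homD[OF assms(1)] by (simp only: ev_mult nil_obj append.simps) (simp add: ev_hom calc(2))
qed

lemma odot_part: "odot \<in> Part M 1 [i] [i]"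
  using scal_part[OF comp_part[OF C_part X_part]] by (simp add: odot_def)

lemma dot_of_odot: "w \<^bold>* (C \<odot> odot) = X"
proof -
  have "C \<odot> C \<odot> X = (C \<odot> C) \<odot> X" by (simp add: calc)
  then have "C \<odot> C \<odot> X = X" by (simp add: CC calc)
  then show ?thesis using w_reciprocal(1) by (simp add: odot_def calc)
qed

lemma value_typed:
  assumes P: "pin_presentation P E" and J: "\<And>Q. Q \<in> E \<Longrightarrow> g Q \<in> J"
    and par: "par P Cross = r" "par P Dot = r" "par P Token = 1"
      "\<And>Q. par P (RightPin Q) = 0" "\<And>Q. par P (LeftPin Q) = 0"
    and T: "T \<in> Part M r [i, i] [i, i]" and D: "D \<in> Part M r [i] [i]"
    and P': "graded_presentation P"
    and rel: "\<And>s t. rel P s t \<Longrightarrow> value_of T D g s = value_of T D g t"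
  shows "representation P M (letter_word g) (gen_value T D g)"
proof -
  interpret P: pin_presentation P E by (rule P)
  show ?thesis
  proof (intro representation.intro P' representation_axioms.intro rel)
    show "word_supercategory M" by (rule word_supercategory_axioms)
    show "letter_word g l \<in> Obj M" if "l \<in> letters P" for l
      using that J by auto
    show "gen_value T D g d \<in> Part M (par P d) (concat (map (letter_word g) (src P d))) (concat (map (letter_word g) (tgt P d)))"
      if "d \<in> gens P" for d
      using that J T D C_part R_part L_part by (auto simp: par)
  qed
qed

end

lemma TAH_rel_eq: "TAH_rel s t \<Longrightarrow> \<lbrakk>s\<rbrakk>\<^sub>H = \<lbrakk>t\<rbrakk>\<^sub>H"
  using typed_presentation.mcls_eqI[OF TAH_typed meq_rel] by (simp add: TAH_pres_def)

lemma TAS_rel_eq: "TAS_rel s t \<Longrightarrow> \<lbrakk>s\<rbrakk>\<^sub>S = \<lbrakk>t\<rbrakk>\<^sub>S"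
  using typed_presentation.mcls_eqI[OF TAS_typed meq_rel] by (simp add: TAS_pres_def)

lemma TAH_part: "mwf TAH_pres t \<Longrightarrow> mgraded TAH_pres t \<Longrightarrow> p = mpar TAH_pres t \<Longrightarrow> a = mdom TAH_pres t \<Longrightarrow>
    b = mcod TAH_pres t \<Longrightarrow> \<lbrakk>t\<rbrakk>\<^sub>H \<in> Part TAH p a b"
  by (intro typed_presentation.presented_PartI[OF TAH_typed] mhomogI)

lemma TAS_part: "mwf TAS_pres t \<Longrightarrow> mgraded TAS_pres t \<Longrightarrow> p = mpar TAS_pres t \<Longrightarrow> a = mdom TAS_pres t \<Longrightarrow>
    b = mcod TAS_pres t \<Longrightarrow> \<lbrakk>t\<rbrakk>\<^sub>S \<in> Part TAS p a b"
  by (intro typed_presentation.presented_PartI[OF TAS_typed] mhomogI)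

lemma TAH_frame:
  assumes w: "w\<^sup>2 = -2"
  shows "affine_frame TAH w Strand EE Pin \<lbrakk>gC\<rbrakk>\<^sub>H \<lbrakk>gX\<rbrakk>\<^sub>H (\<lambda>Q. \<lbrakk>gR Q\<rbrakk>\<^sub>H) (\<lambda>Q. \<lbrakk>gL Q\<rbrakk>\<^sub>H)"
proof (intro affine_frame.intro affine_frame_axioms.intro w)
  interpret graded_presentation TAH_pres by (rule TAH_graded)
  interpret pin_presentation TAH_pres EE by (rule TAH_pins)
  note r = common_rel.intros[THEN TAH_rel.intros(1), THEN TAH_rel_eq]
  show "word_supercategory TAH" by (rule presented_words)
  show "[Strand] \<in> Obj TAH" "\<And>j. j \<in> EE \<Longrightarrow> [Pin j] \<in> Obj TAH" by simp_all
  show "\<lbrakk>gC\<rbrakk>\<^sub>H \<in> Part TAH 1 [Strand] [Strand]" "\<lbrakk>gX\<rbrakk>\<^sub>H \<in> Part TAH 0 [Strand] [Strand]"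
    "\<And>j. j \<in> EE \<Longrightarrow> \<lbrakk>gR j\<rbrakk>\<^sub>H \<in> Part TAH 0 [Pin j, Strand] [Strand, Pin j]"
    "\<And>j. j \<in> EE \<Longrightarrow> \<lbrakk>gL j\<rbrakk>\<^sub>H \<in> Part TAH 0 [Strand, Pin j] [Pin j, Strand]"
    by (auto intro!: TAH_part) (simp_all add: TAH_pres_def)
  show "Comp TAH \<lbrakk>gC\<rbrakk>\<^sub>H \<lbrakk>gC\<rbrakk>\<^sub>H = Ident TAH [Strand]"
    "Comp TAH \<lbrakk>gC\<rbrakk>\<^sub>H \<lbrakk>gX\<rbrakk>\<^sub>H = Scal TAH (-1) (Comp TAH \<lbrakk>gX\<rbrakk>\<^sub>H \<lbrakk>gC\<rbrakk>\<^sub>H)"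
    using r(9,10) by simp_all
  show "Comp TAH \<lbrakk>gL j\<rbrakk>\<^sub>H (Tens TAH Y (Ident TAH [Pin j])) = Comp TAH (Tens TAH (Ident TAH [Pin j]) Y) \<lbrakk>gL j\<rbrakk>\<^sub>H"
    if "j \<in> EE" "Y \<in> {\<lbrakk>gC\<rbrakk>\<^sub>H, \<lbrakk>gX\<rbrakk>\<^sub>H}" for j Y
    using that r(3,11)[OF that(1)] by auto
  show "Comp TAH \<lbrakk>gR j\<rbrakk>\<^sub>H (Tens TAH (Ident TAH [Pin j]) Y) = Comp TAH (Tens TAH Y (Ident TAH [Pin j])) \<lbrakk>gR j\<rbrakk>\<^sub>H"
    if "j \<in> EE" "Y \<in> {\<lbrakk>gC\<rbrakk>\<^sub>H, \<lbrakk>gX\<rbrakk>\<^sub>H}" for j Y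
    using that r(4,12)[OF that(1)] by auto
qed

text \<open>The product of the token and an odd dot is even, and it slides past pins because both factors do.\<close>

lemma (in word_supercategory) odd_dot_frame:
  assumes w: "w\<^sup>2 = -2"
    and obj: "[i] \<in> Obj M" "\<And>j. j \<in> J \<Longrightarrow> [p j] \<in> Obj M"
    and C_part: "C \<in> Part M 1 [i] [i]" and x_part: "x \<in> Part M 1 [i] [i]"
    and R_part: "\<And>j. j \<in> J \<Longrightarrow> R j \<in> Part M 0 [p j, i] [i, p j]"
    and L_part: "\<And>j. j \<in> J \<Longrightarrow> L j \<in> Part M 0 [i, p j] [p j, i]"
    and CC: "C \<odot> C = \<^bold>1 [i]" and Cx: "C \<odot> x = (-1) \<^bold>* (x \<odot> C)"
    and L_slide: "\<And>j. j \<in> J \<Longrightarrow> L j \<odot> (C \<star> \<^bold>1 [p j]) = (\<^bold>1 [p j] \<star> C) \<odot> L j"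
      "\<And>j. j \<in> J \<Longrightarrow> L j \<odot> (x \<star> \<^bold>1 [p j]) = (\<^bold>1 [p j] \<star> x) \<odot> L j"
    and R_slide: "\<And>j. j \<in> J \<Longrightarrow> R j \<odot> (\<^bold>1 [p j] \<star> C) = (C \<star> \<^bold>1 [p j]) \<odot> R j"
      "\<And>j. j \<in> J \<Longrightarrow> R j \<odot> (\<^bold>1 [p j] \<star> x) = (x \<star> \<^bold>1 [p j]) \<odot> R j"
  shows "affine_frame M w i J p C (w \<^bold>* (C \<odot> x)) R L" "(1 / w) \<^bold>* (C \<odot> (w \<^bold>* (C \<odot> x))) = x"
proof -
  note t [simp] = homD[OF part_hom[OF C_part]] homD[OF part_hom[OF x_part]]
  have w0: "w \<noteq> 0" using w by auto
  have "C \<odot> C \<odot> x = (C \<odot> C) \<odot> x" by (simp add: calc)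
  then have CCx: "C \<odot> C \<odot> x = x" by (simp add: CC calc)
  have "C \<odot> x \<odot> C = (C \<odot> x) \<odot> C" by (simp add: calc)
  also have "\<dots> = (-1) \<^bold>* x" unfolding Cx by (simp add: calc CC)
  finally have CxC: "C \<odot> x \<odot> C = (-1) \<^bold>* x" .
  show "(1 / w) \<^bold>* (C \<odot> (w \<^bold>* (C \<odot> x))) = x" using w0 by (simp add: calc CCx)
  have part: "w \<^bold>* (C \<odot> x) \<in> Part M 0 [i] [i]"
    using scal_part[OF comp_part[OF C_part x_part]] by simp
  have CX: "C \<odot> (w \<^bold>* (C \<odot> x)) = (-1) \<^bold>* ((w \<^bold>* (C \<odot> x)) \<odot> C)"
    by (simp add: calc CCx CxC)
  have L: "L j \<odot> ((w \<^bold>* (C \<odot> x)) \<star> \<^bold>1 [p j]) = (\<^bold>1 [p j] \<star> (w \<^bold>* (C \<odot> x))) \<odot> L j"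
    and R: "R j \<odot> (\<^bold>1 [p j] \<star> (w \<^bold>* (C \<odot> x))) = ((w \<^bold>* (C \<odot> x)) \<star> \<^bold>1 [p j]) \<odot> R j" if j: "j \<in> J" for j
  proof -
    note [simp] = homD[OF part_hom[OF L_part[OF j]]] homD[OF part_hom[OF R_part[OF j]]] obj(1) obj(2)[OF j]
    have "L j \<odot> ((C \<odot> x) \<star> \<^bold>1 [p j]) = (\<^bold>1 [p j] \<star> (C \<odot> x)) \<odot> L j"
      by (rule slide_comp[OF t _ _ _ _ L_slide(1,2)[OF j]]) simp_all
    moreover have "R j \<odot> (\<^bold>1 [p j] \<star> (C \<odot> x)) = ((C \<odot> x) \<star> \<^bold>1 [p j]) \<odot> R j"
      by (rule slide_comp'[OF t _ _ _ _ R_slide(1,2)[OF j]]) simp_all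
    ultimately show "L j \<odot> ((w \<^bold>* (C \<odot> x)) \<star> \<^bold>1 [p j]) = (\<^bold>1 [p j] \<star> (w \<^bold>* (C \<odot> x))) \<odot> L j"
      "R j \<odot> (\<^bold>1 [p j] \<star> (w \<^bold>* (C \<odot> x))) = ((w \<^bold>* (C \<odot> x)) \<star> \<^bold>1 [p j]) \<odot> R j"
      by (simp_all add: calc)
  qed
  show "affine_frame M w i J p C (w \<^bold>* (C \<odot> x)) R L"
  proof (intro affine_frame.intro affine_frame_axioms.intro w obj C_part part R_part L_part CC CX)
    show "word_supercategory M" by (rule word_supercategory_axioms)
  qed (use L R L_slide(1) R_slide(1) in blast)+
qed

lemma TAS_frame:
  assumes w: "w\<^sup>2 = -2"
  shows "affine_frame TAS w Strand EE Pin \<lbrakk>gC\<rbrakk>\<^sub>S \<lbrakk>MScal w (gC \<cdot> gX)\<rbrakk>\<^sub>S (\<lambda>Q. \<lbrakk>gR Q\<rbrakk>\<^sub>S) (\<lambda>Q. \<lbrakk>gL Q\<rbrakk>\<^sub>S)"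
    and "Scal TAS (1 / w) (Comp TAS \<lbrakk>gC\<rbrakk>\<^sub>S \<lbrakk>MScal w (gC \<cdot> gX)\<rbrakk>\<^sub>S) = \<lbrakk>gX\<rbrakk>\<^sub>S"
proof -
  interpret graded_presentation TAS_pres by (rule TAS_graded)
  interpret pin_presentation TAS_pres EE by (rule TAS_pins)
  note r = common_rel.intros[THEN TAS_rel.intros(1), THEN TAS_rel_eq]
  have obj: "[Strand] \<in> Obj TAS" "\<And>j. j \<in> EE \<Longrightarrow> [Pin j] \<in> Obj TAS" by simp_all
  have parts: "\<lbrakk>gC\<rbrakk>\<^sub>S \<in> Part TAS 1 [Strand] [Strand]" "\<lbrakk>gX\<rbrakk>\<^sub>S \<in> Part TAS 1 [Strand] [Strand]"
    "\<And>j. j \<in> EE \<Longrightarrow> \<lbrakk>gR j\<rbrakk>\<^sub>S \<in> Part TAS 0 [Pin j, Strand] [Strand, Pin j]"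
    "\<And>j. j \<in> EE \<Longrightarrow> \<lbrakk>gL j\<rbrakk>\<^sub>S \<in> Part TAS 0 [Strand, Pin j] [Pin j, Strand]"
    by (auto intro!: TAS_part) (simp_all add: TAS_pres_def)
  have X: "\<lbrakk>MScal w (gC \<cdot> gX)\<rbrakk>\<^sub>S = Scal TAS w (Comp TAS \<lbrakk>gC\<rbrakk>\<^sub>S \<lbrakk>gX\<rbrakk>\<^sub>S)" by simp
  have C: "Comp TAS \<lbrakk>gC\<rbrakk>\<^sub>S \<lbrakk>gC\<rbrakk>\<^sub>S = Ident TAS [Strand]"
    "Comp TAS \<lbrakk>gC\<rbrakk>\<^sub>S \<lbrakk>gX\<rbrakk>\<^sub>S = Scal TAS (-1) (Comp TAS \<lbrakk>gX\<rbrakk>\<^sub>S \<lbrakk>gC\<rbrakk>\<^sub>S)"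
    using r(9,10) by simp_all
  have slides: "Comp TAS \<lbrakk>gL j\<rbrakk>\<^sub>S (Tens TAS \<lbrakk>gC\<rbrakk>\<^sub>S (Ident TAS [Pin j])) = Comp TAS (Tens TAS (Ident TAS [Pin j]) \<lbrakk>gC\<rbrakk>\<^sub>S) \<lbrakk>gL j\<rbrakk>\<^sub>S"
    "Comp TAS \<lbrakk>gL j\<rbrakk>\<^sub>S (Tens TAS \<lbrakk>gX\<rbrakk>\<^sub>S (Ident TAS [Pin j])) = Comp TAS (Tens TAS (Ident TAS [Pin j]) \<lbrakk>gX\<rbrakk>\<^sub>S) \<lbrakk>gL j\<rbrakk>\<^sub>S"
    "Comp TAS \<lbrakk>gR j\<rbrakk>\<^sub>S (Tens TAS (Ident TAS [Pin j]) \<lbrakk>gC\<rbrakk>\<^sub>S) = Comp TAS (Tens TAS \<lbrakk>gC\<rbrakk>\<^sub>S (Ident TAS [Pin j])) \<lbrakk>gR j\<rbrakk>\<^sub>S"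
    "Comp TAS \<lbrakk>gR j\<rbrakk>\<^sub>S (Tens TAS (Ident TAS [Pin j]) \<lbrakk>gX\<rbrakk>\<^sub>S) = Comp TAS (Tens TAS \<lbrakk>gX\<rbrakk>\<^sub>S (Ident TAS [Pin j])) \<lbrakk>gR j\<rbrakk>\<^sub>S"
    if "j \<in> EE" for j
    using r(3,4,11,12)[OF that] by simp_all
  note frame = word_supercategory.odd_dot_frame[OF presented_words w obj parts C slides]
  show "affine_frame TAS w Strand EE Pin \<lbrakk>gC\<rbrakk>\<^sub>S \<lbrakk>MScal w (gC \<cdot> gX)\<rbrakk>\<^sub>S (\<lambda>Q. \<lbrakk>gR Q\<rbrakk>\<^sub>S) (\<lambda>Q. \<lbrakk>gL Q\<rbrakk>\<^sub>S)"
    unfolding X by (rule frame(1))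
  show "Scal TAS (1 / w) (Comp TAS \<lbrakk>gC\<rbrakk>\<^sub>S \<lbrakk>MScal w (gC \<cdot> gX)\<rbrakk>\<^sub>S) = \<lbrakk>gX\<rbrakk>\<^sub>S"
    unfolding X by (rule frame(2))
qed

theorem theoremA:
  fixes w :: complex
  assumes "w\<^sup>2 = -2"
  shows "\<exists>Fo Fm Go Gm.
    inverse_superfunctors TAS TAH Fo Fm Go Gm \<and>
    Fo [Strand] = [Strand] \<and>
    (\<forall>Q\<in>EE. psi_E w Q \<in> EE \<and> Fo [Pin Q] = [Pin (psi_E w Q)]) \<and>
    Fm \<lbrakk>gC\<rbrakk>\<^sub>S = \<lbrakk>gC\<rbrakk>\<^sub>H \<and>
    Fm \<lbrakk>gX\<rbrakk>\<^sub>S = \<lbrakk>MScal (1 / w) (gC \<cdot> gX)\<rbrakk>\<^sub>H \<and>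
    Fm \<lbrakk>gT\<rbrakk>\<^sub>S = \<lbrakk>MScal (- (1 / w)) ((gC \<otimes> idI \<ominus> idI \<otimes> gC) \<cdot> gT)\<rbrakk>\<^sub>H \<and>
    (\<forall>Q\<in>EE. Fm \<lbrakk>gR Q\<rbrakk>\<^sub>S = \<lbrakk>gR (psi_E w Q)\<rbrakk>\<^sub>H \<and> Fm \<lbrakk>gL Q\<rbrakk>\<^sub>S = \<lbrakk>gL (psi_E w Q)\<rbrakk>\<^sub>H) \<and>
    Go [Strand] = [Strand] \<and>
    (\<forall>Q\<in>EE. psi_E_inv w Q \<in> EE \<and> Go [Pin Q] = [Pin (psi_E_inv w Q)]) \<and>
    Gm \<lbrakk>gC\<rbrakk>\<^sub>H = \<lbrakk>gC\<rbrakk>\<^sub>S \<and>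
    Gm \<lbrakk>gX\<rbrakk>\<^sub>H = \<lbrakk>MScal w (gC \<cdot> gX)\<rbrakk>\<^sub>S \<and>
    Gm \<lbrakk>gT\<rbrakk>\<^sub>H = \<lbrakk>MScal (1 / w) ((gC \<otimes> idI \<ominus> idI \<otimes> gC) \<cdot> gT)\<rbrakk>\<^sub>S \<and>
    (\<forall>Q\<in>EE. Gm \<lbrakk>gR Q\<rbrakk>\<^sub>H = \<lbrakk>gR (psi_E_inv w Q)\<rbrakk>\<^sub>S \<and> Gm \<lbrakk>gL Q\<rbrakk>\<^sub>H = \<lbrakk>gL (psi_E_inv w Q)\<rbrakk>\<^sub>S)"
proof -
  note w = assms
  interpret S: graded_presentation TAS_pres by (rule TAS_graded)
  interpret H: graded_presentation TAH_pres by (rule TAH_graded)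
  interpret SP: pin_presentation TAS_pres EE by (rule TAS_pins)
  interpret HP: pin_presentation TAH_pres EE by (rule TAH_pins)
  interpret FH: affine_frame TAH w Strand EE Pin "\<lambda>Q. Q" "\<lbrakk>gC\<rbrakk>\<^sub>H" "\<lbrakk>gX\<rbrakk>\<^sub>H" "\<lambda>Q. \<lbrakk>gR Q\<rbrakk>\<^sub>H" "\<lambda>Q. \<lbrakk>gL Q\<rbrakk>\<^sub>H"
    using w by (rule TAH_frame)
  interpret FS: affine_frame TAS w Strand EE Pin "psi_E w" "\<lbrakk>gC\<rbrakk>\<^sub>S" "\<lbrakk>MScal w (gC \<cdot> gX)\<rbrakk>\<^sub>S" "\<lambda>Q. \<lbrakk>gR Q\<rbrakk>\<^sub>S" "\<lambda>Q. \<lbrakk>gL Q\<rbrakk>\<^sub>S"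
    using w by (rule TAS_frame)
  have odot: "FS.odot = \<lbrakk>gX\<rbrakk>\<^sub>S" unfolding FS.odot_def using w by (rule TAS_frame)
  have lw: "FH.letter_word (\<lambda>Q. Q) = (\<lambda>l. [l])" "FS.letter_word (\<lambda>Q. Q) = (\<lambda>l. [l])"
    by (auto simp: FH.letter_word_def FS.letter_word_def fun_eq_iff split: letter.split)
  have words: "concat (map (\<lambda>l. [l]) a) = a" for a :: "'a list" by (induction a) simp_all
  \<comment> \<open>With these values a term stands for itself, so the relations of the presentation are at hand.\<close>
  have idH: "FH.value_of \<lbrakk>gT\<rbrakk>\<^sub>H \<lbrakk>gX\<rbrakk>\<^sub>H (\<lambda>Q. Q) t = \<lbrakk>t\<rbrakk>\<^sub>H" for t
  proof (induction t)
    case (MGen d)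
    show ?case by (cases d) simp_all
  qed (simp_all add: lw words)
  have idS: "FS.value_of \<lbrakk>gT\<rbrakk>\<^sub>S \<lbrakk>gX\<rbrakk>\<^sub>S (\<lambda>Q. Q) t = \<lbrakk>t\<rbrakk>\<^sub>S" for t
  proof (induction t)
    case (MGen d)
    show ?case by (cases d) simp_all
  qed (simp_all add: lw words)
  have TH: "\<lbrakk>gT\<rbrakk>\<^sub>H \<in> Part TAH 0 [Strand, Strand] [Strand, Strand]"
    by (rule TAH_part) (simp_all, simp_all add: TAH_pres_def)
  have TS: "\<lbrakk>gT\<rbrakk>\<^sub>S \<in> Part TAS 1 [Strand, Strand] [Strand, Strand]"
    by (rule TAS_part) (simp_all, simp_all add: TAS_pres_def)
  have H: "FH.even_crossing \<lbrakk>gT\<rbrakk>\<^sub>H" "FH.pin_square"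
    by (rule FH.even_crossingI[OF TH, of "\<lambda>Q. Q"], simp_all add: idH TAH_rel_eq)+
  have S: "FS.odd_crossing \<lbrakk>gT\<rbrakk>\<^sub>S" "FS.pin_square"
    by (rule FS.odd_crossingI[OF TS, of "\<lambda>Q. Q"], simp_all add: odot idS TAS_rel_eq)+
  define T' where "T' = Comp TAH (FH.ev [] (csc (- (1 / w)) cdiff)) \<lbrakk>gT\<rbrakk>\<^sub>H"
  define T'' where "T'' = Comp TAS (FS.ev [] (csc (1 / w) cdiff)) \<lbrakk>gT\<rbrakk>\<^sub>S"
  have odd: "FH.odd_crossing T'" unfolding T'_def by (rule FH.even_to_odd[OF H(1)])
  have even: "FS.even_crossing T''" unfolding T''_def by (rule FS.odd_to_even[OF S(1)])
  have T'_part: "T' \<in> Part TAH 1 [Strand, Strand] [Strand, Strand]"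
    using odd by (simp add: FH.odd_crossing_def FH.crossing_def)
  have T''_part: "T'' \<in> Part TAS 0 [Strand, Strand] [Strand, Strand]"
    using even by (simp add: FS.even_crossing_def FS.crossing_def)
  interpret F: representation TAS_pres TAH "FH.letter_word (psi_E w)" "FH.gen_value T' FH.odot (psi_E w)"
  proof (rule FH.value_typed[OF TAS_pins _ _ _ _ _ _ T'_part FH.odot_part TAS_graded])
    show "FH.value_of T' FH.odot (psi_E w) s = FH.value_of T' FH.odot (psi_E w) t" if "rel TAS_pres s t" for s t
      by (rule FH.odd_crossing_value[OF odd _ _ H(2)]) (use that psi_E_inv(1)[OF w] in \<open>simp_all add: TAS_pres_def\<close>)
  qed (use psi_E_inv(1)[OF w] in \<open>simp_all add: TAS_pres_def\<close>)
  interpret G: representation TAH_pres TAS "FS.letter_word (psi_E_inv w)" "FS.gen_value T'' \<lbrakk>MScal w (gC \<cdot> gX)\<rbrakk>\<^sub>S (psi_E_inv w)"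
  proof (rule FS.value_typed[OF TAH_pins _ _ _ _ _ _ T''_part FS.X_part TAH_graded])
    show "FS.value_of T'' \<lbrakk>MScal w (gC \<cdot> gX)\<rbrakk>\<^sub>S (psi_E_inv w) s = FS.value_of T'' \<lbrakk>MScal w (gC \<cdot> gX)\<rbrakk>\<^sub>S (psi_E_inv w) t"
      if "rel TAH_pres s t" for s t
      by (rule FS.even_crossing_value[OF even _ _ S(2)])
        (use that psi_E_inv(3,4)[OF w] in \<open>simp_all add: TAH_pres_def\<close>)
  qed (use psi_E_inv(3)[OF w] in \<open>simp_all add: TAH_pres_def\<close>)
  have hom: "\<lbrakk>gT\<rbrakk>\<^sub>H \<in> Hom TAH [Strand, Strand] [Strand, Strand]" "\<lbrakk>gT\<rbrakk>\<^sub>S \<in> Hom TAS [Strand, Strand] [Strand, Strand]"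
    "T' \<in> Hom TAH [Strand, Strand] [Strand, Strand]" "T'' \<in> Hom TAS [Strand, Strand] [Strand, Strand]"
    using FH.part_hom[OF TH] FS.part_hom[OF TS] FH.part_hom[OF T'_part] FS.part_hom[OF T''_part] .
  have T': "T' = \<lbrakk>MScal (- (1 / w)) ((gC \<otimes> idI \<ominus> idI \<otimes> gC) \<cdot> gT)\<rbrakk>\<^sub>H"
    unfolding T'_def FH.twist_expand[OF hom(1)] by simp
  have T'': "T'' = \<lbrakk>MScal (1 / w) ((gC \<otimes> idI \<ominus> idI \<otimes> gC) \<cdot> gT)\<rbrakk>\<^sub>S"
    unfolding T''_def FS.twist_expand[OF hom(2)] by simp
  have odotH: "FH.odot = \<lbrakk>MScal (1 / w) (gC \<cdot> gX)\<rbrakk>\<^sub>H" by (simp add: FH.odot_def)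
  have Fgen: "F.induced \<lbrakk>MGen d\<rbrakk>\<^sub>S = FH.gen_value T' FH.odot (psi_E w) d" if "d \<in> gens TAS_pres" for d
    using that by (subst F.induced_mcls) simp_all
  have Ggen: "G.induced \<lbrakk>MGen d\<rbrakk>\<^sub>H = FS.gen_value T'' \<lbrakk>MScal w (gC \<cdot> gX)\<rbrakk>\<^sub>S (psi_E_inv w) d" if "d \<in> gens TAH_pres" for d
    using that by (subst G.induced_mcls) simp_all
  \<comment> \<open>The two twists compose to the identity because of the squares of \<open>c\<^sub>1 - c\<^sub>2\<close> and \<open>w\<close>.\<close>
  have wz: "- (1 / w) * (1 / w) * 2 = 1" "1 / w * (- (1 / w)) * 2 = 1"
    using w FH.w_reciprocal(1) by (simp_all add: field_simps power2_eq_square)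
  have GT: "G.induced T' = \<lbrakk>gT\<rbrakk>\<^sub>S"
  proof -
    have "G.induced T' = Scal TAS (- (1 / w)) (Comp TAS (Add TAS (Tens TAS \<lbrakk>gC\<rbrakk>\<^sub>S (Ident TAS [Strand]))
        (Scal TAS (-1) (Tens TAS (Ident TAS [Strand]) \<lbrakk>gC\<rbrakk>\<^sub>S))) T'')"
      unfolding T' by (subst G.induced_mcls) (simp_all del: S.presented_ops S.presented_objs)
    also have "\<dots> = Comp TAS (FS.ev [] (csc (- (1 / w)) cdiff)) T''"
      by (rule FS.twist_expand[OF hom(4), symmetric])
    also have "\<dots> = \<lbrakk>gT\<rbrakk>\<^sub>S" unfolding T''_def by (rule FS.twist_twist[OF hom(2) wz(1)])
    finally show ?thesis .
  qed
  have FT: "F.induced T'' = \<lbrakk>gT\<rbrakk>\<^sub>H"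
  proof -
    have "F.induced T'' = Scal TAH (1 / w) (Comp TAH (Add TAH (Tens TAH \<lbrakk>gC\<rbrakk>\<^sub>H (Ident TAH [Strand]))
        (Scal TAH (-1) (Tens TAH (Ident TAH [Strand]) \<lbrakk>gC\<rbrakk>\<^sub>H))) T')"
      unfolding T'' by (subst F.induced_mcls) (simp_all del: H.presented_ops H.presented_objs)
    also have "\<dots> = Comp TAH (FH.ev [] (csc (1 / w) cdiff)) T'"
      by (rule FH.twist_expand[OF hom(3), symmetric])
    also have "\<dots> = \<lbrakk>gT\<rbrakk>\<^sub>H" unfolding T'_def by (rule FH.twist_twist[OF hom(1) wz(2)])
    finally show ?thesis .
  qed
  have GX: "G.induced FH.odot = \<lbrakk>gX\<rbrakk>\<^sub>S"
  proof -
    have "G.induced FH.odot = FS.odot"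
      unfolding odotH FS.odot_def by (subst G.induced_mcls) (simp_all del: S.presented_ops)
    then show ?thesis by (simp only: odot)
  qed
  have FX: "F.induced \<lbrakk>MScal w (gC \<cdot> gX)\<rbrakk>\<^sub>S = \<lbrakk>gX\<rbrakk>\<^sub>H"
  proof -
    have "F.induced \<lbrakk>MScal w (gC \<cdot> gX)\<rbrakk>\<^sub>S = Scal TAH w (Comp TAH \<lbrakk>gC\<rbrakk>\<^sub>H FH.odot)"
      by (subst F.induced_mcls) (simp_all del: H.presented_ops)
    also have "\<dots> = \<lbrakk>gX\<rbrakk>\<^sub>H" by (rule FH.dot_of_odot)
    finally show ?thesis .
  qed
  let ?Fo = "\<lambda>a. concat (map (FH.letter_word (psi_E w)) a)"
  let ?Go = "\<lambda>a. concat (map (FS.letter_word (psi_E_inv w)) a)"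
  have GF_obj: "?Go (?Fo a) = a" if "a \<in> lists (letters TAS_pres)" for a
    using that
  proof (induction a)
    case (Cons l a)
    then show ?case using psi_E_inv(2)[OF w] by (cases l) auto
  qed simp
  have FG_obj: "?Fo (?Go a) = a" if "a \<in> lists (letters TAH_pres)" for a
    using that
  proof (induction a)
    case (Cons l a)
    then show ?case using psi_E_inv(4)[OF w] by (cases l) auto
  qed simp
  have GF: "G.induced (F.induced f) = f" if "f \<in> Hom TAS a b" for f a b
  proof (rule S.generators_fixed[OF F.induced_superfunctor G.induced_superfunctor GF_obj _ that])
    fix d assume d: "d \<in> gens TAS_pres"
    show "G.induced (F.induced \<lbrakk>MGen d\<rbrakk>\<^sub>S) = \<lbrakk>MGen d\<rbrakk>\<^sub>S"
      unfolding Fgen[OF d] using d psi_E_inv(1,2)[OF w] by (auto simp: GT GX Ggen)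
  qed
  have FG: "F.induced (G.induced f) = f" if "f \<in> Hom TAH a b" for f a b
  proof (rule H.generators_fixed[OF G.induced_superfunctor F.induced_superfunctor FG_obj _ that])
    fix d assume d: "d \<in> gens TAH_pres"
    show "F.induced (G.induced \<lbrakk>MGen d\<rbrakk>\<^sub>H) = \<lbrakk>MGen d\<rbrakk>\<^sub>H"
      unfolding Ggen[OF d] using d psi_E_inv(3,4)[OF w] by (auto simp: FT FX Fgen)
  qed
  have inv: "inverse_superfunctors TAS TAH ?Fo F.induced ?Go G.induced"
    unfolding inverse_superfunctors_def
    using F.induced_superfunctor G.induced_superfunctor GF_obj FG_obj GF FG by simp
  show ?thesis
    by (intro exI[of _ ?Fo] exI[of _ F.induced] exI[of _ ?Go] exI[of _ G.induced] conjI ballI inv)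
      (use psi_E_inv(1,3)[OF w] in \<open>simp_all add: Fgen Ggen T'[symmetric] T''[symmetric] odotH[symmetric]\<close>)
qed

end
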